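(* Let $k$ be a commutative ring, $H$ a weak bialgebra over $k$, and $M,N$ left $H$-modules. Then $M$ and $N$ are $H_t$-bimodules and $H_t$-bicomodules (with the structures given in the context), and $$M\otimes^{H_t}N=M\otimes^l N\cong M\otimes_l N=M\otimes_{H_t}N,$$ where the first equality is an equality of submodules of $M\otimes N$, and the last one an equality of quotients of $M\otimes N$.
   Context: Conventions. $k$ is a commutative ring and $\otimes=\otimes_k$. A $k$-prebialgebra is a $k$-module $H$ that is both an associative unital $k$-algebra (unit $1$) and a coassociative counital $k$-coalgebra ($\Delta$, $\varepsilon$) such that $\Delta(hk)=\Delta(h)\Delta(k)$ for all $h,k\in H$. Sweedler notation: $\Delta(h)=h_{(1)}\otimes h_{(2)}$, $\Delta(1)=1_{(1)}\otimes 1_{(2)}=1_{(1')}\otimes 1_{(2')}$, $\Delta^2=(\Delta\otimes H)\circ\Delta$. A weak bialgebra is a prebialgebra satisfying all four axioms (for all $h,k,l\in H$): (lm) $\varepsilon(hkl)=\varepsilon(hk_{(1)})\varepsilon(k_{(2)}l)$; (rm) $\varepsilon(hkl)=\varepsilon(hk_{(2)})\varepsilon(k_{(1)}l)$; (lc) $\Delta^2(1)=1_{(1)}\otimes 1_{(2)}1_{(1')}\otimes 1_{(2')}$; (rc) $\Delta^2(1)=1_{(1)}\otimes 1_{(1')}1_{(2)}\otimes 1_{(2')}$. Let $\varepsilon_t(h)=\langle\varepsilon,1_{(1)}h\rangle 1_{(2)}$, $\overline{\varepsilon}_s(h)=\langle\varepsilon,1_{(2)}h\rangle 1_{(1)}$,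 and $H_t=\mathrm{Im}(\varepsilon_t)$. $H_t$ is a subalgebra of $H$, and a coalgebra with comultiplication $\Delta_t(z)=\varepsilon_t(1_{(1)}z)\otimes\varepsilon_t(1_{(2)})$ and counit $\varepsilon|_{H_t}$. On a left $H$-module $M$ the $H_t$-actions are $z\triangleright m=zm$ and $m\triangleleft z=\overline{\varepsilon}_s(z)m$, and the right and left $H_t$-coactions are $m\mapsto 1_{(1)}m\otimes\varepsilon_t(1_{(2)})$ and $m\mapsto\varepsilon_t(1_{(1)})\otimes 1_{(2)}m$. For left $H$-modules $M,N$, let $\pi:M\otimes N\to M\otimes N$, $\pi(m\otimes n)=1_{(1)}m\otimes 1_{(2)}n$ (an idempotent map), $M\otimes^l N=\mathrm{Im}(\pi)$ and $M\otimes_l N=(M\otimes N)/\mathrm{Ker}(\pi)$. The isomorphism $M\otimes_l N\cong M\otimes^l N$ is the one induced by $\pi$. $M\otimes^{H_t}N$ is the cotensor product, i.e. the set of $\sum_i m_i\otimes n_i\in M\otimes N$ with $\sum_i 1_{(1)}m_i\otimes\varepsilon_t(1_{(2)})\otimes n_i=\sum_i m_i\otimes\varepsilon_t(1_{(1)})\otimes 1_{(2)}n_i$. $M\otimes_{H_t}N$ is the quotient of $M\otimes N$ by the submodule generated by all $m\triangleleft z\otimes n-m\otimes z\triangleright n$. *)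

theory Defs
  imports "HOL.Hull" "HOL-Algebra.AbelCoset" "HOL-Algebra.Module"
begin

section \<open>Linear maps, quotients, and tensor products over a commutative ring\<close>

text \<open>
  A k-module is a \<^term>\<open>module\<close> record; the ring fields \<open>mult\<close> and \<open>one\<close> are
  meaningful only when the record also carries an algebra, and are left \<open>undefined\<close> in
  the constructions below.
\<close>

definition lin ::
  "('k, 'e) ring_scheme \<Rightarrow> ('k, 'a, 'u) module_scheme \<Rightarrow> ('k, 'b, 'v) module_scheme \<Rightarrow> ('a \<Rightarrow> 'b) set"
  where "lin k M N = {f \<in> carrier M \<rightarrow> carrier N.
      (\<forall>x\<in>carrier M. \<forall>y\<in>carrier M. f (x \<oplus>\<^bsub>M\<^esub> y) = f x \<oplus>\<^bsub>N\<^esub> f y) \<and>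
      (\<forall>r\<in>carrier k. \<forall>x\<in>carrier M. f (r \<odot>\<^bsub>M\<^esub> x) = r \<odot>\<^bsub>N\<^esub> f x)}"

definition lin_iso ::
  "('k, 'e) ring_scheme \<Rightarrow> ('k, 'a, 'u) module_scheme \<Rightarrow> ('k, 'b, 'v) module_scheme \<Rightarrow> ('a \<Rightarrow> 'b) set"
  where "lin_iso k M N = {f \<in> lin k M N. bij_betw f (carrier M) (carrier N)}"

definition regular_module :: "('k, 'e) ring_scheme \<Rightarrow> ('k, 'k) module"
  where "regular_module k = \<lparr>carrier = carrier k, mult = mult k, one = \<one>\<^bsub>k\<^esub>,
      zero = \<zero>\<^bsub>k\<^esub>, add = add k, smult = mult k\<rparr>"

definition module_gen ::
  "('k, 'e) ring_scheme \<Rightarrow> ('k, 'a, 'u) module_scheme \<Rightarrow> 'a set \<Rightarrow> 'a set"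
  where "module_gen k M X = (\<lambda>S. submodule S k M) hull X"

text \<open>
  Elements of the quotient are cosets of \<open>S\<close>. All the cosets in the union that defines
  \<open>smult\<close> coincide when \<open>S\<close> is a submodule.
\<close>

definition quot_module :: "('k, 'a, 'u) module_scheme \<Rightarrow> 'a set \<Rightarrow> ('k, 'a set) module"
  where "quot_module M S = \<lparr>carrier = a_rcosets\<^bsub>M\<^esub> S, mult = undefined, one = undefined,
      zero = S, add = set_add M, smult = (\<lambda>r C. \<Union>x\<in>C. S +>\<^bsub>M\<^esub> (r \<odot>\<^bsub>M\<^esub> x))\<rparr>"

definition free_module :: "('k, 'e) ring_scheme \<Rightarrow> 'x set \<Rightarrow> ('k, 'x \<Rightarrow> 'k) module"
  where "free_module k X = \<lparr>carrier = {f. (\<forall>x. f x \<in> carrier k) \<and>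
        finite {x. f x \<noteq> \<zero>\<^bsub>k\<^esub>} \<and> {x. f x \<noteq> \<zero>\<^bsub>k\<^esub>} \<subseteq> X},
      mult = undefined, one = undefined, zero = (\<lambda>x. \<zero>\<^bsub>k\<^esub>),
      add = (\<lambda>f g x. f x \<oplus>\<^bsub>k\<^esub> g x), smult = (\<lambda>r f x. r \<otimes>\<^bsub>k\<^esub> f x)\<rparr>"

definition free_gen :: "('k, 'e) ring_scheme \<Rightarrow> 'x \<Rightarrow> 'x \<Rightarrow> 'k"
  where "free_gen k x = (\<lambda>y. if y = x then \<one>\<^bsub>k\<^esub> else \<zero>\<^bsub>k\<^esub>)"

type_synonym ('k, 'm, 'n) tens = "('m \<times> 'n \<Rightarrow> 'k) set"

definition tensor_rel ::
  "('k, 'e) ring_scheme \<Rightarrow> ('k, 'm, 'u) module_scheme \<Rightarrow> ('k, 'n, 'v) module_scheme \<Rightarrow> ('m \<times> 'n \<Rightarrow> 'k) set"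
  where "tensor_rel k M N =
    (let F = free_module k (carrier M \<times> carrier N); \<delta> = free_gen k in
      module_gen k F
        ({\<delta> (x \<oplus>\<^bsub>M\<^esub> y, z) \<ominus>\<^bsub>F\<^esub> (\<delta> (x, z) \<oplus>\<^bsub>F\<^esub> \<delta> (y, z)) | x y z.
            x \<in> carrier M \<and> y \<in> carrier M \<and> z \<in> carrier N} \<union>
         {\<delta> (x, y \<oplus>\<^bsub>N\<^esub> z) \<ominus>\<^bsub>F\<^esub> (\<delta> (x, y) \<oplus>\<^bsub>F\<^esub> \<delta> (x, z)) | x y z.
            x \<in> carrier M \<and> y \<in> carrier N \<and> z \<in> carrier N} \<union>
         {\<delta> (r \<odot>\<^bsub>M\<^esub> x, y) \<ominus>\<^bsub>F\<^esub> r \<odot>\<^bsub>F\<^esub> \<delta> (x, y) | r x y.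
            r \<in> carrier k \<and> x \<in> carrier M \<and> y \<in> carrier N} \<union>
         {\<delta> (x, r \<odot>\<^bsub>N\<^esub> y) \<ominus>\<^bsub>F\<^esub> r \<odot>\<^bsub>F\<^esub> \<delta> (x, y) | r x y.
            r \<in> carrier k \<and> x \<in> carrier M \<and> y \<in> carrier N}))"

definition tensor ::
  "('k, 'e) ring_scheme \<Rightarrow> ('k, 'm, 'u) module_scheme \<Rightarrow> ('k, 'n, 'v) module_scheme
    \<Rightarrow> ('k, ('k, 'm, 'n) tens) module"
  where "tensor k M N =
    quot_module (free_module k (carrier M \<times> carrier N)) (tensor_rel k M N)"

definition pure ::
  "('k, 'e) ring_scheme \<Rightarrow> ('k, 'm, 'u) module_scheme \<Rightarrow> ('k, 'n, 'v) module_scheme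
    \<Rightarrow> 'm \<Rightarrow> 'n \<Rightarrow> ('k, 'm, 'n) tens"
  where "pure k M N m n =
    tensor_rel k M N +>\<^bsub>free_module k (carrier M \<times> carrier N)\<^esub> free_gen k (m, n)"

text \<open>
  The linear map on the tensor product of \<open>M\<close> and \<open>N\<close> induced by a bilinear map
  \<open>\<beta>\<close> into \<open>P\<close>. For bilinear \<open>\<beta>\<close> the value does not depend on the chosen
  representative. It also renders Sweedler notation: if \<open>u\<close> is the sum of the pure tensors
  of \<open>a\<^sub>i\<close> and \<open>b\<^sub>i\<close>, then \<open>lift k M N P \<beta> u\<close> is the sum of the
  \<open>\<beta> a\<^sub>i b\<^sub>i\<close>.
\<close>

definition lift ::
  "('k, 'e) ring_scheme \<Rightarrow> ('k, 'm, 'u) module_scheme \<Rightarrow> ('k, 'n, 'v) module_scheme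
    \<Rightarrow> ('k, 'p, 'w) module_scheme \<Rightarrow> ('m \<Rightarrow> 'n \<Rightarrow> 'p) \<Rightarrow> ('k, 'm, 'n) tens \<Rightarrow> 'p"
  where "lift k M N P \<beta> u =
    (let f = (SOME f. f \<in> u) in
      finsum P (\<lambda>p. f p \<odot>\<^bsub>P\<^esub> \<beta> (fst p) (snd p)) {p. f p \<noteq> \<zero>\<^bsub>k\<^esub>})"

text \<open>Threefold tensor products are bracketed to the left.\<close>

definition tensor3 ::
  "('k, 'e) ring_scheme \<Rightarrow> ('k, 'a, 'u) module_scheme \<Rightarrow> ('k, 'b, 'v) module_scheme
    \<Rightarrow> ('k, 'c, 'w) module_scheme \<Rightarrow> ('k, ('k, ('k, 'a, 'b) tens, 'c) tens) module"
  where "tensor3 k A B C = tensor k (tensor k A B) C"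

definition pure3 ::
  "('k, 'e) ring_scheme \<Rightarrow> ('k, 'a, 'u) module_scheme \<Rightarrow> ('k, 'b, 'v) module_scheme
    \<Rightarrow> ('k, 'c, 'w) module_scheme \<Rightarrow> 'a \<Rightarrow> 'b \<Rightarrow> 'c \<Rightarrow> ('k, ('k, 'a, 'b) tens, 'c) tens"
  where "pure3 k A B C a b c = pure k (tensor k A B) C (pure k A B a b) c"

text \<open>\<open>extl\<close> and \<open>extr\<close> tensor an element of a twofold tensor product with \<open>c\<close> on the
  right, respectively with \<open>a\<close> on the left and rebracket.\<close>

definition extl ::
  "('k, 'e) ring_scheme \<Rightarrow> ('k, 'a, 'u) module_scheme \<Rightarrow> ('k, 'b, 'v) module_scheme
    \<Rightarrow> ('k, 'c, 'w) module_scheme \<Rightarrow> ('k, 'a, 'b) tens \<Rightarrow> 'c \<Rightarrow> ('k, ('k, 'a, 'b) tens, 'c) tens"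
  where "extl k A B C u c = pure k (tensor k A B) C u c"

definition extr ::
  "('k, 'e) ring_scheme \<Rightarrow> ('k, 'a, 'u) module_scheme \<Rightarrow> ('k, 'b, 'v) module_scheme
    \<Rightarrow> ('k, 'c, 'w) module_scheme \<Rightarrow> 'a \<Rightarrow> ('k, 'b, 'c) tens \<Rightarrow> ('k, ('k, 'a, 'b) tens, 'c) tens"
  where "extr k A B C a u = lift k B C (tensor3 k A B C) (\<lambda>b c. pure3 k A B C a b c) u"


section \<open>Algebras, coalgebras, bimodules, bicomodules\<close>

text \<open>Unlike the library's \<^locale>\<open>algebra\<close>, the multiplication need not commute.\<close>

locale assoc_algebra = module k A + A: ring A
  for k :: "('k, 'e) ring_scheme" and A :: "('k, 'a, 'u) module_scheme" +
  assumes smult_mult_l: "\<lbrakk>r \<in> carrier k; x \<in> carrier A; y \<in> carrier A\<rbrakk>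
      \<Longrightarrow> (r \<odot>\<^bsub>A\<^esub> x) \<otimes>\<^bsub>A\<^esub> y = r \<odot>\<^bsub>A\<^esub> (x \<otimes>\<^bsub>A\<^esub> y)"
    and smult_mult_r: "\<lbrakk>r \<in> carrier k; x \<in> carrier A; y \<in> carrier A\<rbrakk>
      \<Longrightarrow> x \<otimes>\<^bsub>A\<^esub> (r \<odot>\<^bsub>A\<^esub> y) = r \<odot>\<^bsub>A\<^esub> (x \<otimes>\<^bsub>A\<^esub> y)"

locale left_module = A: assoc_algebra k A + M: module k M
  for k :: "('k, 'e) ring_scheme" and A :: "('k, 'a, 'u) module_scheme"
    and M :: "('k, 'm, 'v) module_scheme" and l :: "'a \<Rightarrow> 'm \<Rightarrow> 'm" +
  assumes l_lin_scalar: "m \<in> carrier M \<Longrightarrow> (\<lambda>a. l a m) \<in> lin k A M"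
    and l_lin: "a \<in> carrier A \<Longrightarrow> l a \<in> lin k M M"
    and l_assoc: "\<lbrakk>a \<in> carrier A; b \<in> carrier A; m \<in> carrier M\<rbrakk> \<Longrightarrow> l (a \<otimes>\<^bsub>A\<^esub> b) m = l a (l b m)"
    and l_one: "m \<in> carrier M \<Longrightarrow> l \<one>\<^bsub>A\<^esub> m = m"

locale right_module = A: assoc_algebra k A + M: module k M
  for k :: "('k, 'e) ring_scheme" and A :: "('k, 'a, 'u) module_scheme"
    and M :: "('k, 'm, 'v) module_scheme" and r :: "'m \<Rightarrow> 'a \<Rightarrow> 'm" +
  assumes r_lin_scalar: "m \<in> carrier M \<Longrightarrow> r m \<in> lin k A M"
    and r_lin: "a \<in> carrier A \<Longrightarrow> (\<lambda>m. r m a) \<in> lin k M M"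
    and r_assoc: "\<lbrakk>a \<in> carrier A; b \<in> carrier A; m \<in> carrier M\<rbrakk> \<Longrightarrow> r m (a \<otimes>\<^bsub>A\<^esub> b) = r (r m a) b"
    and r_one: "m \<in> carrier M \<Longrightarrow> r m \<one>\<^bsub>A\<^esub> = m"

locale bimodule = left_module k A M l + right_module k A M r
  for k :: "('k, 'e) ring_scheme" and A :: "('k, 'a, 'u) module_scheme"
    and M :: "('k, 'm, 'v) module_scheme" and l :: "'a \<Rightarrow> 'm \<Rightarrow> 'm" and r :: "'m \<Rightarrow> 'a \<Rightarrow> 'm" +
  assumes l_r_commute: "\<lbrakk>a \<in> carrier A; b \<in> carrier A; m \<in> carrier M\<rbrakk> \<Longrightarrow> r (l a m) b = l a (r m b)"

locale coalgebra = module k C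
  for k :: "('k, 'e) ring_scheme" and C :: "('k, 'c, 'u) module_scheme"
    and \<Delta> :: "'c \<Rightarrow> ('k, 'c, 'c) tens" and \<epsilon> :: "'c \<Rightarrow> 'k" +
  assumes comult_lin: "\<Delta> \<in> lin k C (tensor k C C)"
    and counit_lin: "\<epsilon> \<in> lin k C (regular_module k)"
    and coassoc: "c \<in> carrier C \<Longrightarrow>
      lift k C C (tensor3 k C C C) (\<lambda>a b. extl k C C C (\<Delta> a) b) (\<Delta> c) =
      lift k C C (tensor3 k C C C) (\<lambda>a b. extr k C C C a (\<Delta> b)) (\<Delta> c)"
    and counit_l: "c \<in> carrier C \<Longrightarrow> lift k C C C (\<lambda>a b. \<epsilon> a \<odot>\<^bsub>C\<^esub> b) (\<Delta> c) = c"
    and counit_r: "c \<in> carrier C \<Longrightarrow> lift k C C C (\<lambda>a b. \<epsilon> b \<odot>\<^bsub>C\<^esub> a) (\<Delta> c) = c"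

locale right_comodule = C: coalgebra k C \<Delta> \<epsilon> + M: module k M
  for k :: "('k, 'e) ring_scheme" and C :: "('k, 'c, 'u) module_scheme"
    and \<Delta> :: "'c \<Rightarrow> ('k, 'c, 'c) tens" and \<epsilon> :: "'c \<Rightarrow> 'k"
    and M :: "('k, 'm, 'v) module_scheme" and \<rho> :: "'m \<Rightarrow> ('k, 'm, 'c) tens" +
  assumes rho_lin: "\<rho> \<in> lin k M (tensor k M C)"
    and rho_coassoc: "m \<in> carrier M \<Longrightarrow>
      lift k M C (tensor3 k M C C) (\<lambda>n c. extl k M C C (\<rho> n) c) (\<rho> m) =
      lift k M C (tensor3 k M C C) (\<lambda>n c. extr k M C C n (\<Delta> c)) (\<rho> m)"
    and rho_counit: "m \<in> carrier M \<Longrightarrow> lift k M C M (\<lambda>n c. \<epsilon> c \<odot>\<^bsub>M\<^esub> n) (\<rho> m) = m"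

locale left_comodule = C: coalgebra k C \<Delta> \<epsilon> + M: module k M
  for k :: "('k, 'e) ring_scheme" and C :: "('k, 'c, 'u) module_scheme"
    and \<Delta> :: "'c \<Rightarrow> ('k, 'c, 'c) tens" and \<epsilon> :: "'c \<Rightarrow> 'k"
    and M :: "('k, 'm, 'v) module_scheme" and \<theta> :: "'m \<Rightarrow> ('k, 'c, 'm) tens" +
  assumes theta_lin: "\<theta> \<in> lin k M (tensor k C M)"
    and theta_coassoc: "m \<in> carrier M \<Longrightarrow>
      lift k C M (tensor3 k C C M) (\<lambda>c n. extl k C C M (\<Delta> c) n) (\<theta> m) =
      lift k C M (tensor3 k C C M) (\<lambda>c n. extr k C C M c (\<theta> n)) (\<theta> m)"
    and theta_counit: "m \<in> carrier M \<Longrightarrow> lift k C M M (\<lambda>c n. \<epsilon> c \<odot>\<^bsub>M\<^esub> n) (\<theta> m) = m"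

locale bicomodule = left_comodule k C \<Delta> \<epsilon> M \<theta> + right_comodule k C \<Delta> \<epsilon> M \<rho>
  for k :: "('k, 'e) ring_scheme" and C :: "('k, 'c, 'u) module_scheme"
    and \<Delta> :: "'c \<Rightarrow> ('k, 'c, 'c) tens" and \<epsilon> :: "'c \<Rightarrow> 'k"
    and M :: "('k, 'm, 'v) module_scheme" and \<theta> :: "'m \<Rightarrow> ('k, 'c, 'm) tens"
    and \<rho> :: "'m \<Rightarrow> ('k, 'm, 'c) tens" +
  assumes theta_rho_commute: "m \<in> carrier M \<Longrightarrow>
      lift k M C (tensor3 k C M C) (\<lambda>n c. extl k C M C (\<theta> n) c) (\<rho> m) =
      lift k C M (tensor3 k C M C) (\<lambda>c n. extr k C M C c (\<rho> n)) (\<theta> m)"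

definition balanced_tensor ::
  "('k, 'e) ring_scheme \<Rightarrow> ('k, 'a, 't) module_scheme \<Rightarrow> ('k, 'm, 'u) module_scheme
    \<Rightarrow> ('k, 'n, 'v) module_scheme \<Rightarrow> ('m \<Rightarrow> 'a \<Rightarrow> 'm) \<Rightarrow> ('a \<Rightarrow> 'n \<Rightarrow> 'n)
    \<Rightarrow> ('k, ('k, 'm, 'n) tens set) module"
  where "balanced_tensor k A M N r l =
    quot_module (tensor k M N) (module_gen k (tensor k M N)
      {pure k M N (r m a) n \<ominus>\<^bsub>tensor k M N\<^esub> pure k M N m (l a n) | m a n.
        m \<in> carrier M \<and> a \<in> carrier A \<and> n \<in> carrier N})"

definition cotensor ::
  "('k, 'e) ring_scheme \<Rightarrow> ('k, 'c, 't) module_scheme \<Rightarrow> ('k, 'm, 'u) module_scheme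
    \<Rightarrow> ('k, 'n, 'v) module_scheme \<Rightarrow> ('m \<Rightarrow> ('k, 'm, 'c) tens) \<Rightarrow> ('n \<Rightarrow> ('k, 'c, 'n) tens)
    \<Rightarrow> ('k, 'm, 'n) tens set"
  where "cotensor k C M N \<rho> \<theta> = {x \<in> carrier (tensor k M N).
      lift k M N (tensor3 k M C N) (\<lambda>m n. extl k M C N (\<rho> m) n) x =
      lift k M N (tensor3 k M C N) (\<lambda>m n. extr k M C N m (\<theta> n)) x}"


section \<open>Weak bialgebras\<close>

locale prebialgebra = assoc_algebra k H + coalgebra k H \<Delta> \<epsilon>
  for k :: "('k, 'e) ring_scheme" and H :: "('k, 'h, 'u) module_scheme"
    and \<Delta> :: "'h \<Rightarrow> ('k, 'h, 'h) tens" and \<epsilon> :: "'h \<Rightarrow> 'k" +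
  assumes comult_mult: "\<lbrakk>h \<in> carrier H; g \<in> carrier H\<rbrakk> \<Longrightarrow>
      \<Delta> (h \<otimes>\<^bsub>H\<^esub> g) =
      lift k H H (tensor k H H) (\<lambda>a b. lift k H H (tensor k H H)
        (\<lambda>c d. pure k H H (a \<otimes>\<^bsub>H\<^esub> c) (b \<otimes>\<^bsub>H\<^esub> d)) (\<Delta> g)) (\<Delta> h)"

locale weak_bialgebra = prebialgebra k H \<Delta> \<epsilon>
  for k :: "('k, 'e) ring_scheme" and H :: "('k, 'h, 'u) module_scheme"
    and \<Delta> :: "'h \<Rightarrow> ('k, 'h, 'h) tens" and \<epsilon> :: "'h \<Rightarrow> 'k" +
  assumes left_monoidal: "\<lbrakk>h \<in> carrier H; g \<in> carrier H; l \<in> carrier H\<rbrakk> \<Longrightarrow>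
      \<epsilon> (h \<otimes>\<^bsub>H\<^esub> g \<otimes>\<^bsub>H\<^esub> l) =
      lift k H H (regular_module k) (\<lambda>a b. \<epsilon> (h \<otimes>\<^bsub>H\<^esub> a) \<otimes>\<^bsub>k\<^esub> \<epsilon> (b \<otimes>\<^bsub>H\<^esub> l)) (\<Delta> g)"
    and right_monoidal: "\<lbrakk>h \<in> carrier H; g \<in> carrier H; l \<in> carrier H\<rbrakk> \<Longrightarrow>
      \<epsilon> (h \<otimes>\<^bsub>H\<^esub> g \<otimes>\<^bsub>H\<^esub> l) =
      lift k H H (regular_module k) (\<lambda>a b. \<epsilon> (h \<otimes>\<^bsub>H\<^esub> b) \<otimes>\<^bsub>k\<^esub> \<epsilon> (a \<otimes>\<^bsub>H\<^esub> l)) (\<Delta> g)"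
    and left_comonoidal:
      "lift k H H (tensor3 k H H H) (\<lambda>a b. extl k H H H (\<Delta> a) b) (\<Delta> \<one>\<^bsub>H\<^esub>) =
       lift k H H (tensor3 k H H H) (\<lambda>a b. lift k H H (tensor3 k H H H)
         (\<lambda>c d. pure3 k H H H a (b \<otimes>\<^bsub>H\<^esub> c) d) (\<Delta> \<one>\<^bsub>H\<^esub>)) (\<Delta> \<one>\<^bsub>H\<^esub>)"
    and right_comonoidal:
      "lift k H H (tensor3 k H H H) (\<lambda>a b. extl k H H H (\<Delta> a) b) (\<Delta> \<one>\<^bsub>H\<^esub>) =
       lift k H H (tensor3 k H H H) (\<lambda>a b. lift k H H (tensor3 k H H H)
         (\<lambda>c d. pure3 k H H H a (c \<otimes>\<^bsub>H\<^esub> b) d) (\<Delta> \<one>\<^bsub>H\<^esub>)) (\<Delta> \<one>\<^bsub>H\<^esub>)"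

definition eps_t ::
  "('k, 'e) ring_scheme \<Rightarrow> ('k, 'h, 'u) module_scheme \<Rightarrow> ('h \<Rightarrow> ('k, 'h, 'h) tens) \<Rightarrow> ('h \<Rightarrow> 'k)
    \<Rightarrow> 'h \<Rightarrow> 'h"
  where "eps_t k H \<Delta> \<epsilon> h = lift k H H H (\<lambda>a b. \<epsilon> (a \<otimes>\<^bsub>H\<^esub> h) \<odot>\<^bsub>H\<^esub> b) (\<Delta> \<one>\<^bsub>H\<^esub>)"

definition eps_s_bar ::
  "('k, 'e) ring_scheme \<Rightarrow> ('k, 'h, 'u) module_scheme \<Rightarrow> ('h \<Rightarrow> ('k, 'h, 'h) tens) \<Rightarrow> ('h \<Rightarrow> 'k)
    \<Rightarrow> 'h \<Rightarrow> 'h"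
  where "eps_s_bar k H \<Delta> \<epsilon> h = lift k H H H (\<lambda>a b. \<epsilon> (b \<otimes>\<^bsub>H\<^esub> h) \<odot>\<^bsub>H\<^esub> a) (\<Delta> \<one>\<^bsub>H\<^esub>)"

definition target ::
  "('k, 'e) ring_scheme \<Rightarrow> ('k, 'h) module \<Rightarrow> ('h \<Rightarrow> ('k, 'h, 'h) tens) \<Rightarrow> ('h \<Rightarrow> 'k)
    \<Rightarrow> ('k, 'h) module"
  where "target k H \<Delta> \<epsilon> = H\<lparr>carrier := eps_t k H \<Delta> \<epsilon> ` carrier H\<rparr>"

definition comult_t ::
  "('k, 'e) ring_scheme \<Rightarrow> ('k, 'h) module \<Rightarrow> ('h \<Rightarrow> ('k, 'h, 'h) tens) \<Rightarrow> ('h \<Rightarrow> 'k)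
    \<Rightarrow> 'h \<Rightarrow> ('k, 'h, 'h) tens"
  where "comult_t k H \<Delta> \<epsilon> z =
    (let Ht = target k H \<Delta> \<epsilon>; e = eps_t k H \<Delta> \<epsilon> in
      lift k H H (tensor k Ht Ht) (\<lambda>a b. pure k Ht Ht (e (a \<otimes>\<^bsub>H\<^esub> z)) (e b)) (\<Delta> \<one>\<^bsub>H\<^esub>))"

text \<open>
  Bimodule and bicomodule structures over \<open>target\<close> on a left \<open>H\<close>-module \<open>M\<close> with action
  \<open>act\<close>. The left action of \<open>target\<close> is \<open>act\<close> itself. The coactions take values in tensor
  products with \<open>target\<close>, not with \<open>H\<close>.
\<close>

definition ract_t ::
  "('k, 'e) ring_scheme \<Rightarrow> ('k, 'h) module \<Rightarrow> ('h \<Rightarrow> ('k, 'h, 'h) tens) \<Rightarrow> ('h \<Rightarrow> 'k)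
    \<Rightarrow> ('h \<Rightarrow> 'm \<Rightarrow> 'm) \<Rightarrow> 'm \<Rightarrow> 'h \<Rightarrow> 'm"
  where "ract_t k H \<Delta> \<epsilon> act m z = act (eps_s_bar k H \<Delta> \<epsilon> z) m"

definition rcoact_t ::
  "('k, 'e) ring_scheme \<Rightarrow> ('k, 'h) module \<Rightarrow> ('h \<Rightarrow> ('k, 'h, 'h) tens) \<Rightarrow> ('h \<Rightarrow> 'k)
    \<Rightarrow> ('k, 'm) module \<Rightarrow> ('h \<Rightarrow> 'm \<Rightarrow> 'm) \<Rightarrow> 'm \<Rightarrow> ('k, 'm, 'h) tens"
  where "rcoact_t k H \<Delta> \<epsilon> M act m =
    (let Ht = target k H \<Delta> \<epsilon>; e = eps_t k H \<Delta> \<epsilon> in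
      lift k H H (tensor k M Ht) (\<lambda>a b. pure k M Ht (act a m) (e b)) (\<Delta> \<one>\<^bsub>H\<^esub>))"

definition lcoact_t ::
  "('k, 'e) ring_scheme \<Rightarrow> ('k, 'h) module \<Rightarrow> ('h \<Rightarrow> ('k, 'h, 'h) tens) \<Rightarrow> ('h \<Rightarrow> 'k)
    \<Rightarrow> ('k, 'm) module \<Rightarrow> ('h \<Rightarrow> 'm \<Rightarrow> 'm) \<Rightarrow> 'm \<Rightarrow> ('k, 'h, 'm) tens"
  where "lcoact_t k H \<Delta> \<epsilon> M act m =
    (let Ht = target k H \<Delta> \<epsilon>; e = eps_t k H \<Delta> \<epsilon> in
      lift k H H (tensor k Ht M) (\<lambda>a b. pure k Ht M (e a) (act b m)) (\<Delta> \<one>\<^bsub>H\<^esub>))"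

definition proj ::
  "('k, 'e) ring_scheme \<Rightarrow> ('k, 'h) module \<Rightarrow> ('h \<Rightarrow> ('k, 'h, 'h) tens)
    \<Rightarrow> ('k, 'm) module \<Rightarrow> ('h \<Rightarrow> 'm \<Rightarrow> 'm) \<Rightarrow> ('k, 'n) module \<Rightarrow> ('h \<Rightarrow> 'n \<Rightarrow> 'n)
    \<Rightarrow> ('k, 'm, 'n) tens \<Rightarrow> ('k, 'm, 'n) tens"
  where "proj k H \<Delta> M actM N actN =
    lift k M N (tensor k M N) (\<lambda>m n. lift k H H (tensor k M N)
      (\<lambda>a b. pure k M N (actM a m) (actN b n)) (\<Delta> \<one>\<^bsub>H\<^esub>))"

definition tensor_im ::
  "('k, 'e) ring_scheme \<Rightarrow> ('k, 'h) module \<Rightarrow> ('h \<Rightarrow> ('k, 'h, 'h) tens)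
    \<Rightarrow> ('k, 'm) module \<Rightarrow> ('h \<Rightarrow> 'm \<Rightarrow> 'm) \<Rightarrow> ('k, 'n) module \<Rightarrow> ('h \<Rightarrow> 'n \<Rightarrow> 'n)
    \<Rightarrow> ('k, 'm, 'n) tens set"
  where "tensor_im k H \<Delta> M actM N actN =
    proj k H \<Delta> M actM N actN ` carrier (tensor k M N)"

definition proj_ker ::
  "('k, 'e) ring_scheme \<Rightarrow> ('k, 'h) module \<Rightarrow> ('h \<Rightarrow> ('k, 'h, 'h) tens)
    \<Rightarrow> ('k, 'm) module \<Rightarrow> ('h \<Rightarrow> 'm \<Rightarrow> 'm) \<Rightarrow> ('k, 'n) module \<Rightarrow> ('h \<Rightarrow> 'n \<Rightarrow> 'n)
    \<Rightarrow> ('k, 'm, 'n) tens set"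
  where "proj_ker k H \<Delta> M actM N actN =
    a_kernel (tensor k M N) (tensor k M N) (proj k H \<Delta> M actM N actN)"

definition tensor_coim ::
  "('k, 'e) ring_scheme \<Rightarrow> ('k, 'h) module \<Rightarrow> ('h \<Rightarrow> ('k, 'h, 'h) tens)
    \<Rightarrow> ('k, 'm) module \<Rightarrow> ('h \<Rightarrow> 'm \<Rightarrow> 'm) \<Rightarrow> ('k, 'n) module \<Rightarrow> ('h \<Rightarrow> 'n \<Rightarrow> 'n)
    \<Rightarrow> ('k, ('k, 'm, 'n) tens set) module"
  where "tensor_coim k H \<Delta> M actM N actN =
    quot_module (tensor k M N) (proj_ker k H \<Delta> M actM N actN)"

end

theory Submission
  imports Defs
begin

text \<open>
  The idea is that \<open>H\<^sub>t\<close> is a separable Frobenius algebra and that the statement holds for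
  bimodules over any such algebra. Let \<open>A\<close> be a \<open>k\<close>-algebra with a linear form \<open>\<epsilon>\<close> and an element
  \<open>e\<close> of \<open>A \<otimes> A\<close>, written \<open>e = x \<otimes> z = x' \<otimes> z'\<close> with suppressed summation, such that
  \<open>a x \<otimes> z = x \<otimes> z a\<close> for all \<open>a\<close> (the Casimir identity), \<open>x z = 1\<close> and
  \<open>\<epsilon>(x) z = 1 = \<epsilon>(z) x\<close>. The Casimir identity gives
  \<open>x x' \<otimes> z' \<otimes> z = x \<otimes> z x' \<otimes> z' = x \<otimes> x' \<otimes> z' z\<close> (\<open>casimir_twice\<close>). These equations contain the
  coassociativity of \<open>a \<mapsto> a x \<otimes> z\<close> and of the coactions \<open>m \<mapsto> m x \<otimes> z\<close> and \<open>m \<mapsto> x \<otimes> z m\<close>, and they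
  show that \<open>\<pi>(m \<otimes> n) = m x \<otimes> z n\<close> takes values in the cotensor product. Conversely, if \<open>m \<otimes> n\<close>
  stands for an element of the cotensor product, so that \<open>m x \<otimes> z \<otimes> n = m \<otimes> x \<otimes> z n\<close>, then letting
  the middle factor act on the right one gives \<open>\<pi>(m \<otimes> n) = m \<otimes> x z n = m \<otimes> n\<close>
  (\<open>cotensor_eq_image\<close>). Dually, the Casimir identity says that \<open>\<pi>\<close> vanishes on the relators
  \<open>m a \<otimes> n - m \<otimes> a n\<close>, while modulo these \<open>\<pi>(m \<otimes> n) = m x \<otimes> z n\<close> equals \<open>m \<otimes> x z n = m \<otimes> n\<close>, so the
  kernel of \<open>\<pi>\<close> is generated by them (\<open>kernel_eq_balanced\<close>). The middle isomorphism is the first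
  isomorphism theorem for \<open>\<pi>\<close>.

  For a weak bialgebra, let \<open>H\<^sub>s\<close> be the image of the map \<open>h \<mapsto> \<epsilon>(1\<^sub>2 h) 1\<^sub>1\<close>. The comonoidality axioms
  give \<open>\<Delta>(z) = z 1\<^sub>1 \<otimes> 1\<^sub>2 = 1\<^sub>1 z \<otimes> 1\<^sub>2\<close> on \<open>H\<^sub>t\<close> and the mirrored formulas on \<open>H\<^sub>s\<close>, whence \<open>H\<^sub>t\<close> is a
  subalgebra and commutes with \<open>H\<^sub>s\<close>. The decisive identity is \<open>1\<^sub>1 \<otimes> 1\<^sub>2 z = 1\<^sub>1 y \<otimes> 1\<^sub>2\<close>
  whenever \<open>z\<close> in \<open>H\<^sub>t\<close> and \<open>y\<close> in \<open>H\<^sub>s\<close> satisfy \<open>\<epsilon>(h z) = \<epsilon>(h y)\<close> for all \<open>h\<close>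
  (\<open>move_across_comult_one\<close>); the monoidality axioms say that such \<open>y\<close> and \<open>z\<close> correspond under the
  two counital maps. Hence these maps are mutually inverse anti-isomorphisms between \<open>H\<^sub>t\<close> and \<open>H\<^sub>s\<close>,
  the element \<open>\<Delta>(1)\<close> lies in \<open>H\<^sub>s \<otimes> H\<^sub>t\<close>, and transporting its first leg to \<open>H\<^sub>t\<close> produces \<open>e\<close>. The
  Casimir identity for \<open>e\<close> is the decisive identity, and separability is \<open>\<Delta>(1) \<Delta>(1) = \<Delta>(1)\<close>.

  Sweedler notation is rendered by \<open>lift\<close>: an equation between tensors is stated as the equality of
  the values of an arbitrary multilinear map on both sides, so that all calculations take place
  under \<open>lift\<close>.
\<close>

section \<open>Linear maps and quotient modules\<close>

lemma linI:
  assumes "\<And>x. x \<in> carrier M \<Longrightarrow> f x \<in> carrier N"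
    and "\<And>x y. x \<in> carrier M \<Longrightarrow> y \<in> carrier M \<Longrightarrow> f (x \<oplus>\<^bsub>M\<^esub> y) = f x \<oplus>\<^bsub>N\<^esub> f y"
    and "\<And>r x. r \<in> carrier k \<Longrightarrow> x \<in> carrier M \<Longrightarrow> f (r \<odot>\<^bsub>M\<^esub> x) = r \<odot>\<^bsub>N\<^esub> f x"
  shows "f \<in> lin k M N"
  using assms by (auto simp: lin_def)

lemma lin_closed: "f \<in> lin k M N \<Longrightarrow> x \<in> carrier M \<Longrightarrow> f x \<in> carrier N"
  and lin_add: "f \<in> lin k M N \<Longrightarrow> x \<in> carrier M \<Longrightarrow> y \<in> carrier M \<Longrightarrow> f (x \<oplus>\<^bsub>M\<^esub> y) = f x \<oplus>\<^bsub>N\<^esub> f y"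
  and lin_smult: "f \<in> lin k M N \<Longrightarrow> r \<in> carrier k \<Longrightarrow> x \<in> carrier M \<Longrightarrow> f (r \<odot>\<^bsub>M\<^esub> x) = r \<odot>\<^bsub>N\<^esub> f x"
  by (auto simp: lin_def)

lemma lin_comp: "g \<in> lin k N P \<Longrightarrow> f \<in> lin k M N \<Longrightarrow> (\<lambda>x. g (f x)) \<in> lin k M P"
  by (rule linI) (simp_all add: lin_closed[of f] lin_closed[of g] lin_add[of f] lin_add[of g]
      lin_smult[of f] lin_smult[of g])

lemma lin_cong:
  assumes "module k M" "f \<in> lin k M N" "\<And>x. x \<in> carrier M \<Longrightarrow> g x = f x"
  shows "g \<in> lin k M N"
proof -
  interpret M: module k M by fact
  show ?thesis
    by (rule linI) (simp_all add: assms(3) lin_closed[OF assms(2)] lin_add[OF assms(2)] lin_smult[OF assms(2)])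
qed

lemma minus_eq_zero_iff:
  assumes "abelian_group G" "x \<in> carrier G" "y \<in> carrier G"
  shows "x \<ominus>\<^bsub>G\<^esub> y = \<zero>\<^bsub>G\<^esub> \<longleftrightarrow> x = y"
proof -
  interpret G: abelian_group G by fact
  show ?thesis
    using assms(2,3) G.minus_equality[of x "\<ominus>\<^bsub>G\<^esub> y"]
    by (auto simp: a_minus_def G.r_neg)
qed

lemma lin_zero:
  assumes "module k M" "module k N" "f \<in> lin k M N"
  shows "f \<zero>\<^bsub>M\<^esub> = \<zero>\<^bsub>N\<^esub>"
proof -
  interpret M: module k M by fact
  interpret N: module k N by fact
  have "f \<zero>\<^bsub>M\<^esub> = f (\<zero>\<^bsub>k\<^esub> \<odot>\<^bsub>M\<^esub> \<zero>\<^bsub>M\<^esub>)" by simp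
  also have "\<dots> = \<zero>\<^bsub>k\<^esub> \<odot>\<^bsub>N\<^esub> f \<zero>\<^bsub>M\<^esub>" by (rule lin_smult[OF assms(3)]) auto
  also have "\<dots> = \<zero>\<^bsub>N\<^esub>" using assms(3) by (simp add: lin_closed)
  finally show ?thesis .
qed

lemma lin_minus:
  assumes "module k M" "module k N" "f \<in> lin k M N" "x \<in> carrier M" "y \<in> carrier M"
  shows "f (x \<ominus>\<^bsub>M\<^esub> y) = f x \<ominus>\<^bsub>N\<^esub> f y"
proof -
  interpret M: module k M by fact
  interpret N: module k N by fact
  have "f (\<ominus>\<^bsub>M\<^esub> y) = f ((\<ominus>\<^bsub>k\<^esub> \<one>\<^bsub>k\<^esub>) \<odot>\<^bsub>M\<^esub> y)"
    using assms by (simp add: M.smult_l_minus)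
  also have "\<dots> = \<ominus>\<^bsub>N\<^esub> f y"
    using assms by (simp add: lin_smult lin_closed N.smult_l_minus)
  finally show ?thesis using assms by (simp add: a_minus_def lin_add)
qed

lemma lin_abelian_group_hom:
  assumes "module k M" "module k N" "f \<in> lin k M N"
  shows "abelian_group_hom M N f"
  using assms by (intro abelian_group_homI group_hom.intro group_hom_axioms.intro)
    (auto simp: module_def hom_def lin_def abelian_group.a_group)

text \<open>The module axioms are equations between elements, so they descend along a surjective linear map.\<close>

lemma module_surjective_image:
  assumes "module k M" and q: "q \<in> lin k M Q" and onto: "carrier Q = q ` carrier M"
    and zero: "q \<zero>\<^bsub>M\<^esub> = \<zero>\<^bsub>Q\<^esub>"
  shows "module k Q"
proof -
  interpret M: module k M by fact
  note s = lin_add[OF q, symmetric] lin_smult[OF q, symmetric] zero[symmetric]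
  have ag: "abelian_group Q"
  proof (rule abelian_groupI)
    fix x assume "x \<in> carrier Q"
    then obtain a where a: "a \<in> carrier M" "x = q a" using onto by auto
    have "q (\<ominus>\<^bsub>M\<^esub> a) \<in> carrier Q" "q (\<ominus>\<^bsub>M\<^esub> a) \<oplus>\<^bsub>Q\<^esub> x = \<zero>\<^bsub>Q\<^esub>"
      using a onto by (auto simp: s M.l_neg)
    then show "\<exists>y\<in>carrier Q. y \<oplus>\<^bsub>Q\<^esub> x = \<zero>\<^bsub>Q\<^esub>" by blast
  qed (use onto in \<open>auto simp: s M.a_ac\<close>)
  show ?thesis
    by (rule moduleI[OF M.is_cring ag])
      (use onto in \<open>auto simp: s M.smult_l_distr M.smult_r_distr M.smult_assoc1\<close>)
qed

lemma submodule_abelian_subgroup: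
  assumes "module k M" "submodule S k M"
  shows "abelian_subgroup S M"
proof -
  interpret M: module k M by fact
  show ?thesis
    using assms(2) by (intro abelian_subgroupI3 additive_subgroupI) (auto simp: submodule_def M.abelian_group_axioms)
qed

lemma quot_eq_iff:
  assumes "module k M" "submodule S k M" "x \<in> carrier M" "y \<in> carrier M"
  shows "S +>\<^bsub>M\<^esub> x = S +>\<^bsub>M\<^esub> y \<longleftrightarrow> x \<ominus>\<^bsub>M\<^esub> y \<in> S"
proof -
  interpret S: abelian_subgroup S M using submodule_abelian_subgroup assms by blast
  have "x \<ominus>\<^bsub>M\<^esub> y \<in> S \<longleftrightarrow> x \<in> S +>\<^bsub>M\<^esub> y"
    using S.a_rcos_module[OF assms(4,3)] by (simp add: a_minus_def)
  also have "\<dots> \<longleftrightarrow> S +>\<^bsub>M\<^esub> x = S +>\<^bsub>M\<^esub> y"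
    using S.a_rcos_self S.a_repr_independence' assms(3,4) by metis
  finally show ?thesis ..
qed

lemma carrier_quot: "carrier (quot_module M S) = (\<lambda>x. S +>\<^bsub>M\<^esub> x) ` carrier M"
  by (auto simp: quot_module_def A_RCOSETS_def')

lemma zero_quot [simp]: "\<zero>\<^bsub>quot_module M S\<^esub> = S"
  by (simp add: quot_module_def)

lemma quot_lin:
  assumes "module k M" "submodule S k M"
  shows "(\<lambda>x. S +>\<^bsub>M\<^esub> x) \<in> lin k M (quot_module M S)"
proof (rule linI)
  interpret M: module k M by fact
  interpret S: abelian_subgroup S M using submodule_abelian_subgroup assms by blast
  fix x assume x: "x \<in> carrier M"
  show "S +>\<^bsub>M\<^esub> x \<in> carrier (quot_module M S)" using x by (simp add: carrier_quot)
  { fix y assume y: "y \<in> carrier M"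
    show "S +>\<^bsub>M\<^esub> (x \<oplus>\<^bsub>M\<^esub> y) = (S +>\<^bsub>M\<^esub> x) \<oplus>\<^bsub>quot_module M S\<^esub> (S +>\<^bsub>M\<^esub> y)"
      using x y by (simp add: quot_module_def S.a_rcos_sum) }
  fix r assume r: "r \<in> carrier k"
  have same: "S +>\<^bsub>M\<^esub> (r \<odot>\<^bsub>M\<^esub> c) = S +>\<^bsub>M\<^esub> (r \<odot>\<^bsub>M\<^esub> x)" if c: "c \<in> S +>\<^bsub>M\<^esub> x" for c
  proof -
    have cM: "c \<in> carrier M" using c x S.a_elemrcos_carrier by blast
    have "S +>\<^bsub>M\<^esub> c = S +>\<^bsub>M\<^esub> x" using S.a_repr_independence'[OF c x] by simp
    then have "c \<ominus>\<^bsub>M\<^esub> x \<in> S" using quot_eq_iff[OF assms] cM x by simp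
    then have "r \<odot>\<^bsub>M\<^esub> (c \<ominus>\<^bsub>M\<^esub> x) \<in> S" using submodule.smult_closed[OF assms(2) r] by blast
    then have "r \<odot>\<^bsub>M\<^esub> c \<ominus>\<^bsub>M\<^esub> r \<odot>\<^bsub>M\<^esub> x \<in> S"
      using cM x r by (simp add: a_minus_def M.smult_r_distr M.smult_r_minus)
    then show ?thesis using quot_eq_iff[OF assms] cM x r by simp
  qed
  have "S +>\<^bsub>M\<^esub> x \<noteq> {}" using S.a_rcos_self[OF x] by blast
  then have "(\<Union>c\<in>S +>\<^bsub>M\<^esub> x. S +>\<^bsub>M\<^esub> (r \<odot>\<^bsub>M\<^esub> c)) = S +>\<^bsub>M\<^esub> (r \<odot>\<^bsub>M\<^esub> x)"
    using same by (rule SUP_eq_const)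
  then show "S +>\<^bsub>M\<^esub> (r \<odot>\<^bsub>M\<^esub> x) = r \<odot>\<^bsub>quot_module M S\<^esub> (S +>\<^bsub>M\<^esub> x)"
    by (simp add: quot_module_def)
qed

lemma module_quot:
  assumes "module k M" "submodule S k M"
  shows "module k (quot_module M S)"
proof (rule module_surjective_image[OF assms(1) quot_lin[OF assms]])
  interpret M: module k M by fact
  interpret S: abelian_subgroup S M using submodule_abelian_subgroup assms by blast
  show "S +>\<^bsub>M\<^esub> \<zero>\<^bsub>M\<^esub> = \<zero>\<^bsub>quot_module M S\<^esub>"
    by (simp add: S.a_subset)
qed (rule carrier_quot)

lemma submodule_module_gen:
  assumes "module k M" "X \<subseteq> carrier M"
  shows "submodule (module_gen k M X) k M"
proof -
  interpret M: module k M by fact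
  have sub: "submodule (carrier M) k M" by (rule M.carrier_is_submodule)
  have z: "\<zero>\<^bsub>M\<^esub> \<in> S" if "submodule S k M" for S
    using subgroup.one_closed[OF submodule.axioms(1)[OF that]] by simp
  show ?thesis
  proof (rule M.submoduleI)
    show "module_gen k M X \<subseteq> carrier M"
      unfolding module_gen_def using assms(2) sub by (rule hull_minimal)
  qed (auto simp: module_gen_def hull_def z M.submoduleE)
qed

lemma module_gen_minimal: "X \<subseteq> S \<Longrightarrow> submodule S k M \<Longrightarrow> module_gen k M X \<subseteq> S"
  unfolding module_gen_def by (rule hull_minimal)

lemma module_gen_inc: "x \<in> X \<Longrightarrow> x \<in> module_gen k M X"
  unfolding module_gen_def by (rule hull_inc)

lemma submodule_kernel:
  assumes "module k M" "module k N" "f \<in> lin k M N"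
  shows "submodule (a_kernel M N f) k M"
proof -
  interpret M: module k M by fact
  interpret N: module k N by fact
  interpret abelian_group_hom M N f by (rule lin_abelian_group_hom[OF assms])
  show ?thesis
    by (rule M.submoduleI) (auto simp: a_kernel_def' lin_smult[OF assms(3)] lin_zero[OF assms])
qed

lemma submodule_image:
  assumes "module k M" "module k N" "f \<in> lin k M N"
  shows "submodule (f ` carrier M) k N"
proof -
  interpret M: module k M by fact
  interpret N: module k N by fact
  interpret abelian_group_hom M N f by (rule lin_abelian_group_hom[OF assms])
  show ?thesis
  proof (rule N.submoduleI)
    show "\<zero>\<^bsub>N\<^esub> \<in> f ` carrier M" using hom_zero by (metis M.zero_closed imageI)
  next
    fix a assume "a \<in> f ` carrier M"
    then show "\<ominus>\<^bsub>N\<^esub> a \<in> f ` carrier M" by (auto simp: hom_a_inv[symmetric] simp del: hom_a_inv)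
  next
    fix a b assume "a \<in> f ` carrier M" "b \<in> f ` carrier M"
    then show "a \<oplus>\<^bsub>N\<^esub> b \<in> f ` carrier M" by (auto simp: hom_add[symmetric] simp del: hom_add)
  next
    fix r a assume "r \<in> carrier k" "a \<in> f ` carrier M"
    then show "r \<odot>\<^bsub>N\<^esub> a \<in> f ` carrier M" by (auto simp: lin_smult[OF assms(3), symmetric])
  qed auto
qed

section \<open>Free modules\<close>

lemma free_module_ops:
  shows zero_free: "\<zero>\<^bsub>free_module k X\<^esub> = (\<lambda>x. \<zero>\<^bsub>k\<^esub>)"
    and add_free: "f \<oplus>\<^bsub>free_module k X\<^esub> g = (\<lambda>x. f x \<oplus>\<^bsub>k\<^esub> g x)"
    and smult_free: "r \<odot>\<^bsub>free_module k X\<^esub> f = (\<lambda>x. r \<otimes>\<^bsub>k\<^esub> f x)"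
  by (simp_all add: free_module_def)

lemma free_moduleI:
  assumes "\<And>x. f x \<in> carrier k" "finite U" "U \<subseteq> X" "\<And>x. x \<notin> U \<Longrightarrow> f x = \<zero>\<^bsub>k\<^esub>"
  shows "f \<in> carrier (free_module k X)"
proof -
  have "{x. f x \<noteq> \<zero>\<^bsub>k\<^esub>} \<subseteq> U" using assms(4) by blast
  then show ?thesis using assms(1-3) finite_subset[of _ U] by (auto simp: free_module_def)
qed

lemma free_moduleD:
  assumes "f \<in> carrier (free_module k X)"
  shows "f x \<in> carrier k" "finite {x. f x \<noteq> \<zero>\<^bsub>k\<^esub>}" "{x. f x \<noteq> \<zero>\<^bsub>k\<^esub>} \<subseteq> X"
  using assms by (auto simp: free_module_def)

lemma module_free:
  assumes "cring k" shows "module k (free_module k X)"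
proof -
  interpret k: cring k by fact
  have add: "f \<oplus>\<^bsub>free_module k X\<^esub> g \<in> carrier (free_module k X)"
    if "f \<in> carrier (free_module k X)" "g \<in> carrier (free_module k X)" for f g
    by (rule free_moduleI[where U = "{x. f x \<noteq> \<zero>\<^bsub>k\<^esub>} \<union> {x. g x \<noteq> \<zero>\<^bsub>k\<^esub>}"])
      (use free_moduleD[OF that(1)] free_moduleD[OF that(2)] in \<open>simp_all add: add_free\<close>)
  have smult: "r \<odot>\<^bsub>free_module k X\<^esub> f \<in> carrier (free_module k X)"
    if "r \<in> carrier k" "f \<in> carrier (free_module k X)" for r f
    by (rule free_moduleI[where U = "{x. f x \<noteq> \<zero>\<^bsub>k\<^esub>}"])
      (use that(1) free_moduleD[OF that(2)] in \<open>simp_all add: smult_free\<close>)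
  have ag: "abelian_group (free_module k X)"
  proof (rule abelian_groupI)
    show "\<zero>\<^bsub>free_module k X\<^esub> \<in> carrier (free_module k X)"
      by (rule free_moduleI[where U = "{}"]) (simp_all add: zero_free)
  next
    fix f assume f: "f \<in> carrier (free_module k X)"
    show "\<zero>\<^bsub>free_module k X\<^esub> \<oplus>\<^bsub>free_module k X\<^esub> f = f"
      using free_moduleD(1)[OF f] by (simp add: add_free zero_free)
    have "(\<ominus>\<^bsub>k\<^esub> \<one>\<^bsub>k\<^esub>) \<odot>\<^bsub>free_module k X\<^esub> f \<oplus>\<^bsub>free_module k X\<^esub> f = \<zero>\<^bsub>free_module k X\<^esub>"
      using free_moduleD(1)[OF f] by (simp add: add_free zero_free smult_free k.l_minus k.l_neg)
    then show "\<exists>g\<in>carrier (free_module k X). g \<oplus>\<^bsub>free_module k X\<^esub> f = \<zero>\<^bsub>free_module k X\<^esub>"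
      using smult[OF _ f] by blast
  next
    fix f g assume fg: "f \<in> carrier (free_module k X)" "g \<in> carrier (free_module k X)"
    show "f \<oplus>\<^bsub>free_module k X\<^esub> g = g \<oplus>\<^bsub>free_module k X\<^esub> f"
      using free_moduleD(1)[OF fg(1)] free_moduleD(1)[OF fg(2)] by (simp add: add_free k.a_comm)
    fix h assume h: "h \<in> carrier (free_module k X)"
    show "f \<oplus>\<^bsub>free_module k X\<^esub> g \<oplus>\<^bsub>free_module k X\<^esub> h = f \<oplus>\<^bsub>free_module k X\<^esub> (g \<oplus>\<^bsub>free_module k X\<^esub> h)"
      using free_moduleD(1)[OF fg(1)] free_moduleD(1)[OF fg(2)] free_moduleD(1)[OF h]
      by (simp add: add_free k.a_assoc)
  qed (rule add)
  show ?thesis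
    by (rule moduleI[OF assms ag])
      (simp_all add: smult[unfolded smult_free] add_free smult_free free_moduleD(1) k.l_distr k.r_distr k.m_assoc)
qed

lemma free_gen_carrier:
  assumes "cring k" "x \<in> X" shows "free_gen k x \<in> carrier (free_module k X)"
proof -
  interpret k: cring k by fact
  show ?thesis
    by (rule free_moduleI[where U = "{x}"]) (use assms(2) in \<open>auto simp: free_gen_def\<close>)
qed

text \<open>
  Every element of a free module is reached from zero by adding multiples of generators, one
  point of its support at a time.
\<close>

lemma free_module_induct [consumes 2, case_names zero add]:
  assumes "cring k" and f: "f \<in> carrier (free_module k X)"
    and zero: "P \<zero>\<^bsub>free_module k X\<^esub>"
    and add: "\<And>r x f. \<lbrakk>r \<in> carrier k; x \<in> X; f \<in> carrier (free_module k X); P f\<rbrakk>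
      \<Longrightarrow> P (r \<odot>\<^bsub>free_module k X\<^esub> free_gen k x \<oplus>\<^bsub>free_module k X\<^esub> f)"
  shows "P f"
proof -
  interpret k: cring k by fact
  have "P f" if "finite U" "U \<subseteq> X" "f \<in> carrier (free_module k X)" "\<And>x. x \<notin> U \<Longrightarrow> f x = \<zero>\<^bsub>k\<^esub>" for U f
    using that
  proof (induction U arbitrary: f rule: finite_induct)
    case empty
    then have "f = \<zero>\<^bsub>free_module k X\<^esub>" by (auto simp: zero_free)
    then show ?case using zero by simp
  next
    case (insert p U)
    let ?g = "\<lambda>x. if x = p then \<zero>\<^bsub>k\<^esub> else f x"
    note fk = free_moduleD(1)[OF insert.prems(2)]
    have g: "?g \<in> carrier (free_module k X)"
      by (rule free_moduleI[where U = U]) (use insert fk in auto)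
    have "P ?g" by (rule insert.IH) (use insert.prems g in auto)
    then have "P (f p \<odot>\<^bsub>free_module k X\<^esub> free_gen k p \<oplus>\<^bsub>free_module k X\<^esub> ?g)"
      using insert.prems(1) by (intro add fk g) auto
    also have "f p \<odot>\<^bsub>free_module k X\<^esub> free_gen k p \<oplus>\<^bsub>free_module k X\<^esub> ?g = f"
      using fk by (auto simp: add_free smult_free free_gen_def)
    finally show ?case .
  qed
  then show ?thesis using free_moduleD(2,3)[OF f] f by blast
qed

section \<open>Tensor products and their universal property\<close>

text \<open>The value of \<open>lift\<close> on a representative.\<close>

definition free_ext ::
  "('k, 'e) ring_scheme \<Rightarrow> ('k, 'p, 'w) module_scheme \<Rightarrow> ('x \<Rightarrow> 'p) \<Rightarrow> ('x \<Rightarrow> 'k) \<Rightarrow> 'p"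
  where "free_ext k P \<beta> f = finsum P (\<lambda>p. f p \<odot>\<^bsub>P\<^esub> \<beta> p) {p. f p \<noteq> \<zero>\<^bsub>k\<^esub>}"

lemma free_ext_lin:
  assumes "module k P" and \<beta>: "\<And>x. x \<in> X \<Longrightarrow> \<beta> x \<in> carrier P"
  shows "free_ext k P \<beta> \<in> lin k (free_module k X) P"
proof -
  interpret P: module k P by fact
  \<comment> \<open>Different functions have different supports; sums over a common finite superset can be added.\<close>
  have superset: "free_ext k P \<beta> f = finsum P (\<lambda>p. f p \<odot>\<^bsub>P\<^esub> \<beta> p) U"
    if "finite U" "{p. f p \<noteq> \<zero>\<^bsub>k\<^esub>} \<subseteq> U" "U \<subseteq> X" "f \<in> carrier (free_module k X)" for f U
    unfolding free_ext_def
    by (rule P.add.finprod_mono_neutral_cong_left)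
      (use that \<beta> free_moduleD(1)[OF that(4)] in \<open>auto simp: subset_iff\<close>)
  interpret F: module k "free_module k X" by (rule module_free[OF P.R.is_cring])
  show ?thesis
  proof (rule linI)
    fix f assume f: "f \<in> carrier (free_module k X)"
    note fk = free_moduleD[OF f]
    show "free_ext k P \<beta> f \<in> carrier P"
      unfolding free_ext_def using fk \<beta> by (intro P.finsum_closed) (auto simp: subset_iff)
    { fix g assume g: "g \<in> carrier (free_module k X)"
      note gk = free_moduleD[OF g]
      let ?U = "{p. f p \<noteq> \<zero>\<^bsub>k\<^esub>} \<union> {p. g p \<noteq> \<zero>\<^bsub>k\<^esub>}"
      have U: "finite ?U" "?U \<subseteq> X" using fk gk by auto
      have "free_ext k P \<beta> (f \<oplus>\<^bsub>free_module k X\<^esub> g) =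
          finsum P (\<lambda>p. (f p \<oplus>\<^bsub>k\<^esub> g p) \<odot>\<^bsub>P\<^esub> \<beta> p) ?U"
        using F.a_closed[OF f g] by (subst superset[OF U(1) _ U(2)]) (auto simp: add_free)
      also have "\<dots> = finsum P (\<lambda>p. f p \<odot>\<^bsub>P\<^esub> \<beta> p \<oplus>\<^bsub>P\<^esub> g p \<odot>\<^bsub>P\<^esub> \<beta> p) ?U"
        using U(2) \<beta> fk(1) gk(1)
        by (intro P.finsum_cong') (auto simp: P.smult_l_distr subset_iff)
      also have "\<dots> = finsum P (\<lambda>p. f p \<odot>\<^bsub>P\<^esub> \<beta> p) ?U \<oplus>\<^bsub>P\<^esub> finsum P (\<lambda>p. g p \<odot>\<^bsub>P\<^esub> \<beta> p) ?U"
        using U(2) \<beta> fk(1) gk(1) by (intro P.finsum_addf) (auto simp: subset_iff)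
      also have "\<dots> = free_ext k P \<beta> f \<oplus>\<^bsub>P\<^esub> free_ext k P \<beta> g"
        using f g U by (simp add: superset[OF U(1) _ U(2)])
      finally show "free_ext k P \<beta> (f \<oplus>\<^bsub>free_module k X\<^esub> g) = free_ext k P \<beta> f \<oplus>\<^bsub>P\<^esub> free_ext k P \<beta> g" . }
    fix r assume r: "r \<in> carrier k"
    let ?U = "{p. f p \<noteq> \<zero>\<^bsub>k\<^esub>}"
    have "free_ext k P \<beta> (r \<odot>\<^bsub>free_module k X\<^esub> f) = finsum P (\<lambda>p. (r \<otimes>\<^bsub>k\<^esub> f p) \<odot>\<^bsub>P\<^esub> \<beta> p) ?U"
      using F.smult_closed[OF r f] r fk by (subst superset[of ?U]) (auto simp: smult_free)
    also have "\<dots> = finsum P (\<lambda>p. r \<odot>\<^bsub>P\<^esub> (f p \<odot>\<^bsub>P\<^esub> \<beta> p)) ?U"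
      using fk \<beta> r by (intro P.finsum_cong') (auto simp: P.smult_assoc1 subset_iff)
    also have "\<dots> = r \<odot>\<^bsub>P\<^esub> free_ext k P \<beta> f"
      unfolding free_ext_def using fk \<beta> r
      by (intro P.finsum_smult_ldistr[symmetric]) (auto simp: subset_iff)
    finally show "free_ext k P \<beta> (r \<odot>\<^bsub>free_module k X\<^esub> f) = r \<odot>\<^bsub>P\<^esub> free_ext k P \<beta> f" .
  qed
qed

lemma free_ext_gen:
  assumes "module k P" "\<beta> x \<in> carrier P"
  shows "free_ext k P \<beta> (free_gen k x) = \<beta> x"
proof -
  interpret P: module k P by fact
  show ?thesis
    \<comment> \<open>Over the zero ring the generator has empty support.\<close>
  proof (cases "\<one>\<^bsub>k\<^esub> = \<zero>\<^bsub>k\<^esub>")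
    case True
    then have "\<beta> x = \<zero>\<^bsub>P\<^esub>" using P.smult_one[OF assms(2)] P.smult_l_null[OF assms(2)] by simp
    moreover have "{p. free_gen k x p \<noteq> \<zero>\<^bsub>k\<^esub>} = {}" using True by (auto simp: free_gen_def)
    ultimately show ?thesis by (simp add: free_ext_def)
  next
    case False
    then have "{p. free_gen k x p \<noteq> \<zero>\<^bsub>k\<^esub>} = {x}" by (auto simp: free_gen_def)
    then show ?thesis using assms(2) by (simp add: free_ext_def free_gen_def)
  qed
qed

definition bilin ::
  "('k, 'e) ring_scheme \<Rightarrow> ('k, 'm, 'u) module_scheme \<Rightarrow> ('k, 'n, 'v) module_scheme
    \<Rightarrow> ('k, 'p, 'w) module_scheme \<Rightarrow> ('m \<Rightarrow> 'n \<Rightarrow> 'p) \<Rightarrow> bool"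
  where "bilin k M N P \<beta> \<longleftrightarrow> (\<forall>m\<in>carrier M. (\<lambda>n. \<beta> m n) \<in> lin k N P) \<and>
      (\<forall>n\<in>carrier N. (\<lambda>m. \<beta> m n) \<in> lin k M P)"

lemma bilinI:
  assumes "\<And>m. m \<in> carrier M \<Longrightarrow> (\<lambda>n. \<beta> m n) \<in> lin k N P"
    and "\<And>n. n \<in> carrier N \<Longrightarrow> (\<lambda>m. \<beta> m n) \<in> lin k M P"
  shows "bilin k M N P \<beta>"
  using assms by (auto simp: bilin_def)

lemma bilinD:
  assumes "bilin k M N P \<beta>"
  shows "m \<in> carrier M \<Longrightarrow> (\<lambda>n. \<beta> m n) \<in> lin k N P"
    and "n \<in> carrier N \<Longrightarrow> (\<lambda>m. \<beta> m n) \<in> lin k M P"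
    and "m \<in> carrier M \<Longrightarrow> n \<in> carrier N \<Longrightarrow> \<beta> m n \<in> carrier P"
  using assms lin_closed unfolding bilin_def by fast+

locale tensor_product = M: module k M + N: module k N
  for k :: "('k, 'e) ring_scheme" and M :: "('k, 'm, 'u) module_scheme"
    and N :: "('k, 'n, 'v) module_scheme"
begin

abbreviation "F \<equiv> free_module k (carrier M \<times> carrier N)"

definition relators where "relators =
   {free_gen k (x \<oplus>\<^bsub>M\<^esub> y, z) \<ominus>\<^bsub>F\<^esub> (free_gen k (x, z) \<oplus>\<^bsub>F\<^esub> free_gen k (y, z)) | x y z.
       x \<in> carrier M \<and> y \<in> carrier M \<and> z \<in> carrier N} \<union>
   {free_gen k (x, y \<oplus>\<^bsub>N\<^esub> z) \<ominus>\<^bsub>F\<^esub> (free_gen k (x, y) \<oplus>\<^bsub>F\<^esub> free_gen k (x, z)) | x y z.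
       x \<in> carrier M \<and> y \<in> carrier N \<and> z \<in> carrier N} \<union>
   {free_gen k (r \<odot>\<^bsub>M\<^esub> x, y) \<ominus>\<^bsub>F\<^esub> r \<odot>\<^bsub>F\<^esub> free_gen k (x, y) | r x y.
       r \<in> carrier k \<and> x \<in> carrier M \<and> y \<in> carrier N} \<union>
   {free_gen k (x, r \<odot>\<^bsub>N\<^esub> y) \<ominus>\<^bsub>F\<^esub> r \<odot>\<^bsub>F\<^esub> free_gen k (x, y) | r x y.
       r \<in> carrier k \<and> x \<in> carrier M \<and> y \<in> carrier N}"

lemma tensor_rel_eq: "tensor_rel k M N = module_gen k F relators"
  unfolding tensor_rel_def relators_def Let_def ..

lemma module_F: "module k F"
  by (rule module_free[OF M.R.is_cring])

lemma gen_closed: "m \<in> carrier M \<Longrightarrow> n \<in> carrier N \<Longrightarrow> free_gen k (m, n) \<in> carrier F"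
  by (intro free_gen_carrier M.R.is_cring) auto

lemma submodule_rel: "submodule (tensor_rel k M N) k F"
proof -
  interpret F: module k F by (rule module_F)
  show ?thesis
    unfolding tensor_rel_eq
    by (rule submodule_module_gen[OF module_F]) (auto simp: relators_def gen_closed)
qed

lemma module_tensor: "module k (tensor k M N)"
  unfolding tensor_def by (rule module_quot[OF module_F submodule_rel])

lemma proj_lin: "(\<lambda>f. tensor_rel k M N +>\<^bsub>F\<^esub> f) \<in> lin k F (tensor k M N)"
  unfolding tensor_def by (rule quot_lin[OF module_F submodule_rel])

lemma bilin_pure: "bilin k M N (tensor k M N) (pure k M N)"
proof -
  interpret F: module k F by (rule module_F)
  let ?q = "\<lambda>f. tensor_rel k M N +>\<^bsub>F\<^esub> f"
  note qa = lin_add[OF proj_lin, symmetric] and qs = lin_smult[OF proj_lin, symmetric]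
  have eq: "?q f = ?q g" if "f \<ominus>\<^bsub>F\<^esub> g \<in> relators" "f \<in> carrier F" "g \<in> carrier F" for f g
    using that quot_eq_iff[OF module_F submodule_rel that(2,3)]
    by (auto simp: tensor_rel_eq module_gen_inc)
  have closed: "pure k M N m n \<in> carrier (tensor k M N)"
    if "m \<in> carrier M" "n \<in> carrier N" for m n
    unfolding pure_def by (rule lin_closed[OF proj_lin]) (rule gen_closed[OF that])
  show ?thesis
  proof (intro bilinI linI closed)
    fix m n n' assume "m \<in> carrier M" "n \<in> carrier N" "n' \<in> carrier N"
    then show "pure k M N m (n \<oplus>\<^bsub>N\<^esub> n') = pure k M N m n \<oplus>\<^bsub>tensor k M N\<^esub> pure k M N m n'"
      unfolding pure_def by (simp only: qa gen_closed)
        (rule eq; auto simp: relators_def gen_closed)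
  next
    fix m m' n assume "m \<in> carrier M" "n \<in> carrier N" "m' \<in> carrier M"
    then show "pure k M N (m \<oplus>\<^bsub>M\<^esub> m') n = pure k M N m n \<oplus>\<^bsub>tensor k M N\<^esub> pure k M N m' n"
      unfolding pure_def by (simp only: qa gen_closed)
        (rule eq; auto simp: relators_def gen_closed)
  next
    fix r m n assume "r \<in> carrier k" "m \<in> carrier M" "n \<in> carrier N"
    then show "pure k M N m (r \<odot>\<^bsub>N\<^esub> n) = r \<odot>\<^bsub>tensor k M N\<^esub> pure k M N m n"
      unfolding pure_def by (simp only: qs gen_closed)
        (rule eq; auto simp: relators_def gen_closed)
  next
    fix r m n assume "r \<in> carrier k" "m \<in> carrier M" "n \<in> carrier N"
    then show "pure k M N (r \<odot>\<^bsub>M\<^esub> m) n = r \<odot>\<^bsub>tensor k M N\<^esub> pure k M N m n"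
      unfolding pure_def by (simp only: qs gen_closed)
        (rule eq; auto simp: relators_def gen_closed)
  qed auto
qed

text \<open>
  Scalars are absorbed into the first factor, so sums of pure tensors exhaust the tensor product.
\<close>

lemma tensor_induct [consumes 1, case_names pure add]:
  assumes u: "u \<in> carrier (tensor k M N)"
    and pure: "\<And>m n. m \<in> carrier M \<Longrightarrow> n \<in> carrier N \<Longrightarrow> Q (pure k M N m n)"
    and add: "\<And>u v. \<lbrakk>u \<in> carrier (tensor k M N); v \<in> carrier (tensor k M N); Q u; Q v\<rbrakk>
      \<Longrightarrow> Q (u \<oplus>\<^bsub>tensor k M N\<^esub> v)"
  shows "Q u"
proof -
  interpret F: module k F by (rule module_F)
  let ?q = "\<lambda>f. tensor_rel k M N +>\<^bsub>F\<^esub> f"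
  obtain f where f: "f \<in> carrier F" "u = ?q f" using u by (auto simp: tensor_def carrier_quot)
  have "Q (?q f)" using M.R.is_cring f(1)
  proof (induction f rule: free_module_induct)
    case zero
    have "pure k M N \<zero>\<^bsub>M\<^esub> \<zero>\<^bsub>N\<^esub> = \<zero>\<^bsub>tensor k M N\<^esub>"
      by (rule lin_zero[OF N.module_axioms module_tensor bilinD(1)[OF bilin_pure]]) simp
    also have "\<dots> = ?q \<zero>\<^bsub>F\<^esub>" by (rule lin_zero[OF module_F module_tensor proj_lin, symmetric])
    finally show ?case using pure[of "\<zero>\<^bsub>M\<^esub>" "\<zero>\<^bsub>N\<^esub>"] by simp
  next
    case (add r x f)
    obtain m n where x: "x = (m, n)" "m \<in> carrier M" "n \<in> carrier N" using add by auto
    have "?q (r \<odot>\<^bsub>F\<^esub> free_gen k x \<oplus>\<^bsub>F\<^esub> f) = r \<odot>\<^bsub>tensor k M N\<^esub> pure k M N m n \<oplus>\<^bsub>tensor k M N\<^esub> ?q f"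
      using add x gen_closed[OF x(2,3)] by (simp add: lin_add[OF proj_lin] lin_smult[OF proj_lin] pure_def)
    also have "r \<odot>\<^bsub>tensor k M N\<^esub> pure k M N m n = pure k M N (r \<odot>\<^bsub>M\<^esub> m) n"
      using lin_smult[OF bilinD(2)[OF bilin_pure]] add x by simp
    finally show ?case
      using assms(3) pure x add bilinD(3)[OF bilin_pure] lin_closed[OF proj_lin] by simp
  qed
  then show ?thesis using f by simp
qed

text \<open>
  The linear extension of a bilinear map kills the relators, hence is constant on cosets. So the
  representative picked by the choice operator in \<open>lift\<close> may be replaced by any other.
\<close>

lemma lift_eq_free_ext:
  assumes P: "module k P" and \<beta>: "bilin k M N P \<beta>" and f: "f \<in> carrier F"
  shows "lift k M N P \<beta> (tensor_rel k M N +>\<^bsub>F\<^esub> f) = free_ext k P (\<lambda>p. \<beta> (fst p) (snd p)) f"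
proof -
  interpret P: module k P by fact
  interpret F: module k F by (rule module_F)
  interpret S: abelian_subgroup "tensor_rel k M N" F
    by (rule submodule_abelian_subgroup[OF module_F submodule_rel])
  let ?b = "\<lambda>p. \<beta> (fst p) (snd p)" and ?q = "\<lambda>f. tensor_rel k M N +>\<^bsub>F\<^esub> f"
  have b: "?b p \<in> carrier P" if "p \<in> carrier M \<times> carrier N" for p
    using that bilinD(3)[OF \<beta>] by auto
  have L: "free_ext k P ?b \<in> lin k F P" by (rule free_ext_lin[OF P b])
  note Ladd = lin_add[OF L] and Lsm = lin_smult[OF L] and Lmi = lin_minus[OF module_F P L]
  have gen: "free_ext k P ?b (free_gen k (m, n)) = \<beta> m n" if "m \<in> carrier M" "n \<in> carrier N" for m n
    using free_ext_gen[OF P, of ?b "(m, n)"] bilinD(3)[OF \<beta>] that by simp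
  have "tensor_rel k M N \<subseteq> a_kernel F P (free_ext k P ?b)"
    unfolding tensor_rel_eq
  proof (rule module_gen_minimal[OF _ submodule_kernel[OF module_F P L]])
    note bl = lin_add[OF bilinD(1)[OF \<beta>]] lin_add[OF bilinD(2)[OF \<beta>]]
      lin_smult[OF bilinD(1)[OF \<beta>]] lin_smult[OF bilinD(2)[OF \<beta>]] bilinD(3)[OF \<beta>]
    have "p \<ominus>\<^bsub>P\<^esub> p = \<zero>\<^bsub>P\<^esub>" if "p \<in> carrier P" for p
      using that by (simp add: a_minus_def P.r_neg)
    then show "relators \<subseteq> a_kernel F P (free_ext k P ?b)"
      unfolding relators_def a_kernel_def'
      by (auto simp: Lmi Ladd Lsm gen gen_closed bl)
  qed
  moreover obtain g where g: "g = (SOME g. g \<in> ?q f)" by blast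
  have "?q f \<noteq> {}" using S.a_rcos_self[OF f] by blast
  then have gq: "g \<in> ?q f" unfolding g by (simp add: some_in_eq)
  have gF: "g \<in> carrier F" using gq f S.a_elemrcos_carrier by blast
  have "?q g = ?q f" using S.a_repr_independence'[OF gq f] by simp
  then have "g \<ominus>\<^bsub>F\<^esub> f \<in> tensor_rel k M N" using quot_eq_iff[OF module_F submodule_rel gF f] by simp
  ultimately have "free_ext k P ?b (g \<ominus>\<^bsub>F\<^esub> f) = \<zero>\<^bsub>P\<^esub>" by (auto simp: a_kernel_def')
  then have "free_ext k P ?b g = free_ext k P ?b f"
    using Lmi[OF gF f] lin_closed[OF L gF] lin_closed[OF L f] minus_eq_zero_iff[OF P.abelian_group_axioms]
    by simp
  then show ?thesis by (simp add: lift_def free_ext_def Let_def g)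
qed

lemma lift_lin:
  assumes P: "module k P" and \<beta>: "bilin k M N P \<beta>"
  shows "lift k M N P \<beta> \<in> lin k (tensor k M N) P"
proof -
  interpret F: module k F by (rule module_F)
  let ?q = "\<lambda>f. tensor_rel k M N +>\<^bsub>F\<^esub> f"
  have L: "free_ext k P (\<lambda>p. \<beta> (fst p) (snd p)) \<in> lin k F P"
    using bilinD(3)[OF \<beta>] by (intro free_ext_lin[OF P]) auto
  have c: "carrier (tensor k M N) = ?q ` carrier F" by (simp add: tensor_def carrier_quot)
  note q = lin_add[OF proj_lin, symmetric] lin_smult[OF proj_lin, symmetric]
  show ?thesis
    by (rule linI) (auto simp: c q lift_eq_free_ext[OF P \<beta>] lin_closed[OF L] lin_add[OF L] lin_smult[OF L])
qed

lemma lift_pure: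
  assumes P: "module k P" and \<beta>: "bilin k M N P \<beta>" and "m \<in> carrier M" "n \<in> carrier N"
  shows "lift k M N P \<beta> (pure k M N m n) = \<beta> m n"
  unfolding pure_def lift_eq_free_ext[OF P \<beta> gen_closed[OF assms(3,4)]]
  using free_ext_gen[OF P, of "\<lambda>p. \<beta> (fst p) (snd p)" "(m, n)"] bilinD(3)[OF \<beta>] assms(3,4) by simp

lemma tensor_lin_eqI:
  assumes f: "f \<in> lin k (tensor k M N) P" and g: "g \<in> lin k (tensor k M N) P"
    and "\<And>m n. m \<in> carrier M \<Longrightarrow> n \<in> carrier N \<Longrightarrow> f (pure k M N m n) = g (pure k M N m n)"
    and "u \<in> carrier (tensor k M N)"
  shows "f u = g u"
  using assms(4)
proof (induction u rule: tensor_induct)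
  case (add u v)
  then show ?case by (simp add: lin_add[OF f] lin_add[OF g])
qed (rule assms(3))

end

lemma first_isomorphism:
  assumes M: "module k M" and N: "module k N" and f: "f \<in> lin k M N"
  shows "\<exists>\<phi> \<in> lin_iso k (quot_module M (a_kernel M N f)) (N\<lparr>carrier := f ` carrier M\<rparr>).
    \<forall>x\<in>carrier M. \<phi> (a_kernel M N f +>\<^bsub>M\<^esub> x) = f x"
proof -
  let ?K = "a_kernel M N f"
  interpret M: module k M by fact
  interpret N: module k N by fact
  have K: "submodule ?K k M" by (rule submodule_kernel[OF assms])
  interpret K: abelian_subgroup ?K M by (rule submodule_abelian_subgroup[OF M K])
  have same: "f x = f y \<longleftrightarrow> ?K +>\<^bsub>M\<^esub> x = ?K +>\<^bsub>M\<^esub> y"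
    if x: "x \<in> carrier M" and y: "y \<in> carrier M" for x y
  proof -
    have "?K +>\<^bsub>M\<^esub> x = ?K +>\<^bsub>M\<^esub> y \<longleftrightarrow> x \<ominus>\<^bsub>M\<^esub> y \<in> ?K" by (rule quot_eq_iff[OF M K x y])
    also have "\<dots> \<longleftrightarrow> f (x \<ominus>\<^bsub>M\<^esub> y) = \<zero>\<^bsub>N\<^esub>" using M.minus_closed[OF x y] by (simp only: a_kernel_def' mem_Collect_eq simp_thms)
    also have "\<dots> \<longleftrightarrow> f x \<ominus>\<^bsub>N\<^esub> f y = \<zero>\<^bsub>N\<^esub>" by (simp only: lin_minus[OF assms x y])
    also have "\<dots> \<longleftrightarrow> f x = f y"
      by (rule minus_eq_zero_iff[OF N.abelian_group_axioms lin_closed[OF f x] lin_closed[OF f y]])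
    finally show ?thesis by (rule sym)
  qed
  \<comment> \<open>The value of \<open>f\<close> at any representative of the coset.\<close>
  define \<phi> where "\<phi> C = f (SOME x. x \<in> carrier M \<and> ?K +>\<^bsub>M\<^esub> x = C)" for C
  have \<phi>: "\<phi> (?K +>\<^bsub>M\<^esub> x) = f x" if "x \<in> carrier M" for x
    using someI[of "\<lambda>y. y \<in> carrier M \<and> ?K +>\<^bsub>M\<^esub> y = ?K +>\<^bsub>M\<^esub> x" x] that same
    unfolding \<phi>_def by blast
  note q = lin_add[OF quot_lin[OF M K], symmetric] lin_smult[OF quot_lin[OF M K], symmetric]
  have "\<phi> \<in> lin k (quot_module M ?K) (N\<lparr>carrier := f ` carrier M\<rparr>)"
    by (rule linI) (auto simp: carrier_quot q \<phi> lin_add[OF f] lin_smult[OF f])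
  moreover have "inj_on \<phi> (carrier (quot_module M ?K))"
    using same by (intro inj_onI) (auto simp: carrier_quot \<phi>)
  moreover have "\<phi> ` carrier (quot_module M ?K) = f ` carrier M"
    unfolding carrier_quot image_image by (rule image_cong[OF refl \<phi>])
  ultimately show ?thesis using \<phi> by (intro bexI[of _ \<phi>]) (auto simp: lin_iso_def bij_betw_def)
qed

subsection \<open>Calculus of induced maps\<close>

text \<open>
  The collected rules prove linearity, bilinearity and membership in carriers by recursion over the
  syntax of a map, which discharges the side conditions of every calculation under \<open>lift\<close>.
\<close>

named_theorems lin_intros

lemma module_tensorI [lin_intros]: "module k M \<Longrightarrow> module k N \<Longrightarrow> module k (tensor k M N)"
  by (rule tensor_product.module_tensor[OF tensor_product.intro])

lemma lin_id [lin_intros]: "(\<lambda>x. x) \<in> lin k M M"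
  by (rule linI) auto

lemma lin_pure [lin_intros]:
  assumes "module k M" "module k N"
  shows "n \<in> carrier N \<Longrightarrow> f \<in> lin k X M \<Longrightarrow> (\<lambda>x. pure k M N (f x) n) \<in> lin k X (tensor k M N)"
    and "m \<in> carrier M \<Longrightarrow> g \<in> lin k X N \<Longrightarrow> (\<lambda>x. pure k M N m (g x)) \<in> lin k X (tensor k M N)"
  using lin_comp[OF bilinD(2)[OF tensor_product.bilin_pure[OF tensor_product.intro[OF assms]]]]
    lin_comp[OF bilinD(1)[OF tensor_product.bilin_pure[OF tensor_product.intro[OF assms]]]] by fast+

lemma pure_closed [lin_intros]:
  "module k M \<Longrightarrow> module k N \<Longrightarrow> m \<in> carrier M \<Longrightarrow> n \<in> carrier N \<Longrightarrow> pure k M N m n \<in> carrier (tensor k M N)"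
  using bilinD(3)[OF tensor_product.bilin_pure[OF tensor_product.intro]] .

lemma module_regular [lin_intros]: "cring k \<Longrightarrow> module k (regular_module k)"
proof -
  assume "cring k"
  then interpret k: cring k .
  have "abelian_group (regular_module k)"
    by (rule abelian_groupI) (auto simp: regular_module_def k.a_ac intro: k.l_neg)
  then show ?thesis
    by (intro moduleI k.is_cring) (auto simp: regular_module_def k.l_distr k.r_distr k.m_assoc)
qed

lemma lin_smult_scalar [lin_intros]:
  assumes "module k P" "p \<in> carrier P" "f \<in> lin k X (regular_module k)"
  shows "(\<lambda>x. f x \<odot>\<^bsub>P\<^esub> p) \<in> lin k X P"
proof -
  interpret P: module k P by fact
  have "(\<lambda>r. r \<odot>\<^bsub>P\<^esub> p) \<in> lin k (regular_module k) P"
    using assms(2) by (intro linI) (auto simp: regular_module_def P.smult_l_distr P.smult_assoc1)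
  from lin_comp[OF this assms(3)] show ?thesis .
qed

lemma lin_smult_vector [lin_intros]:
  assumes "module k P" "r \<in> carrier k" "f \<in> lin k X P"
  shows "(\<lambda>x. r \<odot>\<^bsub>P\<^esub> f x) \<in> lin k X P"
proof -
  interpret P: module k P by fact
  have "(\<lambda>p. r \<odot>\<^bsub>P\<^esub> p) \<in> lin k P P"
  proof (rule linI)
    fix s p assume "s \<in> carrier k" "p \<in> carrier P"
    then show "r \<odot>\<^bsub>P\<^esub> (s \<odot>\<^bsub>P\<^esub> p) = s \<odot>\<^bsub>P\<^esub> (r \<odot>\<^bsub>P\<^esub> p)"
      using assms(2) by (simp flip: P.smult_assoc1 add: P.R.m_comm)
  qed (use assms(2) in \<open>auto simp: P.smult_r_distr\<close>)
  from lin_comp[OF this assms(3)] show ?thesis .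
qed

lemma lin_plus:
  assumes "module k P" "f \<in> lin k X P" "g \<in> lin k X P"
  shows "(\<lambda>x. f x \<oplus>\<^bsub>P\<^esub> g x) \<in> lin k X P"
proof -
  interpret P: module k P by fact
  show ?thesis
    by (rule linI) (simp_all add: lin_add[OF assms(2)] lin_add[OF assms(3)] lin_smult[OF assms(2)]
      lin_smult[OF assms(3)] lin_closed[OF assms(2)] lin_closed[OF assms(3)] P.smult_r_distr P.a_ac)
qed

context tensor_product
begin

lemma lift_elem:
  assumes "module k P" "bilin k M N P \<beta>" "f \<in> lin k X (tensor k M N)"
  shows "(\<lambda>x. lift k M N P \<beta> (f x)) \<in> lin k X P"
  by (rule lin_comp[OF lift_lin[OF assms(1,2)] assms(3)])

lemma lift_closed:
  "module k P \<Longrightarrow> bilin k M N P \<beta> \<Longrightarrow> u \<in> carrier (tensor k M N) \<Longrightarrow> lift k M N P \<beta> u \<in> carrier P"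
  by (rule lin_closed[OF lift_lin])

text \<open>A linear map can be moved under Sweedler notation.\<close>

lemma lin_lift:
  assumes P: "module k P" and Q: "module k Q" and \<beta>: "bilin k M N P \<beta>" and g: "g \<in> lin k P Q"
    and u: "u \<in> carrier (tensor k M N)"
  shows "g (lift k M N P \<beta> u) = lift k M N Q (\<lambda>m n. g (\<beta> m n)) u"
proof -
  have gb: "bilin k M N Q (\<lambda>m n. g (\<beta> m n))"
    by (intro bilinI lin_comp[OF g] bilinD[OF \<beta>])
  show ?thesis
    by (rule tensor_lin_eqI[OF lin_comp[OF g lift_lin[OF P \<beta>]] lift_lin[OF Q gb] _ u])
      (simp add: lift_pure[OF P \<beta>] lift_pure[OF Q gb])
qed

lemma lift_cong:
  assumes P: "module k P" and \<beta>: "bilin k M N P \<beta>" and u: "u \<in> carrier (tensor k M N)"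
    and eq: "\<And>m n. m \<in> carrier M \<Longrightarrow> n \<in> carrier N \<Longrightarrow> \<beta> m n = \<beta>' m n"
  shows "lift k M N P \<beta> u = lift k M N P \<beta>' u"
proof -
  have \<beta>': "bilin k M N P \<beta>'"
    by (intro bilinI lin_cong[OF M.module_axioms bilinD(2)[OF \<beta>]] lin_cong[OF N.module_axioms bilinD(1)[OF \<beta>]])
      (simp_all flip: eq)
  show ?thesis
    by (rule tensor_lin_eqI[OF lift_lin[OF P \<beta>] lift_lin[OF P \<beta>'] _ u])
      (simp add: lift_pure[OF P \<beta>] lift_pure[OF P \<beta>'] eq)
qed

lemma lift_param:
  assumes X: "module k X" and P: "module k P" and \<beta>: "\<And>x. x \<in> carrier X \<Longrightarrow> bilin k M N P (\<beta> x)"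
    and l: "\<And>m n. m \<in> carrier M \<Longrightarrow> n \<in> carrier N \<Longrightarrow> (\<lambda>x. \<beta> x m n) \<in> lin k X P"
    and u: "u \<in> carrier (tensor k M N)"
  shows "(\<lambda>x. lift k M N P (\<beta> x) u) \<in> lin k X P"
proof (rule linI)
  interpret X: module k X by fact
  interpret P: module k P by fact
  fix x assume x: "x \<in> carrier X"
  show "lift k M N P (\<beta> x) u \<in> carrier P" by (rule lift_closed[OF P \<beta>[OF x] u])
  { fix y assume y: "y \<in> carrier X"
    have xy: "x \<oplus>\<^bsub>X\<^esub> y \<in> carrier X" using x y by simp
    show "lift k M N P (\<beta> (x \<oplus>\<^bsub>X\<^esub> y)) u = lift k M N P (\<beta> x) u \<oplus>\<^bsub>P\<^esub> lift k M N P (\<beta> y) u"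
      by (rule tensor_lin_eqI[OF lift_lin[OF P \<beta>[OF xy]]
            lin_plus[OF P lift_lin[OF P \<beta>[OF x]] lift_lin[OF P \<beta>[OF y]]] _ u])
        (simp add: lift_pure[OF P \<beta>] x y lin_add[OF l]) }
  fix r assume r: "r \<in> carrier k"
  have rx: "r \<odot>\<^bsub>X\<^esub> x \<in> carrier X" using x r by simp
  show "lift k M N P (\<beta> (r \<odot>\<^bsub>X\<^esub> x)) u = r \<odot>\<^bsub>P\<^esub> lift k M N P (\<beta> x) u"
    by (rule tensor_lin_eqI[OF lift_lin[OF P \<beta>[OF rx]] lin_smult_vector[OF P r lift_lin[OF P \<beta>[OF x]]] _ u])
      (simp add: lift_pure[OF P \<beta>] x r lin_smult[OF l])
qed

end

lemmas lin_lift_map [lin_intros] = tensor_product.lift_lin[OF tensor_product.intro]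
lemmas lin_lift_elem [lin_intros] = tensor_product.lift_elem[OF tensor_product.intro]
lemmas lin_lift_param [lin_intros] = tensor_product.lift_param[OF tensor_product.intro]
lemmas lift_closed [lin_intros] = tensor_product.lift_closed[OF tensor_product.intro]
lemmas lin_lift = tensor_product.lin_lift[OF tensor_product.intro]
lemmas lift_cong = tensor_product.lift_cong[OF tensor_product.intro]
lemmas lift_pure = tensor_product.lift_pure[OF tensor_product.intro]
lemmas tensor_lin_eqI = tensor_product.tensor_lin_eqI[OF tensor_product.intro]

text \<open>
  In Sweedler notation this is substitution: to evaluate \<open>\<beta>\<close> on a tensor presented as
  \<open>f(a, b) \<otimes> g(a, b)\<close> one inserts both legs into \<open>\<beta>\<close>.
\<close>

lemma lift_lift_pure:
  assumes mods: "module k M" "module k N" "module k A" "module k B" "module k P"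
    and \<beta>: "bilin k M N P \<beta>"
    and \<gamma>: "bilin k A B (tensor k M N) (\<lambda>a b. pure k M N (f a b) (g a b))"
    and fg: "\<And>a b. a \<in> carrier A \<Longrightarrow> b \<in> carrier B \<Longrightarrow> f a b \<in> carrier M"
      "\<And>a b. a \<in> carrier A \<Longrightarrow> b \<in> carrier B \<Longrightarrow> g a b \<in> carrier N"
    and u: "u \<in> carrier (tensor k A B)"
  shows "lift k M N P \<beta> (lift k A B (tensor k M N) (\<lambda>a b. pure k M N (f a b) (g a b)) u) =
    lift k A B P (\<lambda>a b. \<beta> (f a b) (g a b)) u"
proof -
  have L: "lift k M N P \<beta> \<in> lin k (tensor k M N) P" by (intro lin_lift_map mods \<beta>)
  have "lift k M N P \<beta> (lift k A B (tensor k M N) (\<lambda>a b. pure k M N (f a b) (g a b)) u) =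
    lift k A B P (\<lambda>a b. lift k M N P \<beta> (pure k M N (f a b) (g a b))) u"
    by (intro lin_lift mods module_tensorI \<gamma> L u)
  also have "\<dots> = lift k A B P (\<lambda>a b. \<beta> (f a b) (g a b)) u"
    by (intro lift_cong mods bilinI lin_comp[OF L bilinD(1)[OF \<gamma>]] lin_comp[OF L bilinD(2)[OF \<gamma>]] u
        lift_pure \<beta> fg)
  finally show ?thesis .
qed

text \<open>
  The order of two independent Sweedler summations is irrelevant. Both sides are linear in \<open>v\<close>,
  so it suffices to compare them on pure tensors, where the summation over \<open>v\<close> disappears.
\<close>

lemma lift_swap:
  assumes mods: "module k A" "module k B" "module k C" "module k D" "module k P"
    and u: "u \<in> carrier (tensor k A B)" and v: "v \<in> carrier (tensor k C D)"
    and \<tau>: "\<And>a b. a \<in> carrier A \<Longrightarrow> b \<in> carrier B \<Longrightarrow> bilin k C D P (\<tau> a b)"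
      "\<And>c d. c \<in> carrier C \<Longrightarrow> d \<in> carrier D \<Longrightarrow> bilin k A B P (\<lambda>a b. \<tau> a b c d)"
  shows "lift k A B P (\<lambda>a b. lift k C D P (\<tau> a b) v) u =
    lift k C D P (\<lambda>c d. lift k A B P (\<lambda>a b. \<tau> a b c d) u) v"
proof (rule tensor_lin_eqI[OF mods(3,4) _ _ _ v])
  have inner: "bilin k A B P (\<lambda>a b. lift k C D P (\<tau> a b) v)" if "v \<in> carrier (tensor k C D)" for v
    by (intro bilinI lin_lift_param mods that \<tau> bilinD(1)[OF \<tau>(2)] bilinD(2)[OF \<tau>(2)])
  show "(\<lambda>v. lift k A B P (\<lambda>a b. lift k C D P (\<tau> a b) v) u) \<in> lin k (tensor k C D) P"
    by (intro lin_lift_param lin_lift_elem lin_id mods u module_tensorI inner \<tau>)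
  have outer: "bilin k C D P (\<lambda>c d. lift k A B P (\<lambda>a b. \<tau> a b c d) u)"
    by (intro bilinI lin_lift_param mods u \<tau> bilinD(1)[OF \<tau>(1)] bilinD(2)[OF \<tau>(1)])
  show "lift k C D P (\<lambda>c d. lift k A B P (\<lambda>a b. \<tau> a b c d) u) \<in> lin k (tensor k C D) P"
    by (intro tensor_product.lift_lin tensor_product.intro mods outer)
  fix c d assume cd: "c \<in> carrier C" "d \<in> carrier D"
  have "lift k A B P (\<lambda>a b. lift k C D P (\<tau> a b) (pure k C D c d)) u = lift k A B P (\<lambda>a b. \<tau> a b c d) u"
    by (intro lift_cong mods inner pure_closed cd u lift_pure \<tau>)
  also have "\<dots> = lift k C D P (\<lambda>c d. lift k A B P (\<lambda>a b. \<tau> a b c d) u) (pure k C D c d)"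
    by (intro lift_pure[symmetric] mods outer cd)
  finally show "lift k A B P (\<lambda>a b. lift k C D P (\<tau> a b) (pure k C D c d)) u =
    lift k C D P (\<lambda>c d. lift k A B P (\<lambda>a b. \<tau> a b c d) u) (pure k C D c d)" .
qed

definition trilin ::
  "('k, 'e) ring_scheme \<Rightarrow> ('k, 'a, 'u) module_scheme \<Rightarrow> ('k, 'b, 'v) module_scheme
    \<Rightarrow> ('k, 'c, 'w) module_scheme \<Rightarrow> ('k, 'p, 'x) module_scheme \<Rightarrow> ('a \<Rightarrow> 'b \<Rightarrow> 'c \<Rightarrow> 'p) \<Rightarrow> bool"
  where "trilin k A B C P \<tau> \<longleftrightarrow> (\<forall>a\<in>carrier A. bilin k B C P (\<lambda>b c. \<tau> a b c)) \<and>
      (\<forall>b\<in>carrier B. bilin k A C P (\<lambda>a c. \<tau> a b c)) \<and> (\<forall>c\<in>carrier C. bilin k A B P (\<lambda>a b. \<tau> a b c))"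

lemma trilinI:
  assumes "\<And>a. a \<in> carrier A \<Longrightarrow> bilin k B C P (\<lambda>b c. \<tau> a b c)"
    and "\<And>b. b \<in> carrier B \<Longrightarrow> bilin k A C P (\<lambda>a c. \<tau> a b c)"
    and "\<And>c. c \<in> carrier C \<Longrightarrow> bilin k A B P (\<lambda>a b. \<tau> a b c)"
  shows "trilin k A B C P \<tau>"
  using assms by (auto simp: trilin_def)

lemma trilinD:
  assumes "trilin k A B C P \<tau>"
  shows "a \<in> carrier A \<Longrightarrow> bilin k B C P (\<lambda>b c. \<tau> a b c)"
    and "b \<in> carrier B \<Longrightarrow> bilin k A C P (\<lambda>a c. \<tau> a b c)"
    and "c \<in> carrier C \<Longrightarrow> bilin k A B P (\<lambda>a b. \<tau> a b c)"
    and "b \<in> carrier B \<Longrightarrow> c \<in> carrier C \<Longrightarrow> f \<in> lin k X A \<Longrightarrow> (\<lambda>x. \<tau> (f x) b c) \<in> lin k X P"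
    and "a \<in> carrier A \<Longrightarrow> c \<in> carrier C \<Longrightarrow> g \<in> lin k X B \<Longrightarrow> (\<lambda>x. \<tau> a (g x) c) \<in> lin k X P"
    and "a \<in> carrier A \<Longrightarrow> b \<in> carrier B \<Longrightarrow> h \<in> lin k X C \<Longrightarrow> (\<lambda>x. \<tau> a b (h x)) \<in> lin k X P"
  using assms lin_comp[of "\<lambda>a. \<tau> a b c" k A P] lin_comp[of "\<lambda>b. \<tau> a b c" k B P]
    lin_comp[of "\<lambda>c. \<tau> a b c" k C P]
  unfolding trilin_def bilin_def by blast+

text \<open>
  The map \<open>T\<close> is the linear map induced by \<open>\<tau>\<close>. Its values on \<open>extl\<close> and \<open>extr\<close> translate equations
  in a threefold tensor product into equations for arbitrary trilinear maps.
\<close>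

lemma tensor3_universal:
  assumes mods: "module k A" "module k B" "module k C" "module k P" and \<tau>: "trilin k A B C P \<tau>"
  obtains T where "T \<in> lin k (tensor3 k A B C) P"
    and "\<And>a b c. \<lbrakk>a \<in> carrier A; b \<in> carrier B; c \<in> carrier C\<rbrakk> \<Longrightarrow> T (pure3 k A B C a b c) = \<tau> a b c"
    and "\<And>v c. \<lbrakk>v \<in> carrier (tensor k A B); c \<in> carrier C\<rbrakk>
      \<Longrightarrow> T (extl k A B C v c) = lift k A B P (\<lambda>a b. \<tau> a b c) v"
    and "\<And>a v. \<lbrakk>a \<in> carrier A; v \<in> carrier (tensor k B C)\<rbrakk>
      \<Longrightarrow> T (extr k A B C a v) = lift k B C P (\<lambda>b c. \<tau> a b c) v"
proof
  note [lin_intros] = mods trilinD[OF \<tau>]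
  let ?T = "lift k (tensor k A B) C P (\<lambda>v c. lift k A B P (\<lambda>a b. \<tau> a b c) v)"
  show lin: "?T \<in> lin k (tensor3 k A B C) P" unfolding tensor3_def by (intro bilinI lin_intros)
  show extl: "?T (extl k A B C v c) = lift k A B P (\<lambda>a b. \<tau> a b c) v"
    if "v \<in> carrier (tensor k A B)" "c \<in> carrier C" for v c
    unfolding extl_def by (rule lift_pure; (intro bilinI lin_intros that)?)
  show pure: "?T (pure3 k A B C a b c) = \<tau> a b c"
    if that [lin_intros]: "a \<in> carrier A" "b \<in> carrier B" "c \<in> carrier C" for a b c
  proof -
    have "?T (pure3 k A B C a b c) = lift k A B P (\<lambda>a b. \<tau> a b c) (pure k A B a b)"
      unfolding pure3_def by (rule lift_pure; (intro bilinI lin_intros)?)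
    also have "\<dots> = \<tau> a b c" by (rule lift_pure; (intro bilinI lin_intros)?)
    finally show ?thesis .
  qed
  show "?T (extr k A B C a v) = lift k B C P (\<lambda>b c. \<tau> a b c) v"
    if that [lin_intros]: "a \<in> carrier A" "v \<in> carrier (tensor k B C)" for a v
  proof -
    note [lin_intros] = lin[unfolded tensor3_def] lin_comp[OF lin[unfolded tensor3_def]]
    have "?T (extr k A B C a v) = lift k B C P (\<lambda>b c. ?T (pure3 k A B C a b c)) v"
      unfolding extr_def tensor3_def pure3_def by (rule lin_lift; (intro bilinI lin_intros)?)
    also have "\<dots> = lift k B C P (\<lambda>b c. \<tau> a b c) v"
      unfolding pure3_def by (rule lift_cong; (intro bilinI lin_intros pure[unfolded pure3_def])?)
    finally show ?thesis .
  qed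
qed

section \<open>Separable Frobenius algebras\<close>

context assoc_algebra
begin

lemma module_algebra [lin_intros]: "module k A" ..

lemma mult_closed [lin_intros]: "x \<in> carrier A \<Longrightarrow> y \<in> carrier A \<Longrightarrow> x \<otimes>\<^bsub>A\<^esub> y \<in> carrier A"
  by simp

lemma lin_mult_left [lin_intros]:
  assumes "c \<in> carrier A" "f \<in> lin k X A"
  shows "(\<lambda>x. c \<otimes>\<^bsub>A\<^esub> f x) \<in> lin k X A"
proof -
  have "(\<lambda>a. c \<otimes>\<^bsub>A\<^esub> a) \<in> lin k A A"
    using assms(1) by (intro linI) (auto simp: A.r_distr smult_mult_r)
  from lin_comp[OF this assms(2)] show ?thesis .
qed

lemma lin_mult_right [lin_intros]:
  assumes "c \<in> carrier A" "f \<in> lin k X A"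
  shows "(\<lambda>x. f x \<otimes>\<^bsub>A\<^esub> c) \<in> lin k X A"
proof -
  have "(\<lambda>a. a \<otimes>\<^bsub>A\<^esub> c) \<in> lin k A A"
    using assms(1) by (intro linI) (auto simp: A.l_distr smult_mult_l)
  from lin_comp[OF this assms(2)] show ?thesis .
qed

end

context left_module
begin

lemma module_left_module [lin_intros]: "module k M" ..

lemma l_closed [lin_intros]: "a \<in> carrier A \<Longrightarrow> m \<in> carrier M \<Longrightarrow> l a m \<in> carrier M"
  by (rule lin_closed[OF l_lin])

lemma lin_left_action [lin_intros]:
  shows "m \<in> carrier M \<Longrightarrow> f \<in> lin k X A \<Longrightarrow> (\<lambda>x. l (f x) m) \<in> lin k X M"
    and "a \<in> carrier A \<Longrightarrow> g \<in> lin k X M \<Longrightarrow> (\<lambda>x. l a (g x)) \<in> lin k X M"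
  using lin_comp[OF l_lin_scalar] lin_comp[OF l_lin] by fast+

end

context right_module
begin

lemma module_right_module [lin_intros]: "module k M" ..

lemma r_closed [lin_intros]: "a \<in> carrier A \<Longrightarrow> m \<in> carrier M \<Longrightarrow> r m a \<in> carrier M"
  by (rule lin_closed[OF r_lin])

lemma lin_right_action [lin_intros]:
  shows "m \<in> carrier M \<Longrightarrow> f \<in> lin k X A \<Longrightarrow> (\<lambda>x. r m (f x)) \<in> lin k X M"
    and "a \<in> carrier A \<Longrightarrow> g \<in> lin k X M \<Longrightarrow> (\<lambda>x. r (g x) a) \<in> lin k X M"
  using lin_comp[OF r_lin_scalar] lin_comp[OF r_lin] by fast+

end

text \<open>
  The element \<open>e = x \<otimes> z\<close> together with \<open>\<epsilon>\<close> is a Frobenius system whose Casimir element is also a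
  separability idempotent. The comultiplication \<open>a \<mapsto> a x \<otimes> z\<close> is prescribed only on the carrier, so
  that a map given by another formula can be inserted for \<open>\<Delta>\<close>; the same holds for the coactions
  below.
\<close>

locale separable_frobenius = assoc_algebra k A
  for k :: "('k, 'e) ring_scheme" and A :: "('k, 'a, 'u) module_scheme" +
  fixes e :: "('k, 'a, 'a) tens" and \<Delta> :: "'a \<Rightarrow> ('k, 'a, 'a) tens" and \<epsilon> :: "'a \<Rightarrow> 'k"
  assumes eps_lin [lin_intros]: "\<epsilon> \<in> lin k A (regular_module k)"
    and e_closed [lin_intros]: "e \<in> carrier (tensor k A A)"
    and casimir: "a \<in> carrier A \<Longrightarrow>
      lift k A A (tensor k A A) (\<lambda>x z. pure k A A (a \<otimes>\<^bsub>A\<^esub> x) z) e =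
      lift k A A (tensor k A A) (\<lambda>x z. pure k A A x (z \<otimes>\<^bsub>A\<^esub> a)) e"
    and separable: "lift k A A A (\<lambda>x z. x \<otimes>\<^bsub>A\<^esub> z) e = \<one>\<^bsub>A\<^esub>"
    and counit_e_l: "lift k A A A (\<lambda>x z. \<epsilon> x \<odot>\<^bsub>A\<^esub> z) e = \<one>\<^bsub>A\<^esub>"
    and counit_e_r: "lift k A A A (\<lambda>x z. \<epsilon> z \<odot>\<^bsub>A\<^esub> x) e = \<one>\<^bsub>A\<^esub>"
    and comult_eq: "a \<in> carrier A \<Longrightarrow>
      \<Delta> a = lift k A A (tensor k A A) (\<lambda>x z. pure k A A (a \<otimes>\<^bsub>A\<^esub> x) z) e"
begin

lemma lin_eps [lin_intros]: "f \<in> lin k X A \<Longrightarrow> (\<lambda>x. \<epsilon> (f x)) \<in> lin k X (regular_module k)"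
  by (rule lin_comp[OF eps_lin])

lemma eps_closed [lin_intros]: "x \<in> carrier A \<Longrightarrow> \<epsilon> x \<in> carrier k"
  using lin_closed[OF eps_lin] by (simp add: regular_module_def)

lemma casimir_lift:
  assumes P: "module k P" and \<beta>: "bilin k A A P \<beta>" and a: "a \<in> carrier A"
  shows "lift k A A P (\<lambda>x z. \<beta> (a \<otimes>\<^bsub>A\<^esub> x) z) e = lift k A A P (\<lambda>x z. \<beta> x (z \<otimes>\<^bsub>A\<^esub> a)) e"
proof -
  note [lin_intros] = P \<beta> a
  have "lift k A A P \<beta> (lift k A A (tensor k A A) (\<lambda>x z. pure k A A (a \<otimes>\<^bsub>A\<^esub> x) z) e) =
      lift k A A P (\<lambda>x z. \<beta> (a \<otimes>\<^bsub>A\<^esub> x) z) e"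
    by (rule lift_lift_pure; (intro bilinI lin_intros)?)
  moreover have "lift k A A P \<beta> (lift k A A (tensor k A A) (\<lambda>x z. pure k A A x (z \<otimes>\<^bsub>A\<^esub> a)) e) =
      lift k A A P (\<lambda>x z. \<beta> x (z \<otimes>\<^bsub>A\<^esub> a)) e"
    by (rule lift_lift_pure; (intro bilinI lin_intros)?)
  ultimately show ?thesis by (simp add: casimir[OF a])
qed

text \<open>
  Sliding a factor through the inner copy of \<open>e\<close> by the Casimir identity identifies all ways
  to put two copies of \<open>e\<close> side by side in a threefold tensor product.
\<close>

lemma casimir_twice:
  assumes P: "module k P" and \<tau>: "trilin k A A A P \<tau>"
  shows "lift k A A P (\<lambda>x z. lift k A A P (\<lambda>x' z'. \<tau> (x \<otimes>\<^bsub>A\<^esub> x') z' z) e) e =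
      lift k A A P (\<lambda>x z. lift k A A P (\<lambda>x' z'. \<tau> x (z \<otimes>\<^bsub>A\<^esub> x') z') e) e" (is "?one = ?two")
    and "lift k A A P (\<lambda>x z. lift k A A P (\<lambda>x' z'. \<tau> x (z \<otimes>\<^bsub>A\<^esub> x') z') e) e =
      lift k A A P (\<lambda>x z. lift k A A P (\<lambda>x' z'. \<tau> x x' (z' \<otimes>\<^bsub>A\<^esub> z)) e) e" (is "_ = ?three")
proof -
  note [lin_intros] = P trilinD[OF \<tau>]
  have "?one = lift k A A P (\<lambda>x z. lift k A A P (\<lambda>x' z'. \<tau> x' (z' \<otimes>\<^bsub>A\<^esub> x) z) e) e"
    by (rule lift_cong; (intro bilinI lin_intros casimir_lift)?)
  also have "\<dots> = ?two"
    by (rule lift_swap; (intro bilinI lin_intros)?)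
  finally show "?one = ?two" .
  show "?two = ?three"
    by (rule lift_cong; (intro bilinI lin_intros casimir_lift)?)
qed

lemma comult_lin [lin_intros]: "\<Delta> \<in> lin k A (tensor k A A)"
  by (rule lin_cong[OF module_algebra _ comult_eq]) (intro bilinI lin_intros)

lemma lin_comult [lin_intros]: "f \<in> lin k X A \<Longrightarrow> (\<lambda>x. \<Delta> (f x)) \<in> lin k X (tensor k A A)"
  by (rule lin_comp[OF comult_lin])

lemma comult_closed [lin_intros]: "a \<in> carrier A \<Longrightarrow> \<Delta> a \<in> carrier (tensor k A A)"
  by (rule lin_closed[OF comult_lin])

lemma lin_of_comult:
  assumes P: "module k P" and g: "g \<in> lin k (tensor k A A) P" and a: "a \<in> carrier A"
  shows "g (\<Delta> a) = lift k A A P (\<lambda>x z. g (pure k A A (a \<otimes>\<^bsub>A\<^esub> x) z)) e"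
  unfolding comult_eq[OF a] by (rule lin_lift; (intro bilinI lin_intros P g a)?)

lemma lift_comult:
  assumes P: "module k P" and \<beta>: "bilin k A A P \<beta>" and a: "a \<in> carrier A"
  shows "lift k A A P \<beta> (\<Delta> a) = lift k A A P (\<lambda>x z. \<beta> (a \<otimes>\<^bsub>A\<^esub> x) z) e"
  unfolding comult_eq[OF a] by (rule lift_lift_pure; (intro bilinI lin_intros P \<beta> a)?)

end

lemma (in assoc_algebra) right_regular: "right_module k A A (\<otimes>\<^bsub>A\<^esub>)"
  by unfold_locales (auto intro!: lin_intros simp: A.m_assoc)

text \<open>The right coaction is \<open>m \<mapsto> m x \<otimes> z\<close>; the left one, in \<open>frobenius_left\<close>, is \<open>m \<mapsto> x \<otimes> z m\<close>.\<close>

locale frobenius_right = separable_frobenius k A e \<Delta> \<epsilon> + right_module k A M r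
  for k :: "('k, 'e) ring_scheme" and A :: "('k, 'a, 'u) module_scheme"
    and e :: "('k, 'a, 'a) tens" and \<Delta> :: "'a \<Rightarrow> ('k, 'a, 'a) tens" and \<epsilon> :: "'a \<Rightarrow> 'k"
    and M :: "('k, 'm, 'v) module_scheme" and r :: "'m \<Rightarrow> 'a \<Rightarrow> 'm" +
  fixes \<rho> :: "'m \<Rightarrow> ('k, 'm, 'a) tens"
  assumes rho_eq: "m \<in> carrier M \<Longrightarrow>
      \<rho> m = lift k A A (tensor k M A) (\<lambda>x z. pure k M A (r m x) z) e"
begin

lemma rho_lin [lin_intros]: "\<rho> \<in> lin k M (tensor k M A)"
  by (rule lin_cong[OF module_right_module _ rho_eq]) (intro bilinI lin_intros)

lemma lin_rho [lin_intros]: "f \<in> lin k X M \<Longrightarrow> (\<lambda>x. \<rho> (f x)) \<in> lin k X (tensor k M A)"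
  by (rule lin_comp[OF rho_lin])

lemma rho_closed [lin_intros]: "m \<in> carrier M \<Longrightarrow> \<rho> m \<in> carrier (tensor k M A)"
  by (rule lin_closed[OF rho_lin])

lemma lin_of_rho:
  assumes P: "module k P" and g: "g \<in> lin k (tensor k M A) P" and m: "m \<in> carrier M"
  shows "g (\<rho> m) = lift k A A P (\<lambda>x z. g (pure k M A (r m x) z)) e"
  unfolding rho_eq[OF m] by (rule lin_lift; (intro bilinI lin_intros P g m)?)

lemma lift_rho:
  assumes P: "module k P" and \<beta>: "bilin k M A P \<beta>" and m: "m \<in> carrier M"
  shows "lift k M A P \<beta> (\<rho> m) = lift k A A P (\<lambda>x z. \<beta> (r m x) z) e"
  unfolding rho_eq[OF m] by (rule lift_lift_pure; (intro bilinI lin_intros P \<beta> m)?)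

text \<open>Both sides are a double Sweedler sum: \<open>m x x' \<otimes> z' \<otimes> z\<close> on the left, \<open>m x \<otimes> z x' \<otimes> z'\<close> on the right.\<close>

lemma right_coassoc:
  assumes m: "m \<in> carrier M"
  shows "lift k M A (tensor3 k M A A) (\<lambda>n c. extl k M A A (\<rho> n) c) (\<rho> m) =
      lift k M A (tensor3 k M A A) (\<lambda>n c. extr k M A A n (\<Delta> c)) (\<rho> m)"
proof -
  let ?T = "tensor k (tensor k M A) A"
  let ?p = "\<lambda>n b c. pure k (tensor k M A) A (pure k M A n b) c"
  note [lin_intros] = m
  have "lift k M A ?T (\<lambda>n c. pure k (tensor k M A) A (\<rho> n) c) (\<rho> m) =
      lift k A A ?T (\<lambda>x z. pure k (tensor k M A) A (\<rho> (r m x)) z) e"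
    by (rule lift_rho; (intro bilinI lin_intros)?)
  also have "\<dots> = lift k A A ?T (\<lambda>x z. lift k A A ?T (\<lambda>x' z'. ?p (r (r m x) x') z' z) e) e"
    by (rule lift_cong; (intro bilinI lin_intros lin_of_rho)?)
  also have "\<dots> = lift k A A ?T (\<lambda>x z. lift k A A ?T (\<lambda>x' z'. ?p (r m (x \<otimes>\<^bsub>A\<^esub> x')) z' z) e) e"
    by (rule lift_cong; (intro bilinI lin_intros lift_cong)?; simp add: r_assoc m)
  also have "\<dots> = lift k A A ?T (\<lambda>x z. lift k A A ?T (\<lambda>x' z'. ?p (r m x) (z \<otimes>\<^bsub>A\<^esub> x') z') e) e"
    by (rule casimir_twice(1)[where \<tau> = "\<lambda>p q s. ?p (r m p) q s"]; (intro trilinI bilinI lin_intros)?)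
  also have "\<dots> = lift k A A ?T (\<lambda>x z. lift k A A ?T (?p (r m x)) (\<Delta> z)) e"
    by (rule lift_cong; (intro bilinI lin_intros lift_comult[symmetric])?)
  also have "\<dots> = lift k M A ?T (\<lambda>n c. lift k A A ?T (?p n) (\<Delta> c)) (\<rho> m)"
    by (rule lift_rho[symmetric]; (intro bilinI lin_intros)?)
  finally show ?thesis by (simp only: extl_def extr_def tensor3_def pure3_def)
qed

lemma right_counit:
  assumes m: "m \<in> carrier M"
  shows "lift k M A M (\<lambda>n c. \<epsilon> c \<odot>\<^bsub>M\<^esub> n) (\<rho> m) = m"
proof -
  note [lin_intros] = m
  have "lift k M A M (\<lambda>n c. \<epsilon> c \<odot>\<^bsub>M\<^esub> n) (\<rho> m) = lift k A A M (\<lambda>x z. \<epsilon> z \<odot>\<^bsub>M\<^esub> r m x) e"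
    by (rule lift_rho; (intro bilinI lin_intros)?)
  also have "\<dots> = lift k A A M (\<lambda>x z. r m (\<epsilon> z \<odot>\<^bsub>A\<^esub> x)) e"
    by (rule lift_cong; (intro bilinI lin_intros)?; simp add: lin_smult[OF r_lin_scalar] m eps_closed)
  also have "\<dots> = r m (lift k A A A (\<lambda>x z. \<epsilon> z \<odot>\<^bsub>A\<^esub> x) e)"
    by (rule lin_lift[symmetric]; (intro bilinI lin_intros)?)
  finally show ?thesis by (simp add: counit_e_r r_one m)
qed

end

locale frobenius_left = separable_frobenius k A e \<Delta> \<epsilon> + left_module k A M l
  for k :: "('k, 'e) ring_scheme" and A :: "('k, 'a, 'u) module_scheme"
    and e :: "('k, 'a, 'a) tens" and \<Delta> :: "'a \<Rightarrow> ('k, 'a, 'a) tens" and \<epsilon> :: "'a \<Rightarrow> 'k"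
    and M :: "('k, 'm, 'v) module_scheme" and l :: "'a \<Rightarrow> 'm \<Rightarrow> 'm" +
  fixes \<theta> :: "'m \<Rightarrow> ('k, 'a, 'm) tens"
  assumes theta_eq: "m \<in> carrier M \<Longrightarrow>
      \<theta> m = lift k A A (tensor k A M) (\<lambda>x z. pure k A M x (l z m)) e"
begin

lemma theta_lin [lin_intros]: "\<theta> \<in> lin k M (tensor k A M)"
  by (rule lin_cong[OF module_left_module _ theta_eq]) (intro bilinI lin_intros)

lemma lin_theta [lin_intros]: "f \<in> lin k X M \<Longrightarrow> (\<lambda>x. \<theta> (f x)) \<in> lin k X (tensor k A M)"
  by (rule lin_comp[OF theta_lin])

lemma theta_closed [lin_intros]: "m \<in> carrier M \<Longrightarrow> \<theta> m \<in> carrier (tensor k A M)"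
  by (rule lin_closed[OF theta_lin])

lemma lin_of_theta:
  assumes P: "module k P" and g: "g \<in> lin k (tensor k A M) P" and m: "m \<in> carrier M"
  shows "g (\<theta> m) = lift k A A P (\<lambda>x z. g (pure k A M x (l z m))) e"
  unfolding theta_eq[OF m] by (rule lin_lift; (intro bilinI lin_intros P g m)?)

lemma lift_theta:
  assumes P: "module k P" and \<beta>: "bilin k A M P \<beta>" and m: "m \<in> carrier M"
  shows "lift k A M P \<beta> (\<theta> m) = lift k A A P (\<lambda>x z. \<beta> x (l z m)) e"
  unfolding theta_eq[OF m] by (rule lift_lift_pure; (intro bilinI lin_intros P \<beta> m)?)

text \<open>Here the two sides are \<open>x x' \<otimes> z' \<otimes> z m\<close> and \<open>x \<otimes> x' \<otimes> z' z m\<close>.\<close>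

lemma left_coassoc:
  assumes m: "m \<in> carrier M"
  shows "lift k A M (tensor3 k A A M) (\<lambda>c n. extl k A A M (\<Delta> c) n) (\<theta> m) =
      lift k A M (tensor3 k A A M) (\<lambda>c n. extr k A A M c (\<theta> n)) (\<theta> m)"
proof -
  let ?T = "tensor k (tensor k A A) M"
  let ?p = "\<lambda>b c n. pure k (tensor k A A) M (pure k A A b c) n"
  note [lin_intros] = m
  have "lift k A M ?T (\<lambda>c n. pure k (tensor k A A) M (\<Delta> c) n) (\<theta> m) =
      lift k A A ?T (\<lambda>x z. pure k (tensor k A A) M (\<Delta> x) (l z m)) e"
    by (rule lift_theta; (intro bilinI lin_intros)?)
  also have "\<dots> = lift k A A ?T (\<lambda>x z. lift k A A ?T (\<lambda>x' z'. ?p (x \<otimes>\<^bsub>A\<^esub> x') z' (l z m)) e) e"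
    by (rule lift_cong; (intro bilinI lin_intros lin_of_comult)?)
  also have "\<dots> = lift k A A ?T (\<lambda>x z. lift k A A ?T (\<lambda>x' z'. ?p x (z \<otimes>\<^bsub>A\<^esub> x') (l z' m)) e) e"
    by (rule casimir_twice(1)[where \<tau> = "\<lambda>p q s. ?p p q (l s m)"]; (intro trilinI bilinI lin_intros)?)
  also have "\<dots> = lift k A A ?T (\<lambda>x z. lift k A A ?T (\<lambda>x' z'. ?p x x' (l (z' \<otimes>\<^bsub>A\<^esub> z) m)) e) e"
    by (rule casimir_twice(2)[where \<tau> = "\<lambda>p q s. ?p p q (l s m)"]; (intro trilinI bilinI lin_intros)?)
  also have "\<dots> = lift k A A ?T (\<lambda>x z. lift k A A ?T (\<lambda>x' z'. ?p x x' (l z' (l z m))) e) e"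
    by (rule lift_cong; (intro bilinI lin_intros lift_cong)?; simp add: l_assoc m)
  also have "\<dots> = lift k A A ?T (\<lambda>x z. lift k A M ?T (?p x) (\<theta> (l z m))) e"
    by (rule lift_cong; (intro bilinI lin_intros lift_theta[symmetric])?)
  also have "\<dots> = lift k A M ?T (\<lambda>c n. lift k A M ?T (?p c) (\<theta> n)) (\<theta> m)"
    by (rule lift_theta[symmetric]; (intro bilinI lin_intros)?)
  finally show ?thesis by (simp only: extl_def extr_def tensor3_def pure3_def)
qed

lemma left_counit:
  assumes m: "m \<in> carrier M"
  shows "lift k A M M (\<lambda>c n. \<epsilon> c \<odot>\<^bsub>M\<^esub> n) (\<theta> m) = m"
proof -
  note [lin_intros] = m
  have "lift k A M M (\<lambda>c n. \<epsilon> c \<odot>\<^bsub>M\<^esub> n) (\<theta> m) = lift k A A M (\<lambda>x z. \<epsilon> x \<odot>\<^bsub>M\<^esub> l z m) e"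
    by (rule lift_theta; (intro bilinI lin_intros)?)
  also have "\<dots> = lift k A A M (\<lambda>x z. l (\<epsilon> x \<odot>\<^bsub>A\<^esub> z) m) e"
    by (rule lift_cong; (intro bilinI lin_intros)?; simp add: lin_smult[OF l_lin_scalar] m eps_closed)
  also have "\<dots> = l (lift k A A A (\<lambda>x z. \<epsilon> x \<odot>\<^bsub>A\<^esub> z) e) m"
    by (rule lin_lift[where g = "\<lambda>a. l a m", symmetric]; (intro bilinI lin_intros)?)
  finally show ?thesis by (simp add: counit_e_l l_one m)
qed

end

context separable_frobenius
begin

text \<open>
  The comultiplication is the right coaction of the right regular module, which yields
  coassociativity and one counit law. For the other one, the Casimir identity turns
  \<open>\<epsilon>(c x) z\<close> into \<open>\<epsilon>(x) z c\<close>.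
\<close>

lemma coalgebra: "coalgebra k A \<Delta> \<epsilon>"
proof -
  interpret right_module k A A "(\<otimes>\<^bsub>A\<^esub>)" by (rule right_regular)
  interpret R: frobenius_right k A e \<Delta> \<epsilon> A "(\<otimes>\<^bsub>A\<^esub>)" \<Delta>
    by unfold_locales (rule comult_eq)
  show ?thesis
  proof unfold_locales
    fix c assume c: "c \<in> carrier A"
    note [lin_intros] = c
    have "lift k A A A (\<lambda>a b. \<epsilon> a \<odot>\<^bsub>A\<^esub> b) (\<Delta> c) = lift k A A A (\<lambda>x z. \<epsilon> (c \<otimes>\<^bsub>A\<^esub> x) \<odot>\<^bsub>A\<^esub> z) e"
      by (rule lift_comult; (intro bilinI lin_intros)?)
    also have "\<dots> = lift k A A A (\<lambda>x z. \<epsilon> x \<odot>\<^bsub>A\<^esub> (z \<otimes>\<^bsub>A\<^esub> c)) e"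
      by (rule casimir_lift[where \<beta> = "\<lambda>x z. \<epsilon> x \<odot>\<^bsub>A\<^esub> z"]; (intro bilinI lin_intros)?)
    also have "\<dots> = lift k A A A (\<lambda>x z. (\<epsilon> x \<odot>\<^bsub>A\<^esub> z) \<otimes>\<^bsub>A\<^esub> c) e"
      by (rule lift_cong; (intro bilinI lin_intros)?; simp add: smult_mult_l c eps_closed)
    also have "\<dots> = lift k A A A (\<lambda>x z. \<epsilon> x \<odot>\<^bsub>A\<^esub> z) e \<otimes>\<^bsub>A\<^esub> c"
      by (rule lin_lift[where g = "\<lambda>a. a \<otimes>\<^bsub>A\<^esub> c", symmetric]; (intro bilinI lin_intros)?)
    finally show "lift k A A A (\<lambda>a b. \<epsilon> a \<odot>\<^bsub>A\<^esub> b) (\<Delta> c) = c" by (simp add: counit_e_l c)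
  qed (rule comult_lin eps_lin R.right_coassoc R.right_counit; assumption)+
qed

end

locale frobenius_bimodule =
  frobenius_left k A e \<Delta> \<epsilon> M l \<theta> + frobenius_right k A e \<Delta> \<epsilon> M r \<rho> + bimodule k A M l r
  for k :: "('k, 'e) ring_scheme" and A :: "('k, 'a, 'u) module_scheme"
    and e :: "('k, 'a, 'a) tens" and \<Delta> :: "'a \<Rightarrow> ('k, 'a, 'a) tens" and \<epsilon> :: "'a \<Rightarrow> 'k"
    and M :: "('k, 'm, 'v) module_scheme" and l :: "'a \<Rightarrow> 'm \<Rightarrow> 'm" and r :: "'m \<Rightarrow> 'a \<Rightarrow> 'm"
    and \<theta> :: "'m \<Rightarrow> ('k, 'a, 'm) tens" and \<rho> :: "'m \<Rightarrow> ('k, 'm, 'a) tens"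
begin

text \<open>The two sides are \<open>x' \<otimes> z' (m x) \<otimes> z\<close> and \<open>x' \<otimes> (z' m) x \<otimes> z\<close>.\<close>

lemma coactions_commute:
  assumes m: "m \<in> carrier M"
  shows "lift k M A (tensor3 k A M A) (\<lambda>n c. extl k A M A (\<theta> n) c) (\<rho> m) =
      lift k A M (tensor3 k A M A) (\<lambda>c n. extr k A M A c (\<rho> n)) (\<theta> m)"
proof -
  let ?T = "tensor k (tensor k A M) A"
  let ?p = "\<lambda>b n c. pure k (tensor k A M) A (pure k A M b n) c"
  note [lin_intros] = m
  have "lift k M A ?T (\<lambda>n c. pure k (tensor k A M) A (\<theta> n) c) (\<rho> m) =
      lift k A A ?T (\<lambda>x z. pure k (tensor k A M) A (\<theta> (r m x)) z) e"
    by (rule lift_rho; (intro bilinI lin_intros)?)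
  also have "\<dots> = lift k A A ?T (\<lambda>x z. lift k A A ?T (\<lambda>x' z'. ?p x' (l z' (r m x)) z) e) e"
    by (rule lift_cong; (intro bilinI lin_intros lin_of_theta)?)
  also have "\<dots> = lift k A A ?T (\<lambda>x' z'. lift k A A ?T (\<lambda>x z. ?p x' (l z' (r m x)) z) e) e"
    by (rule lift_swap; (intro bilinI lin_intros)?)
  also have "\<dots> = lift k A A ?T (\<lambda>x' z'. lift k A A ?T (\<lambda>x z. ?p x' (r (l z' m) x) z) e) e"
    by (rule lift_cong; (intro bilinI lin_intros lift_cong)?; simp add: l_r_commute m)
  also have "\<dots> = lift k A A ?T (\<lambda>x z. lift k M A ?T (?p x) (\<rho> (l z m))) e"
    by (rule lift_cong; (intro bilinI lin_intros lift_rho[symmetric])?)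
  also have "\<dots> = lift k A M ?T (\<lambda>c n. lift k M A ?T (?p c) (\<rho> n)) (\<theta> m)"
    by (rule lift_theta[symmetric]; (intro bilinI lin_intros)?)
  finally show ?thesis by (simp only: extl_def extr_def tensor3_def pure3_def)
qed

lemma bicomodule: "bicomodule k A \<Delta> \<epsilon> M \<theta> \<rho>"
proof -
  interpret C: coalgebra k A \<Delta> \<epsilon> by (rule coalgebra)
  show ?thesis
    by unfold_locales (rule theta_lin left_coassoc left_counit rho_lin right_coassoc right_counit
        coactions_commute; assumption)+
qed

end

text \<open>The map \<open>\<pi>\<close> is \<open>m \<otimes> n \<mapsto> m x \<otimes> z n\<close>.\<close>

locale frobenius_tensor =
  frobenius_right k A e \<Delta> \<epsilon> M r \<rho> + frobenius_left k A e \<Delta> \<epsilon> N l \<theta>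
  for k :: "('k, 'e) ring_scheme" and A :: "('k, 'a, 'u) module_scheme"
    and e :: "('k, 'a, 'a) tens" and \<Delta> :: "'a \<Rightarrow> ('k, 'a, 'a) tens" and \<epsilon> :: "'a \<Rightarrow> 'k"
    and M :: "('k, 'm, 'v) module_scheme" and r :: "'m \<Rightarrow> 'a \<Rightarrow> 'm" and \<rho> :: "'m \<Rightarrow> ('k, 'm, 'a) tens"
    and N :: "('k, 'n, 'w) module_scheme" and l :: "'a \<Rightarrow> 'n \<Rightarrow> 'n" and \<theta> :: "'n \<Rightarrow> ('k, 'a, 'n) tens" +
  fixes \<pi> :: "('k, 'm, 'n) tens \<Rightarrow> ('k, 'm, 'n) tens"
  assumes pi_eq: "u \<in> carrier (tensor k M N) \<Longrightarrow> \<pi> u = lift k M N (tensor k M N)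
      (\<lambda>m n. lift k A A (tensor k M N) (\<lambda>x z. pure k M N (r m x) (l z n)) e) u"
begin

lemma bilin_pi: "bilin k M N (tensor k M N)
    (\<lambda>m n. lift k A A (tensor k M N) (\<lambda>x z. pure k M N (r m x) (l z n)) e)"
  by (intro bilinI lin_intros)

lemma pi_lin [lin_intros]: "\<pi> \<in> lin k (tensor k M N) (tensor k M N)"
  by (rule lin_cong[OF _ _ pi_eq]) (intro bilinI lin_intros)+

lemma lin_pi [lin_intros]: "f \<in> lin k X (tensor k M N) \<Longrightarrow> (\<lambda>x. \<pi> (f x)) \<in> lin k X (tensor k M N)"
  by (rule lin_comp[OF pi_lin])

lemma pi_closed [lin_intros]: "u \<in> carrier (tensor k M N) \<Longrightarrow> \<pi> u \<in> carrier (tensor k M N)"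
  by (rule lin_closed[OF pi_lin])

lemma pi_pure:
  assumes "m \<in> carrier M" "n \<in> carrier N"
  shows "\<pi> (pure k M N m n) = lift k A A (tensor k M N) (\<lambda>x z. pure k M N (r m x) (l z n)) e"
proof -
  have "\<pi> (pure k M N m n) = lift k M N (tensor k M N)
      (\<lambda>m n. lift k A A (tensor k M N) (\<lambda>x z. pure k M N (r m x) (l z n)) e) (pure k M N m n)"
    by (intro pi_eq lin_intros assms)
  also have "\<dots> = lift k A A (tensor k M N) (\<lambda>x z. pure k M N (r m x) (l z n)) e"
    by (intro lift_pure lin_intros bilin_pi assms)
  finally show ?thesis .
qed

lemma lin_of_pi_pure:
  assumes P: "module k P" and g: "g \<in> lin k (tensor k M N) P" and m: "m \<in> carrier M" and n: "n \<in> carrier N"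
  shows "g (\<pi> (pure k M N m n)) = lift k A A P (\<lambda>x z. g (pure k M N (r m x) (l z n))) e"
  unfolding pi_pure[OF m n] by (rule lin_lift; (intro bilinI lin_intros P g m n)?)

text \<open>This is \<open>x z = 1\<close> acting on \<open>n\<close>.\<close>

lemma separable_collapse:
  assumes P: "module k P" and g: "g \<in> lin k N P" and n: "n \<in> carrier N"
  shows "lift k A A P (\<lambda>x z. g (l x (l z n))) e = g n"
proof -
  note [lin_intros] = P n g lin_comp[OF g]
  have "lift k A A P (\<lambda>x z. g (l x (l z n))) e = lift k A A P (\<lambda>x z. g (l (x \<otimes>\<^bsub>A\<^esub> z) n)) e"
    by (rule lift_cong; (intro bilinI lin_intros)?; simp add: l_assoc n)
  also have "\<dots> = g (l (lift k A A A (\<lambda>x z. x \<otimes>\<^bsub>A\<^esub> z) e) n)"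
    by (rule lin_lift[where g = "\<lambda>a. g (l a n)", symmetric]; (intro bilinI lin_intros)?)
  finally show ?thesis by (simp add: separable l_one n)
qed

text \<open>
  The element \<open>\<pi>(m \<otimes> n)\<close> satisfies the cotensor condition because \<open>casimir_twice\<close> identifies
  \<open>m x x' \<otimes> z' \<otimes> z n\<close> with \<open>m x \<otimes> x' \<otimes> z' z n\<close>. Conversely, the cotensor condition implies \<open>u = \<pi>(u)\<close>
  by letting the middle factor act on the right one.
\<close>

lemma cotensor_eq_image: "cotensor k A M N \<rho> \<theta> = \<pi> ` carrier (tensor k M N)"
proof -
  let ?MN = "tensor k M N" and ?T = "tensor k (tensor k M A) N"
  let ?p = "\<lambda>m a n. pure k (tensor k M A) N (pure k M A m a) n"
  \<comment> \<open>The cotensor product is the equalizer of \<open>L\<close> and \<open>R\<close>.\<close>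
  define L where "L = lift k M N ?T (\<lambda>m n. pure k (tensor k M A) N (\<rho> m) n)"
  define R where "R = lift k M N ?T (\<lambda>m n. lift k A N ?T (?p m) (\<theta> n))"
  have cot: "cotensor k A M N \<rho> \<theta> = {u \<in> carrier ?MN. L u = R u}"
    by (simp add: cotensor_def L_def R_def extl_def extr_def tensor3_def pure3_def)
  have L_lin: "L \<in> lin k ?MN ?T" unfolding L_def by (intro bilinI lin_intros)
  have R_lin: "R \<in> lin k ?MN ?T" unfolding R_def by (intro bilinI lin_intros)
  note [lin_intros] = L_lin R_lin lin_comp[OF L_lin] lin_comp[OF R_lin]
  have L_pure: "L (pure k M N m n) = lift k A A ?T (\<lambda>x z. ?p (r m x) z n) e"
    if m: "m \<in> carrier M" and n: "n \<in> carrier N" for m n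
  proof -
    have "L (pure k M N m n) = pure k (tensor k M A) N (\<rho> m) n"
      unfolding L_def by (rule lift_pure; (intro bilinI lin_intros m n)?)
    also have "\<dots> = lift k A A ?T (\<lambda>x z. ?p (r m x) z n) e"
      by (rule lin_of_rho[where g = "\<lambda>u. pure k (tensor k M A) N u n"]; (intro bilinI lin_intros m n)?)
    finally show ?thesis .
  qed
  have R_pure: "R (pure k M N m n) = lift k A A ?T (\<lambda>x z. ?p m x (l z n)) e"
    if m: "m \<in> carrier M" and n: "n \<in> carrier N" for m n
  proof -
    have "R (pure k M N m n) = lift k A N ?T (?p m) (\<theta> n)"
      unfolding R_def by (rule lift_pure; (intro bilinI lin_intros m n)?)
    also have "\<dots> = lift k A A ?T (\<lambda>x z. ?p m x (l z n)) e"
      by (rule lift_theta; (intro bilinI lin_intros m n)?)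
    finally show ?thesis .
  qed
  have "L (\<pi> u) = R (\<pi> u)" if "u \<in> carrier ?MN" for u
    using that
  proof (rule tensor_lin_eqI[where P = ?T, rotated -1])
    fix m n assume mn: "m \<in> carrier M" "n \<in> carrier N"
    note [lin_intros] = mn
    have "L (\<pi> (pure k M N m n)) = lift k A A ?T (\<lambda>x z. L (pure k M N (r m x) (l z n))) e"
      by (rule lin_of_pi_pure; (intro bilinI lin_intros)?)
    also have "\<dots> = lift k A A ?T (\<lambda>x z. lift k A A ?T (\<lambda>x' z'. ?p (r (r m x) x') z' (l z n)) e) e"
      by (rule lift_cong; (intro bilinI lin_intros L_pure)?)
    also have "\<dots> = lift k A A ?T (\<lambda>x z. lift k A A ?T (\<lambda>x' z'. ?p (r m (x \<otimes>\<^bsub>A\<^esub> x')) z' (l z n)) e) e"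
      by (rule lift_cong; (intro bilinI lin_intros lift_cong)?; simp add: r_assoc mn)
    also have "\<dots> = lift k A A ?T (\<lambda>x z. lift k A A ?T (\<lambda>x' z'. ?p (r m x) (z \<otimes>\<^bsub>A\<^esub> x') (l z' n)) e) e"
      by (rule casimir_twice(1)[where \<tau> = "\<lambda>p q s. ?p (r m p) q (l s n)"]; (intro trilinI bilinI lin_intros)?)
    also have "\<dots> = lift k A A ?T (\<lambda>x z. lift k A A ?T (\<lambda>x' z'. ?p (r m x) x' (l (z' \<otimes>\<^bsub>A\<^esub> z) n)) e) e"
      by (rule casimir_twice(2)[where \<tau> = "\<lambda>p q s. ?p (r m p) q (l s n)"]; (intro trilinI bilinI lin_intros)?)
    also have "\<dots> = lift k A A ?T (\<lambda>x z. lift k A A ?T (\<lambda>x' z'. ?p (r m x) x' (l z' (l z n))) e) e"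
      by (rule lift_cong; (intro bilinI lin_intros lift_cong)?; simp add: l_assoc mn)
    also have "\<dots> = lift k A A ?T (\<lambda>x z. R (pure k M N (r m x) (l z n))) e"
      by (rule lift_cong; (intro bilinI lin_intros R_pure[symmetric])?)
    also have "\<dots> = R (\<pi> (pure k M N m n))"
      by (rule lin_of_pi_pure[symmetric]; (intro bilinI lin_intros)?)
    finally show "L (\<pi> (pure k M N m n)) = R (\<pi> (pure k M N m n))" .
  qed (intro bilinI lin_intros)+
  moreover have "u = \<pi> u" if u: "u \<in> carrier ?MN" and eq: "L u = R u" for u
  proof -
    \<comment> \<open>The map \<open>m \<otimes> a \<otimes> n \<mapsto> m \<otimes> a n\<close>: it sends \<open>L u\<close> to \<open>\<pi> u\<close> and, by separability, \<open>R u\<close> to \<open>u\<close>.\<close>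
    define G where "G = lift k (tensor k M A) N ?MN (\<lambda>v n. lift k M A ?MN (\<lambda>m a. pure k M N m (l a n)) v)"
    have G_lin: "G \<in> lin k ?T ?MN" unfolding G_def by (intro bilinI lin_intros)
    note [lin_intros] = G_lin lin_comp[OF G_lin]
    have G_p: "G (?p m a n) = pure k M N m (l a n)"
      if m: "m \<in> carrier M" and a: "a \<in> carrier A" and n: "n \<in> carrier N" for m a n
    proof -
      have "G (?p m a n) = lift k M A ?MN (\<lambda>m a. pure k M N m (l a n)) (pure k M A m a)"
        unfolding G_def by (rule lift_pure; (intro bilinI lin_intros m a n)?)
      also have "\<dots> = pure k M N m (l a n)"
        by (rule lift_pure; (intro bilinI lin_intros m a n)?)
      finally show ?thesis .
    qed
    have "G (L v) = \<pi> v" if "v \<in> carrier ?MN" for v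
      using that
    proof (rule tensor_lin_eqI[where P = ?MN, rotated -1])
      fix m n assume mn: "m \<in> carrier M" "n \<in> carrier N"
      note [lin_intros] = mn
      have "G (L (pure k M N m n)) = lift k A A ?MN (\<lambda>x z. G (?p (r m x) z n)) e"
        unfolding L_pure[OF mn] by (rule lin_lift; (intro bilinI lin_intros)?)
      also have "\<dots> = lift k A A ?MN (\<lambda>x z. pure k M N (r m x) (l z n)) e"
        by (rule lift_cong; (intro bilinI lin_intros G_p)?)
      also have "\<dots> = \<pi> (pure k M N m n)" by (rule pi_pure[OF mn, symmetric])
      finally show "G (L (pure k M N m n)) = \<pi> (pure k M N m n)" .
    qed (intro bilinI lin_intros)+
    moreover have "G (R v) = v" if "v \<in> carrier ?MN" for v
      using that
    proof (rule tensor_lin_eqI[where P = ?MN, rotated -1])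
      fix m n assume mn: "m \<in> carrier M" "n \<in> carrier N"
      note [lin_intros] = mn
      have "G (R (pure k M N m n)) = lift k A A ?MN (\<lambda>x z. G (?p m x (l z n))) e"
        unfolding R_pure[OF mn] by (rule lin_lift; (intro bilinI lin_intros)?)
      also have "\<dots> = lift k A A ?MN (\<lambda>x z. pure k M N m (l x (l z n))) e"
        by (rule lift_cong; (intro bilinI lin_intros G_p)?)
      also have "\<dots> = pure k M N m n"
        by (rule separable_collapse; (intro bilinI lin_intros)?)
      finally show "G (R (pure k M N m n)) = pure k M N m n" .
    qed (intro bilinI lin_intros)+
    ultimately show ?thesis using u eq by metis
  qed
  ultimately show ?thesis unfolding cot by (blast intro: pi_closed)
qed

text \<open>
  By the Casimir identity \<open>\<pi>\<close> kills the relators. Conversely, modulo the relators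
  \<open>\<pi>(m \<otimes> n) = m x \<otimes> z n\<close> equals \<open>m \<otimes> x z n = m \<otimes> n\<close>, so \<open>\<pi>\<close> induces the identity on the quotient and
  every element of its kernel is zero there.
\<close>

lemma kernel_eq_balanced:
  "a_kernel (tensor k M N) (tensor k M N) \<pi> = module_gen k (tensor k M N)
    {pure k M N (r m a) n \<ominus>\<^bsub>tensor k M N\<^esub> pure k M N m (l a n) | m a n.
      m \<in> carrier M \<and> a \<in> carrier A \<and> n \<in> carrier N}" (is "_ = module_gen k ?MN ?X")
proof
  have MN: "module k ?MN" by (intro lin_intros)
  interpret MN: module k ?MN by (rule MN)
  have X: "?X \<subseteq> carrier ?MN" by (auto intro!: MN.minus_closed lin_intros)
  have B: "submodule (module_gen k ?MN ?X) k ?MN" by (rule submodule_module_gen[OF MN X])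
  have "\<pi> (pure k M N (r m a) n \<ominus>\<^bsub>?MN\<^esub> pure k M N m (l a n)) = \<zero>\<^bsub>?MN\<^esub>"
    if m: "m \<in> carrier M" and a: "a \<in> carrier A" and n: "n \<in> carrier N" for m a n
  proof -
    note [lin_intros] = m a n
    have c: "r m a \<in> carrier M" "l a n \<in> carrier N" by (intro lin_intros)+
    have "\<pi> (pure k M N (r m a) n) = lift k A A ?MN (\<lambda>x z. pure k M N (r (r m a) x) (l z n)) e"
      by (intro pi_pure c n)
    also have "\<dots> = lift k A A ?MN (\<lambda>x z. pure k M N (r m (a \<otimes>\<^bsub>A\<^esub> x)) (l z n)) e"
      by (rule lift_cong; (intro bilinI lin_intros)?; simp add: r_assoc m a)
    also have "\<dots> = lift k A A ?MN (\<lambda>x z. pure k M N (r m x) (l (z \<otimes>\<^bsub>A\<^esub> a) n)) e"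
      by (rule casimir_lift[where \<beta> = "\<lambda>x z. pure k M N (r m x) (l z n)"]; (intro bilinI lin_intros)?)
    also have "\<dots> = lift k A A ?MN (\<lambda>x z. pure k M N (r m x) (l z (l a n))) e"
      by (rule lift_cong; (intro bilinI lin_intros)?; simp add: l_assoc n a)
    also have "\<dots> = \<pi> (pure k M N m (l a n))" by (intro pi_pure[symmetric] c m)
    finally have "\<pi> (pure k M N (r m a) n) = \<pi> (pure k M N m (l a n))" .
    moreover have "pure k M N (r m a) n \<in> carrier ?MN" "pure k M N m (l a n) \<in> carrier ?MN"
      by (intro lin_intros)+
    ultimately show ?thesis
      by (simp add: lin_minus[OF MN MN pi_lin] minus_eq_zero_iff[OF MN.abelian_group_axioms] lin_closed[OF pi_lin])
  qed
  then have "?X \<subseteq> a_kernel ?MN ?MN \<pi>" using X by (auto simp: a_kernel_def' subset_iff)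
  then show "module_gen k ?MN ?X \<subseteq> a_kernel ?MN ?MN \<pi>"
    by (rule module_gen_minimal[OF _ submodule_kernel[OF MN MN pi_lin]])
  let ?B = "module_gen k ?MN ?X" and ?Q = "quot_module ?MN (module_gen k ?MN ?X)"
  define q where "q u = ?B +>\<^bsub>?MN\<^esub> u" for u
  have Q: "module k ?Q" by (rule module_quot[OF MN B])
  have q_lin: "q \<in> lin k ?MN ?Q" unfolding q_def by (rule quot_lin[OF MN B])
  note [lin_intros] = Q q_lin lin_comp[OF q_lin]
  have q_bal: "q (pure k M N (r m a) n) = q (pure k M N m (l a n))"
    if m: "m \<in> carrier M" and a: "a \<in> carrier A" and n: "n \<in> carrier N" for m a n
    unfolding q_def
    by (subst quot_eq_iff[OF MN B]) (use m a n in \<open>auto intro!: module_gen_inc lin_intros\<close>)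
  have q_pi: "q (\<pi> u) = q u" if "u \<in> carrier ?MN" for u
    using that
  proof (rule tensor_lin_eqI[where P = ?Q, rotated -1])
    fix m n assume mn: "m \<in> carrier M" "n \<in> carrier N"
    note [lin_intros] = mn
    have "q (\<pi> (pure k M N m n)) = lift k A A ?Q (\<lambda>x z. q (pure k M N (r m x) (l z n))) e"
      by (rule lin_of_pi_pure; (intro bilinI lin_intros)?)
    also have "\<dots> = lift k A A ?Q (\<lambda>x z. q (pure k M N m (l x (l z n)))) e"
      by (rule lift_cong; (intro bilinI lin_intros q_bal)?)
    also have "\<dots> = q (pure k M N m n)"
      by (rule separable_collapse; (intro bilinI lin_intros)?)
    finally show "q (\<pi> (pure k M N m n)) = q (pure k M N m n)" .
  qed (intro bilinI lin_intros)+
  show "a_kernel ?MN ?MN \<pi> \<subseteq> ?B"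
  proof
    fix u assume "u \<in> a_kernel ?MN ?MN \<pi>"
    then have u: "u \<in> carrier ?MN" "\<pi> u = \<zero>\<^bsub>?MN\<^esub>" by (auto simp: a_kernel_def')
    have "q u = q \<zero>\<^bsub>?MN\<^esub>" using q_pi[OF u(1)] u(2) by simp
    then have "u \<ominus>\<^bsub>?MN\<^esub> \<zero>\<^bsub>?MN\<^esub> \<in> ?B" unfolding q_def by (simp add: quot_eq_iff[OF MN B] u(1))
    moreover have "u \<ominus>\<^bsub>?MN\<^esub> \<zero>\<^bsub>?MN\<^esub> = u" using u(1) by (simp add: a_minus_def)
    ultimately show "u \<in> ?B" by (simp only:)
  qed
qed

end

section \<open>Weak bialgebras\<close>

context weak_bialgebra
begin

text \<open>
  \<open>Ht\<close> is the target algebra \<open>H\<^sub>t\<close>, and \<open>Hs\<close> is its mirror image in the first leg of \<open>\<Delta> 1\<close>.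
\<close>

abbreviation "et \<equiv> eps_t k H \<Delta> \<epsilon>"
abbreviation "es \<equiv> eps_s_bar k H \<Delta> \<epsilon>"
abbreviation "Ht \<equiv> et ` carrier H"
abbreviation "Hs \<equiv> es ` carrier H"

declare comult_lin [lin_intros] counit_lin [lin_intros]

lemma lin_comult [lin_intros]: "f \<in> lin k X H \<Longrightarrow> (\<lambda>x. \<Delta> (f x)) \<in> lin k X (tensor k H H)"
  by (rule lin_comp[OF comult_lin])

lemma comult_closed [lin_intros]: "a \<in> carrier H \<Longrightarrow> \<Delta> a \<in> carrier (tensor k H H)"
  by (rule lin_closed[OF comult_lin])

lemma lin_counit [lin_intros]: "f \<in> lin k X H \<Longrightarrow> (\<lambda>x. \<epsilon> (f x)) \<in> lin k X (regular_module k)"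
  by (rule lin_comp[OF counit_lin])

lemma counit_closed [lin_intros]: "x \<in> carrier H \<Longrightarrow> \<epsilon> x \<in> carrier k"
  using lin_closed[OF counit_lin] by (simp add: regular_module_def)

lemma one_closed [lin_intros]: "\<one>\<^bsub>H\<^esub> \<in> carrier H" by simp

lemma eps_t_lin [lin_intros]: "et \<in> lin k H H"
  by (rule lin_cong[OF module_algebra _ eps_t_def]) (intro bilinI lin_intros)

lemma eps_s_bar_lin [lin_intros]: "es \<in> lin k H H"
  by (rule lin_cong[OF module_algebra _ eps_s_bar_def]) (intro bilinI lin_intros)

lemma lin_eps_t [lin_intros]: "f \<in> lin k X H \<Longrightarrow> (\<lambda>x. et (f x)) \<in> lin k X H"
  by (rule lin_comp[OF eps_t_lin])

lemma lin_eps_s_bar [lin_intros]: "f \<in> lin k X H \<Longrightarrow> (\<lambda>x. es (f x)) \<in> lin k X H"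
  by (rule lin_comp[OF eps_s_bar_lin])

lemma eps_t_closed [lin_intros]: "h \<in> carrier H \<Longrightarrow> et h \<in> carrier H"
  by (rule lin_closed[OF eps_t_lin])

lemma eps_s_bar_closed [lin_intros]: "h \<in> carrier H \<Longrightarrow> es h \<in> carrier H"
  by (rule lin_closed[OF eps_s_bar_lin])

subsection \<open>The axioms as identities for multilinear maps\<close>

lemma counit_l_of_lin:
  assumes P: "module k P" and g: "g \<in> lin k H P" and h: "h \<in> carrier H"
  shows "lift k H H P (\<lambda>a b. \<epsilon> a \<odot>\<^bsub>P\<^esub> g b) (\<Delta> h) = g h"
proof -
  note [lin_intros] = P g h lin_comp[OF g] lin_closed[OF g]
  have "g (lift k H H H (\<lambda>a b. \<epsilon> a \<odot>\<^bsub>H\<^esub> b) (\<Delta> h)) = lift k H H P (\<lambda>a b. g (\<epsilon> a \<odot>\<^bsub>H\<^esub> b)) (\<Delta> h)"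
    by (rule lin_lift; (intro bilinI lin_intros)?)
  also have "\<dots> = lift k H H P (\<lambda>a b. \<epsilon> a \<odot>\<^bsub>P\<^esub> g b) (\<Delta> h)"
    by (rule lift_cong; (intro bilinI lin_intros)?; simp add: lin_smult[OF g] counit_closed)
  finally show ?thesis by (simp add: counit_l h)
qed

lemma counit_r_of_lin:
  assumes P: "module k P" and g: "g \<in> lin k H P" and h: "h \<in> carrier H"
  shows "lift k H H P (\<lambda>a b. \<epsilon> b \<odot>\<^bsub>P\<^esub> g a) (\<Delta> h) = g h"
proof -
  note [lin_intros] = P g h lin_comp[OF g] lin_closed[OF g]
  have "g (lift k H H H (\<lambda>a b. \<epsilon> b \<odot>\<^bsub>H\<^esub> a) (\<Delta> h)) = lift k H H P (\<lambda>a b. g (\<epsilon> b \<odot>\<^bsub>H\<^esub> a)) (\<Delta> h)"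
    by (rule lin_lift; (intro bilinI lin_intros)?)
  also have "\<dots> = lift k H H P (\<lambda>a b. \<epsilon> b \<odot>\<^bsub>P\<^esub> g a) (\<Delta> h)"
    by (rule lift_cong; (intro bilinI lin_intros)?; simp add: lin_smult[OF g] counit_closed)
  finally show ?thesis by (simp add: counit_r h)
qed

lemma lin_of_eps_t:
  assumes P: "module k P" and g: "g \<in> lin k H P" and h: "h \<in> carrier H"
  shows "g (et h) = lift k H H P (\<lambda>a b. \<epsilon> (a \<otimes>\<^bsub>H\<^esub> h) \<odot>\<^bsub>P\<^esub> g b) (\<Delta> \<one>\<^bsub>H\<^esub>)"
proof -
  note [lin_intros] = P g h lin_comp[OF g] lin_closed[OF g]
  have "g (et h) = lift k H H P (\<lambda>a b. g (\<epsilon> (a \<otimes>\<^bsub>H\<^esub> h) \<odot>\<^bsub>H\<^esub> b)) (\<Delta> \<one>\<^bsub>H\<^esub>)"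
    unfolding eps_t_def by (rule lin_lift; (intro bilinI lin_intros)?)
  also have "\<dots> = lift k H H P (\<lambda>a b. \<epsilon> (a \<otimes>\<^bsub>H\<^esub> h) \<odot>\<^bsub>P\<^esub> g b) (\<Delta> \<one>\<^bsub>H\<^esub>)"
    by (rule lift_cong; (intro bilinI lin_intros)?; simp add: lin_smult[OF g] counit_closed h)
  finally show ?thesis .
qed

lemma lin_of_eps_s_bar:
  assumes P: "module k P" and g: "g \<in> lin k H P" and h: "h \<in> carrier H"
  shows "g (es h) = lift k H H P (\<lambda>a b. \<epsilon> (b \<otimes>\<^bsub>H\<^esub> h) \<odot>\<^bsub>P\<^esub> g a) (\<Delta> \<one>\<^bsub>H\<^esub>)"
proof -
  note [lin_intros] = P g h lin_comp[OF g] lin_closed[OF g]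
  have "g (es h) = lift k H H P (\<lambda>a b. g (\<epsilon> (b \<otimes>\<^bsub>H\<^esub> h) \<odot>\<^bsub>H\<^esub> a)) (\<Delta> \<one>\<^bsub>H\<^esub>)"
    unfolding eps_s_bar_def by (rule lin_lift; (intro bilinI lin_intros)?)
  also have "\<dots> = lift k H H P (\<lambda>a b. \<epsilon> (b \<otimes>\<^bsub>H\<^esub> h) \<odot>\<^bsub>P\<^esub> g a) (\<Delta> \<one>\<^bsub>H\<^esub>)"
    by (rule lift_cong; (intro bilinI lin_intros)?; simp add: lin_smult[OF g] counit_closed h)
  finally show ?thesis .
qed

text \<open>
  The three identities evaluate an arbitrary trilinear map on the two sides of coassociativity, of
  (lc) and of (rc). In each of them, \<open>(a, b)\<close> and \<open>(c, d)\<close> are the legs of the outer and the inner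
  comultiplication.
\<close>

lemma
  assumes P: "module k P" and \<tau>: "trilin k H H H P \<tau>"
  shows lift_coassoc: "h \<in> carrier H \<Longrightarrow>
      lift k H H P (\<lambda>a b. lift k H H P (\<lambda>c d. \<tau> c d b) (\<Delta> a)) (\<Delta> h) =
      lift k H H P (\<lambda>a b. lift k H H P (\<lambda>c d. \<tau> a c d) (\<Delta> b)) (\<Delta> h)"
    and lift_left_comonoidal:
      "lift k H H P (\<lambda>a b. lift k H H P (\<lambda>c d. \<tau> c d b) (\<Delta> a)) (\<Delta> \<one>\<^bsub>H\<^esub>) =
      lift k H H P (\<lambda>a b. lift k H H P (\<lambda>c d. \<tau> a (b \<otimes>\<^bsub>H\<^esub> c) d) (\<Delta> \<one>\<^bsub>H\<^esub>)) (\<Delta> \<one>\<^bsub>H\<^esub>)"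
    and lift_right_comonoidal:
      "lift k H H P (\<lambda>a b. lift k H H P (\<lambda>c d. \<tau> c d b) (\<Delta> a)) (\<Delta> \<one>\<^bsub>H\<^esub>) =
      lift k H H P (\<lambda>a b. lift k H H P (\<lambda>c d. \<tau> a (c \<otimes>\<^bsub>H\<^esub> b) d) (\<Delta> \<one>\<^bsub>H\<^esub>)) (\<Delta> \<one>\<^bsub>H\<^esub>)"
proof -
  note [lin_intros] = P trilinD[OF \<tau>]
  obtain T where T: "T \<in> lin k (tensor3 k H H H) P"
      "\<And>a b c. \<lbrakk>a \<in> carrier H; b \<in> carrier H; c \<in> carrier H\<rbrakk> \<Longrightarrow> T (pure3 k H H H a b c) = \<tau> a b c"
      "\<And>v c. \<lbrakk>v \<in> carrier (tensor k H H); c \<in> carrier H\<rbrakk>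
        \<Longrightarrow> T (extl k H H H v c) = lift k H H P (\<lambda>a b. \<tau> a b c) v"
      "\<And>a v. \<lbrakk>a \<in> carrier H; v \<in> carrier (tensor k H H)\<rbrakk>
        \<Longrightarrow> T (extr k H H H a v) = lift k H H P (\<lambda>b c. \<tau> a b c) v"
    by (rule tensor3_universal[OF module_algebra module_algebra module_algebra P \<tau>]) (rule that)
  note [lin_intros] = T(1)[unfolded tensor3_def] lin_comp[OF T(1)[unfolded tensor3_def]]
  have l: "T (lift k H H (tensor3 k H H H) (\<lambda>a b. extl k H H H (\<Delta> a) b) (\<Delta> h)) =
      lift k H H P (\<lambda>a b. lift k H H P (\<lambda>c d. \<tau> c d b) (\<Delta> a)) (\<Delta> h)" if [lin_intros]: "h \<in> carrier H" for h
  proof -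
    have "T (lift k H H (tensor3 k H H H) (\<lambda>a b. extl k H H H (\<Delta> a) b) (\<Delta> h)) =
        lift k H H P (\<lambda>a b. T (extl k H H H (\<Delta> a) b)) (\<Delta> h)"
      unfolding tensor3_def extl_def by (rule lin_lift; (intro bilinI lin_intros)?)
    also have "\<dots> = lift k H H P (\<lambda>a b. lift k H H P (\<lambda>c d. \<tau> c d b) (\<Delta> a)) (\<Delta> h)"
      unfolding extl_def by (rule lift_cong; (intro bilinI lin_intros T(3)[unfolded extl_def])?)
    finally show ?thesis .
  qed
  have m: "T (lift k H H (tensor3 k H H H) (\<lambda>a b. lift k H H (tensor3 k H H H)
         (\<lambda>c d. pure3 k H H H a (f b c) d) (\<Delta> \<one>\<^bsub>H\<^esub>)) (\<Delta> \<one>\<^bsub>H\<^esub>)) =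
      lift k H H P (\<lambda>a b. lift k H H P (\<lambda>c d. \<tau> a (f b c) d) (\<Delta> \<one>\<^bsub>H\<^esub>)) (\<Delta> \<one>\<^bsub>H\<^esub>)"
    if f: "bilin k H H H f" for f
  proof -
    note [lin_intros] = bilinD[OF f]
    have inner: "T (lift k H H (tensor3 k H H H) (\<lambda>c d. pure3 k H H H a (f b c) d) (\<Delta> \<one>\<^bsub>H\<^esub>)) =
        lift k H H P (\<lambda>c d. \<tau> a (f b c) d) (\<Delta> \<one>\<^bsub>H\<^esub>)"
      if [lin_intros]: "a \<in> carrier H" "b \<in> carrier H" for a b
    proof -
      have "T (lift k H H (tensor3 k H H H) (\<lambda>c d. pure3 k H H H a (f b c) d) (\<Delta> \<one>\<^bsub>H\<^esub>)) =
          lift k H H P (\<lambda>c d. T (pure3 k H H H a (f b c) d)) (\<Delta> \<one>\<^bsub>H\<^esub>)"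
        unfolding tensor3_def pure3_def by (rule lin_lift; (intro bilinI lin_intros)?)
      also have "\<dots> = lift k H H P (\<lambda>c d. \<tau> a (f b c) d) (\<Delta> \<one>\<^bsub>H\<^esub>)"
        unfolding pure3_def by (rule lift_cong; (intro bilinI lin_intros T(2)[unfolded pure3_def])?)
      finally show ?thesis .
    qed
    have "T (lift k H H (tensor3 k H H H) (\<lambda>a b. lift k H H (tensor3 k H H H)
          (\<lambda>c d. pure3 k H H H a (f b c) d) (\<Delta> \<one>\<^bsub>H\<^esub>)) (\<Delta> \<one>\<^bsub>H\<^esub>)) =
        lift k H H P (\<lambda>a b. T (lift k H H (tensor3 k H H H)
          (\<lambda>c d. pure3 k H H H a (f b c) d) (\<Delta> \<one>\<^bsub>H\<^esub>))) (\<Delta> \<one>\<^bsub>H\<^esub>)"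
      unfolding tensor3_def pure3_def by (rule lin_lift; (intro bilinI lin_intros)?)
    also have "\<dots> = lift k H H P (\<lambda>a b. lift k H H P (\<lambda>c d. \<tau> a (f b c) d) (\<Delta> \<one>\<^bsub>H\<^esub>)) (\<Delta> \<one>\<^bsub>H\<^esub>)"
      unfolding tensor3_def pure3_def
      by (rule lift_cong; (intro bilinI lin_intros inner[unfolded tensor3_def pure3_def])?)
    finally show ?thesis .
  qed
  show "lift k H H P (\<lambda>a b. lift k H H P (\<lambda>c d. \<tau> c d b) (\<Delta> a)) (\<Delta> h) =
      lift k H H P (\<lambda>a b. lift k H H P (\<lambda>c d. \<tau> a c d) (\<Delta> b)) (\<Delta> h)" if [lin_intros]: "h \<in> carrier H"
  proof -
    have "lift k H H P (\<lambda>a b. lift k H H P (\<lambda>c d. \<tau> c d b) (\<Delta> a)) (\<Delta> h) =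
      T (lift k H H (tensor3 k H H H) (\<lambda>a b. extr k H H H a (\<Delta> b)) (\<Delta> h))"
      by (simp only: l[OF that, symmetric] coassoc[OF that])
    also have "\<dots> = lift k H H P (\<lambda>a b. T (extr k H H H a (\<Delta> b))) (\<Delta> h)"
      unfolding tensor3_def extr_def pure3_def by (rule lin_lift; (intro bilinI lin_intros)?)
    also have "\<dots> = lift k H H P (\<lambda>a b. lift k H H P (\<lambda>c d. \<tau> a c d) (\<Delta> b)) (\<Delta> h)"
      unfolding tensor3_def extr_def pure3_def
      by (rule lift_cong; (intro bilinI lin_intros T(4)[unfolded tensor3_def extr_def pure3_def])?)
    finally show ?thesis .
  qed
  show "lift k H H P (\<lambda>a b. lift k H H P (\<lambda>c d. \<tau> c d b) (\<Delta> a)) (\<Delta> \<one>\<^bsub>H\<^esub>) =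
      lift k H H P (\<lambda>a b. lift k H H P (\<lambda>c d. \<tau> a (b \<otimes>\<^bsub>H\<^esub> c) d) (\<Delta> \<one>\<^bsub>H\<^esub>)) (\<Delta> \<one>\<^bsub>H\<^esub>)"
    unfolding l[OF one_closed, symmetric] left_comonoidal by (rule m) (intro bilinI lin_intros)
  show "lift k H H P (\<lambda>a b. lift k H H P (\<lambda>c d. \<tau> c d b) (\<Delta> a)) (\<Delta> \<one>\<^bsub>H\<^esub>) =
      lift k H H P (\<lambda>a b. lift k H H P (\<lambda>c d. \<tau> a (c \<otimes>\<^bsub>H\<^esub> b) d) (\<Delta> \<one>\<^bsub>H\<^esub>)) (\<Delta> \<one>\<^bsub>H\<^esub>)"
    unfolding l[OF one_closed, symmetric] right_comonoidal
    by (rule m[of "\<lambda>b c. c \<otimes>\<^bsub>H\<^esub> b"]) (intro bilinI lin_intros)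
qed

lemma lift_comult_mult:
  assumes P: "module k P" and \<beta>: "bilin k H H P \<beta>" and h: "h \<in> carrier H" and g: "g \<in> carrier H"
  shows "lift k H H P \<beta> (\<Delta> (h \<otimes>\<^bsub>H\<^esub> g)) =
    lift k H H P (\<lambda>a b. lift k H H P (\<lambda>c d. \<beta> (a \<otimes>\<^bsub>H\<^esub> c) (b \<otimes>\<^bsub>H\<^esub> d)) (\<Delta> g)) (\<Delta> h)"
proof -
  note [lin_intros] = P \<beta> h g lin_comp[OF bilinD(1)[OF \<beta>]] lin_comp[OF bilinD(2)[OF \<beta>]]
  have "lift k H H P \<beta> (\<Delta> (h \<otimes>\<^bsub>H\<^esub> g)) = lift k H H P (\<lambda>a b. lift k H H P \<beta> (lift k H H (tensor k H H)
        (\<lambda>c d. pure k H H (a \<otimes>\<^bsub>H\<^esub> c) (b \<otimes>\<^bsub>H\<^esub> d)) (\<Delta> g))) (\<Delta> h)"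
    unfolding comult_mult[OF h g] by (rule lin_lift; (intro bilinI lin_intros)?)
  also have "\<dots> = lift k H H P (\<lambda>a b. lift k H H P (\<lambda>c d. \<beta> (a \<otimes>\<^bsub>H\<^esub> c) (b \<otimes>\<^bsub>H\<^esub> d)) (\<Delta> g)) (\<Delta> h)"
    by (rule lift_cong; (intro bilinI lin_intros lift_lift_pure)?)
  finally show ?thesis .
qed

text \<open>The element \<open>\<Delta> 1\<close> is a left and right unit for the values of \<open>\<Delta>\<close>.\<close>

lemma lift_comult_one:
  assumes P: "module k P" and \<beta>: "bilin k H H P \<beta>" and h: "h \<in> carrier H"
  shows "lift k H H P (\<lambda>a b. lift k H H P (\<lambda>c d. \<beta> (a \<otimes>\<^bsub>H\<^esub> c) (b \<otimes>\<^bsub>H\<^esub> d)) (\<Delta> h)) (\<Delta> \<one>\<^bsub>H\<^esub>) =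
      lift k H H P \<beta> (\<Delta> h)"
    and "lift k H H P (\<lambda>a b. lift k H H P (\<lambda>c d. \<beta> (a \<otimes>\<^bsub>H\<^esub> c) (b \<otimes>\<^bsub>H\<^esub> d)) (\<Delta> \<one>\<^bsub>H\<^esub>)) (\<Delta> h) =
      lift k H H P \<beta> (\<Delta> h)"
  using lift_comult_mult[OF P \<beta> one_closed h] lift_comult_mult[OF P \<beta> h one_closed] h by simp_all

subsection \<open>The images of the two counital maps\<close>

text \<open>
  By coassociativity \<open>\<Delta>(\<epsilon>\<^sub>t(h)) = \<epsilon>(1\<^sub>1 h) 1\<^sub>2 \<otimes> 1\<^sub>3\<close>. Replacing the threefold coproduct of \<open>1\<close> by
  (lc) or by (rc) places \<open>\<epsilon>\<^sub>t(h)\<close> to the left or to the right of the first leg of another \<open>\<Delta>(1)\<close>.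
\<close>

lemma comult_eps_t:
  assumes P: "module k P" and \<beta>: "bilin k H H P \<beta>" and h: "h \<in> carrier H"
  shows "lift k H H P \<beta> (\<Delta> (et h)) = lift k H H P (\<lambda>a b. \<beta> (et h \<otimes>\<^bsub>H\<^esub> a) b) (\<Delta> \<one>\<^bsub>H\<^esub>)"
    and "lift k H H P \<beta> (\<Delta> (et h)) = lift k H H P (\<lambda>a b. \<beta> (a \<otimes>\<^bsub>H\<^esub> et h) b) (\<Delta> \<one>\<^bsub>H\<^esub>)"
proof -
  note [lin_intros] = P \<beta> h lin_comp[OF bilinD(1)[OF \<beta>]] lin_comp[OF bilinD(2)[OF \<beta>]] bilinD(3)[OF \<beta>]
  let ?\<tau> = "\<lambda>a c d. \<epsilon> (a \<otimes>\<^bsub>H\<^esub> h) \<odot>\<^bsub>P\<^esub> \<beta> c d"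
  have \<tau>: "trilin k H H H P ?\<tau>" by (intro trilinI bilinI lin_intros)
  have "lift k H H P \<beta> (\<Delta> (et h)) = lift k H H P (\<lambda>a b. \<epsilon> (a \<otimes>\<^bsub>H\<^esub> h) \<odot>\<^bsub>P\<^esub> lift k H H P \<beta> (\<Delta> b)) (\<Delta> \<one>\<^bsub>H\<^esub>)"
    by (rule lin_of_eps_t[where g = "\<lambda>x. lift k H H P \<beta> (\<Delta> x)"]; (intro bilinI lin_intros)?)
  also have "\<dots> = lift k H H P (\<lambda>a b. lift k H H P (\<lambda>c d. ?\<tau> a c d) (\<Delta> b)) (\<Delta> \<one>\<^bsub>H\<^esub>)"
    by (rule lift_cong; (intro bilinI lin_intros lin_lift)?)
  finally have *: "lift k H H P \<beta> (\<Delta> (et h)) =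
      lift k H H P (\<lambda>a b. lift k H H P (\<lambda>c d. ?\<tau> c d b) (\<Delta> a)) (\<Delta> \<one>\<^bsub>H\<^esub>)"
    by (simp only: lift_coassoc[OF P \<tau> one_closed])
  have "lift k H H P \<beta> (\<Delta> (et h)) =
      lift k H H P (\<lambda>a b. lift k H H P (\<lambda>c d. ?\<tau> a (b \<otimes>\<^bsub>H\<^esub> c) d) (\<Delta> \<one>\<^bsub>H\<^esub>)) (\<Delta> \<one>\<^bsub>H\<^esub>)"
    unfolding * by (rule lift_left_comonoidal[OF P \<tau>])
  also have "\<dots> = lift k H H P (\<lambda>c d. lift k H H P (\<lambda>a b. ?\<tau> a (b \<otimes>\<^bsub>H\<^esub> c) d) (\<Delta> \<one>\<^bsub>H\<^esub>)) (\<Delta> \<one>\<^bsub>H\<^esub>)"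
    by (rule lift_swap; (intro bilinI lin_intros)?)
  also have "\<dots> = lift k H H P (\<lambda>a b. \<beta> (et h \<otimes>\<^bsub>H\<^esub> a) b) (\<Delta> \<one>\<^bsub>H\<^esub>)"
    by (rule lift_cong; (intro bilinI lin_intros lin_of_eps_t[symmetric])?)
  finally show "lift k H H P \<beta> (\<Delta> (et h)) = lift k H H P (\<lambda>a b. \<beta> (et h \<otimes>\<^bsub>H\<^esub> a) b) (\<Delta> \<one>\<^bsub>H\<^esub>)" .
  have "lift k H H P \<beta> (\<Delta> (et h)) =
      lift k H H P (\<lambda>a b. lift k H H P (\<lambda>c d. ?\<tau> a (c \<otimes>\<^bsub>H\<^esub> b) d) (\<Delta> \<one>\<^bsub>H\<^esub>)) (\<Delta> \<one>\<^bsub>H\<^esub>)"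
    unfolding * by (rule lift_right_comonoidal[OF P \<tau>])
  also have "\<dots> = lift k H H P (\<lambda>c d. lift k H H P (\<lambda>a b. ?\<tau> a (c \<otimes>\<^bsub>H\<^esub> b) d) (\<Delta> \<one>\<^bsub>H\<^esub>)) (\<Delta> \<one>\<^bsub>H\<^esub>)"
    by (rule lift_swap; (intro bilinI lin_intros)?)
  also have "\<dots> = lift k H H P (\<lambda>a b. \<beta> (a \<otimes>\<^bsub>H\<^esub> et h) b) (\<Delta> \<one>\<^bsub>H\<^esub>)"
    by (rule lift_cong; (intro bilinI lin_intros lin_of_eps_t[symmetric])?)
  finally show "lift k H H P \<beta> (\<Delta> (et h)) = lift k H H P (\<lambda>a b. \<beta> (a \<otimes>\<^bsub>H\<^esub> et h) b) (\<Delta> \<one>\<^bsub>H\<^esub>)" .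
qed

text \<open>Here \<open>\<epsilon>\<close> consumes the last of the three legs of the coproduct of \<open>1\<close>.\<close>

lemma comult_eps_s_bar:
  assumes P: "module k P" and \<beta>: "bilin k H H P \<beta>" and h: "h \<in> carrier H"
  shows "lift k H H P \<beta> (\<Delta> (es h)) = lift k H H P (\<lambda>a b. \<beta> a (b \<otimes>\<^bsub>H\<^esub> es h)) (\<Delta> \<one>\<^bsub>H\<^esub>)"
    and "lift k H H P \<beta> (\<Delta> (es h)) = lift k H H P (\<lambda>a b. \<beta> a (es h \<otimes>\<^bsub>H\<^esub> b)) (\<Delta> \<one>\<^bsub>H\<^esub>)"
proof -
  note [lin_intros] = P \<beta> h lin_comp[OF bilinD(1)[OF \<beta>]] lin_comp[OF bilinD(2)[OF \<beta>]] bilinD(3)[OF \<beta>]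
  let ?\<tau> = "\<lambda>c d b. \<epsilon> (b \<otimes>\<^bsub>H\<^esub> h) \<odot>\<^bsub>P\<^esub> \<beta> c d"
  have \<tau>: "trilin k H H H P ?\<tau>" by (intro trilinI bilinI lin_intros)
  have "lift k H H P \<beta> (\<Delta> (es h)) = lift k H H P (\<lambda>a b. \<epsilon> (b \<otimes>\<^bsub>H\<^esub> h) \<odot>\<^bsub>P\<^esub> lift k H H P \<beta> (\<Delta> a)) (\<Delta> \<one>\<^bsub>H\<^esub>)"
    by (rule lin_of_eps_s_bar[where g = "\<lambda>x. lift k H H P \<beta> (\<Delta> x)"]; (intro bilinI lin_intros)?)
  also have "\<dots> = lift k H H P (\<lambda>a b. lift k H H P (\<lambda>c d. ?\<tau> c d b) (\<Delta> a)) (\<Delta> \<one>\<^bsub>H\<^esub>)"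
    by (rule lift_cong; (intro bilinI lin_intros lin_lift)?)
  finally have *: "lift k H H P \<beta> (\<Delta> (es h)) = \<dots>" .
  have "lift k H H P \<beta> (\<Delta> (es h)) =
      lift k H H P (\<lambda>a b. lift k H H P (\<lambda>c d. ?\<tau> a (b \<otimes>\<^bsub>H\<^esub> c) d) (\<Delta> \<one>\<^bsub>H\<^esub>)) (\<Delta> \<one>\<^bsub>H\<^esub>)"
    unfolding * by (rule lift_left_comonoidal[OF P \<tau>])
  also have "\<dots> = lift k H H P (\<lambda>a b. \<beta> a (b \<otimes>\<^bsub>H\<^esub> es h)) (\<Delta> \<one>\<^bsub>H\<^esub>)"
    by (rule lift_cong; (intro bilinI lin_intros lin_of_eps_s_bar[symmetric])?)
  finally show "lift k H H P \<beta> (\<Delta> (es h)) = lift k H H P (\<lambda>a b. \<beta> a (b \<otimes>\<^bsub>H\<^esub> es h)) (\<Delta> \<one>\<^bsub>H\<^esub>)" .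
  have "lift k H H P \<beta> (\<Delta> (es h)) =
      lift k H H P (\<lambda>a b. lift k H H P (\<lambda>c d. ?\<tau> a (c \<otimes>\<^bsub>H\<^esub> b) d) (\<Delta> \<one>\<^bsub>H\<^esub>)) (\<Delta> \<one>\<^bsub>H\<^esub>)"
    unfolding * by (rule lift_right_comonoidal[OF P \<tau>])
  also have "\<dots> = lift k H H P (\<lambda>a b. \<beta> a (es h \<otimes>\<^bsub>H\<^esub> b)) (\<Delta> \<one>\<^bsub>H\<^esub>)"
    by (rule lift_cong; (intro bilinI lin_intros lin_of_eps_s_bar[symmetric])?)
  finally show "lift k H H P \<beta> (\<Delta> (es h)) = lift k H H P (\<lambda>a b. \<beta> a (es h \<otimes>\<^bsub>H\<^esub> b)) (\<Delta> \<one>\<^bsub>H\<^esub>)" .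
qed

lemma eps_t_idem: assumes h: "h \<in> carrier H" shows "et (et h) = et h"
proof -
  note [lin_intros] = h
  have "et (et h) = lift k H H H (\<lambda>a b. \<epsilon> (a \<otimes>\<^bsub>H\<^esub> et h) \<odot>\<^bsub>H\<^esub> b) (\<Delta> \<one>\<^bsub>H\<^esub>)" by (rule eps_t_def)
  also have "\<dots> = lift k H H H (\<lambda>a b. \<epsilon> a \<odot>\<^bsub>H\<^esub> b) (\<Delta> (et h))"
    by (rule comult_eps_t(2)[symmetric]; (intro bilinI lin_intros)?)
  finally show ?thesis by (simp add: counit_l eps_t_closed h)
qed

lemma Ht_closed: "z \<in> Ht \<Longrightarrow> z \<in> carrier H"
  and Hs_closed: "y \<in> Hs \<Longrightarrow> y \<in> carrier H"
  by (auto intro: eps_t_closed eps_s_bar_closed)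

lemma eps_t_fix: "z \<in> Ht \<Longrightarrow> et z = z"
  by (auto simp: eps_t_idem)

lemma eps_t_in_Ht [lin_intros]: "h \<in> carrier H \<Longrightarrow> et h \<in> Ht"
  and eps_s_bar_in_Hs [lin_intros]: "h \<in> carrier H \<Longrightarrow> es h \<in> Hs"
  by auto

lemma eps_t_one: "et \<one>\<^bsub>H\<^esub> = \<one>\<^bsub>H\<^esub>" and eps_s_bar_one: "es \<one>\<^bsub>H\<^esub> = \<one>\<^bsub>H\<^esub>"
proof -
  have "et \<one>\<^bsub>H\<^esub> = lift k H H H (\<lambda>a b. \<epsilon> a \<odot>\<^bsub>H\<^esub> b) (\<Delta> \<one>\<^bsub>H\<^esub>)"
    unfolding eps_t_def by (rule lift_cong; (intro bilinI lin_intros)?; simp)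
  then show "et \<one>\<^bsub>H\<^esub> = \<one>\<^bsub>H\<^esub>" by (simp add: counit_l)
  have "es \<one>\<^bsub>H\<^esub> = lift k H H H (\<lambda>a b. \<epsilon> b \<odot>\<^bsub>H\<^esub> a) (\<Delta> \<one>\<^bsub>H\<^esub>)"
    unfolding eps_s_bar_def by (rule lift_cong; (intro bilinI lin_intros)?; simp)
  then show "es \<one>\<^bsub>H\<^esub> = \<one>\<^bsub>H\<^esub>" by (simp add: counit_r)
qed

lemma
  assumes P: "module k P" and \<beta>: "bilin k H H P \<beta>" and z: "z \<in> Ht"
  shows comult_Ht_left: "lift k H H P \<beta> (\<Delta> z) = lift k H H P (\<lambda>a b. \<beta> (z \<otimes>\<^bsub>H\<^esub> a) b) (\<Delta> \<one>\<^bsub>H\<^esub>)"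
    and comult_Ht_right: "lift k H H P \<beta> (\<Delta> z) = lift k H H P (\<lambda>a b. \<beta> (a \<otimes>\<^bsub>H\<^esub> z) b) (\<Delta> \<one>\<^bsub>H\<^esub>)"
  using z comult_eps_t[OF P \<beta>] by auto

lemma
  assumes P: "module k P" and \<beta>: "bilin k H H P \<beta>" and y: "y \<in> Hs"
  shows comult_Hs_left: "lift k H H P \<beta> (\<Delta> y) = lift k H H P (\<lambda>a b. \<beta> a (y \<otimes>\<^bsub>H\<^esub> b)) (\<Delta> \<one>\<^bsub>H\<^esub>)"
    and comult_Hs_right: "lift k H H P \<beta> (\<Delta> y) = lift k H H P (\<lambda>a b. \<beta> a (b \<otimes>\<^bsub>H\<^esub> y)) (\<Delta> \<one>\<^bsub>H\<^esub>)"
  using y comult_eps_s_bar[OF P \<beta>] by auto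

text \<open>
  Since \<open>\<Delta>(z)\<close> is \<open>\<Delta>(1)\<close> with \<open>z\<close> multiplied to one of its legs, the factor \<open>\<Delta>(1)\<close> in \<open>\<Delta>(h) \<Delta>(z)\<close>
  and in \<open>\<Delta>(z) \<Delta>(h)\<close> is absorbed by \<open>\<Delta>(h)\<close>.
\<close>

lemma
  assumes P: "module k P" and \<beta>: "bilin k H H P \<beta>" and h: "h \<in> carrier H" and z: "z \<in> Ht"
  shows comult_mult_Ht: "lift k H H P \<beta> (\<Delta> (h \<otimes>\<^bsub>H\<^esub> z)) = lift k H H P (\<lambda>a b. \<beta> (a \<otimes>\<^bsub>H\<^esub> z) b) (\<Delta> h)"
    and comult_Ht_mult: "lift k H H P \<beta> (\<Delta> (z \<otimes>\<^bsub>H\<^esub> h)) = lift k H H P (\<lambda>a b. \<beta> (z \<otimes>\<^bsub>H\<^esub> a) b) (\<Delta> h)"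
proof -
  note zH = Ht_closed[OF z]
  note [lin_intros] = P \<beta> h z zH lin_comp[OF bilinD(1)[OF \<beta>]] lin_comp[OF bilinD(2)[OF \<beta>]]
  have "lift k H H P \<beta> (\<Delta> (h \<otimes>\<^bsub>H\<^esub> z)) =
      lift k H H P (\<lambda>a b. lift k H H P (\<lambda>c d. \<beta> (a \<otimes>\<^bsub>H\<^esub> c) (b \<otimes>\<^bsub>H\<^esub> d)) (\<Delta> z)) (\<Delta> h)"
    by (rule lift_comult_mult; (intro lin_intros)?)
  also have "\<dots> = lift k H H P (\<lambda>a b. lift k H H P (\<lambda>c d. \<beta> (a \<otimes>\<^bsub>H\<^esub> (c \<otimes>\<^bsub>H\<^esub> z)) (b \<otimes>\<^bsub>H\<^esub> d)) (\<Delta> \<one>\<^bsub>H\<^esub>)) (\<Delta> h)"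
    by (rule lift_cong; (intro bilinI lin_intros comult_Ht_right)?)
  also have "\<dots> = lift k H H P (\<lambda>a b. lift k H H P (\<lambda>c d. \<beta> ((a \<otimes>\<^bsub>H\<^esub> c) \<otimes>\<^bsub>H\<^esub> z) (b \<otimes>\<^bsub>H\<^esub> d)) (\<Delta> \<one>\<^bsub>H\<^esub>)) (\<Delta> h)"
    by (rule lift_cong; (intro bilinI lin_intros lift_cong)?; simp add: A.m_assoc zH)
  also have "\<dots> = lift k H H P (\<lambda>a b. \<beta> (a \<otimes>\<^bsub>H\<^esub> z) b) (\<Delta> h)"
    by (rule lift_comult_one(2)[where \<beta> = "\<lambda>p q. \<beta> (p \<otimes>\<^bsub>H\<^esub> z) q"]; (intro bilinI lin_intros)?)
  finally show "lift k H H P \<beta> (\<Delta> (h \<otimes>\<^bsub>H\<^esub> z)) = lift k H H P (\<lambda>a b. \<beta> (a \<otimes>\<^bsub>H\<^esub> z) b) (\<Delta> h)" .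
  have "lift k H H P \<beta> (\<Delta> (z \<otimes>\<^bsub>H\<^esub> h)) =
      lift k H H P (\<lambda>a b. lift k H H P (\<lambda>c d. \<beta> (a \<otimes>\<^bsub>H\<^esub> c) (b \<otimes>\<^bsub>H\<^esub> d)) (\<Delta> h)) (\<Delta> z)"
    by (rule lift_comult_mult; (intro lin_intros)?)
  also have "\<dots> = lift k H H P (\<lambda>a b. lift k H H P (\<lambda>c d. \<beta> ((z \<otimes>\<^bsub>H\<^esub> a) \<otimes>\<^bsub>H\<^esub> c) (b \<otimes>\<^bsub>H\<^esub> d)) (\<Delta> h)) (\<Delta> \<one>\<^bsub>H\<^esub>)"
    by (rule comult_Ht_left[where \<beta> = "\<lambda>a b. lift k H H P (\<lambda>c d. \<beta> (a \<otimes>\<^bsub>H\<^esub> c) (b \<otimes>\<^bsub>H\<^esub> d)) (\<Delta> h)"];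
      (intro bilinI lin_intros)?)
  also have "\<dots> = lift k H H P (\<lambda>a b. lift k H H P (\<lambda>c d. \<beta> (z \<otimes>\<^bsub>H\<^esub> (a \<otimes>\<^bsub>H\<^esub> c)) (b \<otimes>\<^bsub>H\<^esub> d)) (\<Delta> h)) (\<Delta> \<one>\<^bsub>H\<^esub>)"
    by (rule lift_cong; (intro bilinI lin_intros lift_cong)?; simp add: A.m_assoc zH)
  also have "\<dots> = lift k H H P (\<lambda>a b. \<beta> (z \<otimes>\<^bsub>H\<^esub> a) b) (\<Delta> h)"
    by (rule lift_comult_one(1)[where \<beta> = "\<lambda>p q. \<beta> (z \<otimes>\<^bsub>H\<^esub> p) q"]; (intro bilinI lin_intros)?)
  finally show "lift k H H P \<beta> (\<Delta> (z \<otimes>\<^bsub>H\<^esub> h)) = lift k H H P (\<lambda>a b. \<beta> (z \<otimes>\<^bsub>H\<^esub> a) b) (\<Delta> h)" .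
qed

lemma
  assumes P: "module k P" and \<beta>: "bilin k H H P \<beta>" and h: "h \<in> carrier H" and y: "y \<in> Hs"
  shows comult_mult_Hs: "lift k H H P \<beta> (\<Delta> (h \<otimes>\<^bsub>H\<^esub> y)) = lift k H H P (\<lambda>a b. \<beta> a (b \<otimes>\<^bsub>H\<^esub> y)) (\<Delta> h)"
    and comult_Hs_mult: "lift k H H P \<beta> (\<Delta> (y \<otimes>\<^bsub>H\<^esub> h)) = lift k H H P (\<lambda>a b. \<beta> a (y \<otimes>\<^bsub>H\<^esub> b)) (\<Delta> h)"
proof -
  note yH = Hs_closed[OF y]
  note [lin_intros] = P \<beta> h y yH lin_comp[OF bilinD(1)[OF \<beta>]] lin_comp[OF bilinD(2)[OF \<beta>]]
  have "lift k H H P \<beta> (\<Delta> (h \<otimes>\<^bsub>H\<^esub> y)) =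
      lift k H H P (\<lambda>a b. lift k H H P (\<lambda>c d. \<beta> (a \<otimes>\<^bsub>H\<^esub> c) (b \<otimes>\<^bsub>H\<^esub> d)) (\<Delta> y)) (\<Delta> h)"
    by (rule lift_comult_mult; (intro lin_intros)?)
  also have "\<dots> = lift k H H P (\<lambda>a b. lift k H H P (\<lambda>c d. \<beta> (a \<otimes>\<^bsub>H\<^esub> c) (b \<otimes>\<^bsub>H\<^esub> (d \<otimes>\<^bsub>H\<^esub> y))) (\<Delta> \<one>\<^bsub>H\<^esub>)) (\<Delta> h)"
    by (rule lift_cong; (intro bilinI lin_intros comult_Hs_right)?)
  also have "\<dots> = lift k H H P (\<lambda>a b. lift k H H P (\<lambda>c d. \<beta> (a \<otimes>\<^bsub>H\<^esub> c) ((b \<otimes>\<^bsub>H\<^esub> d) \<otimes>\<^bsub>H\<^esub> y)) (\<Delta> \<one>\<^bsub>H\<^esub>)) (\<Delta> h)"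
    by (rule lift_cong; (intro bilinI lin_intros lift_cong)?; simp add: A.m_assoc yH)
  also have "\<dots> = lift k H H P (\<lambda>a b. \<beta> a (b \<otimes>\<^bsub>H\<^esub> y)) (\<Delta> h)"
    by (rule lift_comult_one(2)[where \<beta> = "\<lambda>p q. \<beta> p (q \<otimes>\<^bsub>H\<^esub> y)"]; (intro bilinI lin_intros)?)
  finally show "lift k H H P \<beta> (\<Delta> (h \<otimes>\<^bsub>H\<^esub> y)) = lift k H H P (\<lambda>a b. \<beta> a (b \<otimes>\<^bsub>H\<^esub> y)) (\<Delta> h)" .
  have "lift k H H P \<beta> (\<Delta> (y \<otimes>\<^bsub>H\<^esub> h)) =
      lift k H H P (\<lambda>a b. lift k H H P (\<lambda>c d. \<beta> (a \<otimes>\<^bsub>H\<^esub> c) (b \<otimes>\<^bsub>H\<^esub> d)) (\<Delta> h)) (\<Delta> y)"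
    by (rule lift_comult_mult; (intro lin_intros)?)
  also have "\<dots> = lift k H H P (\<lambda>a b. lift k H H P (\<lambda>c d. \<beta> (a \<otimes>\<^bsub>H\<^esub> c) ((y \<otimes>\<^bsub>H\<^esub> b) \<otimes>\<^bsub>H\<^esub> d)) (\<Delta> h)) (\<Delta> \<one>\<^bsub>H\<^esub>)"
    by (rule comult_Hs_left[where \<beta> = "\<lambda>a b. lift k H H P (\<lambda>c d. \<beta> (a \<otimes>\<^bsub>H\<^esub> c) (b \<otimes>\<^bsub>H\<^esub> d)) (\<Delta> h)"];
      (intro bilinI lin_intros)?)
  also have "\<dots> = lift k H H P (\<lambda>a b. lift k H H P (\<lambda>c d. \<beta> (a \<otimes>\<^bsub>H\<^esub> c) (y \<otimes>\<^bsub>H\<^esub> (b \<otimes>\<^bsub>H\<^esub> d))) (\<Delta> h)) (\<Delta> \<one>\<^bsub>H\<^esub>)"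
    by (rule lift_cong; (intro bilinI lin_intros lift_cong)?; simp add: A.m_assoc yH)
  also have "\<dots> = lift k H H P (\<lambda>a b. \<beta> a (y \<otimes>\<^bsub>H\<^esub> b)) (\<Delta> h)"
    by (rule lift_comult_one(1)[where \<beta> = "\<lambda>p q. \<beta> p (y \<otimes>\<^bsub>H\<^esub> q)"]; (intro bilinI lin_intros)?)
  finally show "lift k H H P \<beta> (\<Delta> (y \<otimes>\<^bsub>H\<^esub> h)) = lift k H H P (\<lambda>a b. \<beta> a (y \<otimes>\<^bsub>H\<^esub> b)) (\<Delta> h)" .
qed

text \<open>
  Since \<open>\<Delta>(z w) = 1\<^sub>1 z w \<otimes> 1\<^sub>2\<close>, applying \<open>\<epsilon>\<close> to the first leg exhibits \<open>z w\<close> as a value of the counital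
  map.
\<close>

lemma Ht_mult: assumes z: "z \<in> Ht" and w: "w \<in> Ht" shows "z \<otimes>\<^bsub>H\<^esub> w \<in> Ht"
proof -
  note zw = Ht_closed[OF z] Ht_closed[OF w]
  note [lin_intros] = z w zw
  have "z \<otimes>\<^bsub>H\<^esub> w = lift k H H H (\<lambda>a b. \<epsilon> a \<odot>\<^bsub>H\<^esub> b) (\<Delta> (z \<otimes>\<^bsub>H\<^esub> w))" by (simp add: counit_l zw)
  also have "\<dots> = lift k H H H (\<lambda>a b. \<epsilon> (a \<otimes>\<^bsub>H\<^esub> w) \<odot>\<^bsub>H\<^esub> b) (\<Delta> z)"
    by (rule comult_mult_Ht; (intro bilinI lin_intros)?)
  also have "\<dots> = lift k H H H (\<lambda>a b. \<epsilon> ((a \<otimes>\<^bsub>H\<^esub> z) \<otimes>\<^bsub>H\<^esub> w) \<odot>\<^bsub>H\<^esub> b) (\<Delta> \<one>\<^bsub>H\<^esub>)"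
    by (rule comult_Ht_right; (intro bilinI lin_intros)?)
  also have "\<dots> = et (z \<otimes>\<^bsub>H\<^esub> w)"
    unfolding eps_t_def by (rule lift_cong; (intro bilinI lin_intros)?; simp add: A.m_assoc zw)
  finally show ?thesis using zw by (metis A.m_closed imageI)
qed

text \<open>
  Both \<open>\<Delta>(z y)\<close> and \<open>\<Delta>(y z)\<close> are equal to \<open>z 1\<^sub>1 \<otimes> y 1\<^sub>2\<close>; the counit then recovers \<open>z y = y z\<close>.
\<close>

lemma Ht_Hs_commute: assumes z: "z \<in> Ht" and y: "y \<in> Hs" shows "z \<otimes>\<^bsub>H\<^esub> y = y \<otimes>\<^bsub>H\<^esub> z"
proof -
  note zy = Ht_closed[OF z] Hs_closed[OF y]
  note [lin_intros] = z y zy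
  let ?\<beta> = "\<lambda>a b. \<epsilon> a \<odot>\<^bsub>H\<^esub> b"
  have "z \<otimes>\<^bsub>H\<^esub> y = lift k H H H ?\<beta> (\<Delta> (z \<otimes>\<^bsub>H\<^esub> y))" by (simp add: counit_l zy)
  also have "\<dots> = lift k H H H (\<lambda>a b. ?\<beta> (z \<otimes>\<^bsub>H\<^esub> a) b) (\<Delta> y)"
    by (rule comult_Ht_mult; (intro bilinI lin_intros)?)
  also have "\<dots> = lift k H H H (\<lambda>a b. ?\<beta> (z \<otimes>\<^bsub>H\<^esub> a) (y \<otimes>\<^bsub>H\<^esub> b)) (\<Delta> \<one>\<^bsub>H\<^esub>)"
    by (rule comult_Hs_left; (intro bilinI lin_intros)?)
  also have "\<dots> = lift k H H H (\<lambda>a b. ?\<beta> a (y \<otimes>\<^bsub>H\<^esub> b)) (\<Delta> z)"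
    by (rule comult_Ht_left[symmetric]; (intro bilinI lin_intros)?)
  also have "\<dots> = lift k H H H ?\<beta> (\<Delta> (y \<otimes>\<^bsub>H\<^esub> z))"
    by (rule comult_Hs_mult[symmetric]; (intro bilinI lin_intros)?)
  also have "\<dots> = y \<otimes>\<^bsub>H\<^esub> z" by (simp add: counit_l zy)
  finally show ?thesis .
qed

subsection \<open>The two images are opposite to each other\<close>

text \<open>
  These are (rm) and (lm) with middle factor \<open>1\<close>: \<open>\<epsilon>(h 1 g) = \<epsilon>(h 1\<^sub>2) \<epsilon>(1\<^sub>1 g)\<close> and
  \<open>\<epsilon>(h 1 g) = \<epsilon>(h 1\<^sub>1) \<epsilon>(1\<^sub>2 g)\<close>. They provide the pairs to which \<open>move_across_comult_one\<close> below applies.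
\<close>

lemma counit_mult_eps_t:
  assumes h: "h \<in> carrier H" and g: "g \<in> carrier H" shows "\<epsilon> (h \<otimes>\<^bsub>H\<^esub> et g) = \<epsilon> (h \<otimes>\<^bsub>H\<^esub> g)"
proof -
  note [lin_intros] = h g
  have "\<epsilon> (h \<otimes>\<^bsub>H\<^esub> et g) = lift k H H (regular_module k)
      (\<lambda>a b. \<epsilon> (a \<otimes>\<^bsub>H\<^esub> g) \<odot>\<^bsub>regular_module k\<^esub> \<epsilon> (h \<otimes>\<^bsub>H\<^esub> b)) (\<Delta> \<one>\<^bsub>H\<^esub>)"
    by (rule lin_of_eps_t[where g = "\<lambda>x. \<epsilon> (h \<otimes>\<^bsub>H\<^esub> x)"]; (intro bilinI lin_intros R.is_cring)?)
  also have "\<dots> = lift k H H (regular_module k) (\<lambda>a b. \<epsilon> (h \<otimes>\<^bsub>H\<^esub> b) \<otimes>\<^bsub>k\<^esub> \<epsilon> (a \<otimes>\<^bsub>H\<^esub> g)) (\<Delta> \<one>\<^bsub>H\<^esub>)"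
    by (rule lift_cong; (intro bilinI lin_intros R.is_cring)?;
        simp add: regular_module_def R.m_comm counit_closed h g)
  also have "\<dots> = \<epsilon> (h \<otimes>\<^bsub>H\<^esub> g)" using right_monoidal[OF h one_closed g] h by simp
  finally show ?thesis .
qed

lemma counit_mult_eps_s_bar:
  assumes h: "h \<in> carrier H" and g: "g \<in> carrier H" shows "\<epsilon> (h \<otimes>\<^bsub>H\<^esub> es g) = \<epsilon> (h \<otimes>\<^bsub>H\<^esub> g)"
proof -
  note [lin_intros] = h g
  have "\<epsilon> (h \<otimes>\<^bsub>H\<^esub> es g) = lift k H H (regular_module k)
      (\<lambda>a b. \<epsilon> (b \<otimes>\<^bsub>H\<^esub> g) \<odot>\<^bsub>regular_module k\<^esub> \<epsilon> (h \<otimes>\<^bsub>H\<^esub> a)) (\<Delta> \<one>\<^bsub>H\<^esub>)"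
    by (rule lin_of_eps_s_bar[where g = "\<lambda>x. \<epsilon> (h \<otimes>\<^bsub>H\<^esub> x)"]; (intro bilinI lin_intros R.is_cring)?)
  also have "\<dots> = lift k H H (regular_module k) (\<lambda>a b. \<epsilon> (h \<otimes>\<^bsub>H\<^esub> a) \<otimes>\<^bsub>k\<^esub> \<epsilon> (b \<otimes>\<^bsub>H\<^esub> g)) (\<Delta> \<one>\<^bsub>H\<^esub>)"
    by (rule lift_cong; (intro bilinI lin_intros R.is_cring)?;
        simp add: regular_module_def R.m_comm counit_closed h g)
  also have "\<dots> = \<epsilon> (h \<otimes>\<^bsub>H\<^esub> g)" using left_monoidal[OF h one_closed g] h by simp
  finally show ?thesis .
qed

text \<open>
  Because \<open>\<Delta>(b w) = b\<^sub>1 w \<otimes> b\<^sub>2\<close> and \<open>\<Delta>(a y) = a\<^sub>1 \<otimes> a\<^sub>2 y\<close>, the counit law gives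
  \<open>1\<^sub>1 \<otimes> 1\<^sub>2 w = 1\<^sub>1 \<otimes> \<epsilon>(1\<^sub>2 w) 1\<^sub>3\<close> and \<open>1\<^sub>1 y \<otimes> 1\<^sub>2 = 1\<^sub>1 \<otimes> \<epsilon>(1\<^sub>2 y) 1\<^sub>3\<close>, and these agree by hypothesis.
\<close>

lemma move_across_comult_one:
  assumes P: "module k P" and \<beta>: "bilin k H H P \<beta>" and w: "w \<in> Ht" and y: "y \<in> Hs"
    and eq: "\<And>h. h \<in> carrier H \<Longrightarrow> \<epsilon> (h \<otimes>\<^bsub>H\<^esub> w) = \<epsilon> (h \<otimes>\<^bsub>H\<^esub> y)"
  shows "lift k H H P (\<lambda>a b. \<beta> a (b \<otimes>\<^bsub>H\<^esub> w)) (\<Delta> \<one>\<^bsub>H\<^esub>) = lift k H H P (\<lambda>a b. \<beta> (a \<otimes>\<^bsub>H\<^esub> y) b) (\<Delta> \<one>\<^bsub>H\<^esub>)"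
proof -
  note wy = Ht_closed[OF w] Hs_closed[OF y]
  note [lin_intros] = P \<beta> w y wy lin_comp[OF bilinD(1)[OF \<beta>]] lin_comp[OF bilinD(2)[OF \<beta>]] bilinD(3)[OF \<beta>]
  have left: "\<beta> a (b \<otimes>\<^bsub>H\<^esub> w) = lift k H H P (\<lambda>c d. \<epsilon> (c \<otimes>\<^bsub>H\<^esub> w) \<odot>\<^bsub>P\<^esub> \<beta> a d) (\<Delta> b)"
    if [lin_intros]: "a \<in> carrier H" "b \<in> carrier H" for a b
  proof -
    have "\<beta> a (b \<otimes>\<^bsub>H\<^esub> w) = lift k H H P (\<lambda>c d. \<epsilon> c \<odot>\<^bsub>P\<^esub> \<beta> a d) (\<Delta> (b \<otimes>\<^bsub>H\<^esub> w))"
      by (rule counit_l_of_lin[symmetric]; (intro bilinI lin_intros)?)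
    also have "\<dots> = lift k H H P (\<lambda>c d. \<epsilon> (c \<otimes>\<^bsub>H\<^esub> w) \<odot>\<^bsub>P\<^esub> \<beta> a d) (\<Delta> b)"
      by (rule comult_mult_Ht; (intro bilinI lin_intros)?)
    finally show ?thesis .
  qed
  have right: "\<beta> (a \<otimes>\<^bsub>H\<^esub> y) b = lift k H H P (\<lambda>c d. \<epsilon> (d \<otimes>\<^bsub>H\<^esub> y) \<odot>\<^bsub>P\<^esub> \<beta> c b) (\<Delta> a)"
    if [lin_intros]: "a \<in> carrier H" "b \<in> carrier H" for a b
  proof -
    have "\<beta> (a \<otimes>\<^bsub>H\<^esub> y) b = lift k H H P (\<lambda>c d. \<epsilon> d \<odot>\<^bsub>P\<^esub> \<beta> c b) (\<Delta> (a \<otimes>\<^bsub>H\<^esub> y))"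
      by (rule counit_r_of_lin[where g = "\<lambda>c. \<beta> c b", symmetric]; (intro bilinI lin_intros)?)
    also have "\<dots> = lift k H H P (\<lambda>c d. \<epsilon> (d \<otimes>\<^bsub>H\<^esub> y) \<odot>\<^bsub>P\<^esub> \<beta> c b) (\<Delta> a)"
      by (rule comult_mult_Hs; (intro bilinI lin_intros)?)
    finally show ?thesis .
  qed
  let ?\<tau> = "\<lambda>p q s. \<epsilon> (q \<otimes>\<^bsub>H\<^esub> w) \<odot>\<^bsub>P\<^esub> \<beta> p s"
  have \<tau>: "trilin k H H H P ?\<tau>" by (intro trilinI bilinI lin_intros)
  have "lift k H H P (\<lambda>a b. \<beta> a (b \<otimes>\<^bsub>H\<^esub> w)) (\<Delta> \<one>\<^bsub>H\<^esub>) =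
      lift k H H P (\<lambda>a b. lift k H H P (\<lambda>c d. ?\<tau> a c d) (\<Delta> b)) (\<Delta> \<one>\<^bsub>H\<^esub>)"
    by (rule lift_cong; (intro bilinI lin_intros left)?)
  also have "\<dots> = lift k H H P (\<lambda>a b. lift k H H P (\<lambda>c d. ?\<tau> c d b) (\<Delta> a)) (\<Delta> \<one>\<^bsub>H\<^esub>)"
    by (rule lift_coassoc[OF P \<tau> one_closed, symmetric])
  also have "\<dots> = lift k H H P (\<lambda>a b. lift k H H P (\<lambda>c d. \<epsilon> (d \<otimes>\<^bsub>H\<^esub> y) \<odot>\<^bsub>P\<^esub> \<beta> c b) (\<Delta> a)) (\<Delta> \<one>\<^bsub>H\<^esub>)"
    by (rule lift_cong; (intro bilinI lin_intros lift_cong)?; simp add: eq)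
  also have "\<dots> = lift k H H P (\<lambda>a b. \<beta> (a \<otimes>\<^bsub>H\<^esub> y) b) (\<Delta> \<one>\<^bsub>H\<^esub>)"
    by (rule lift_cong; (intro bilinI lin_intros right[symmetric])?)
  finally show ?thesis .
qed

lemma
  assumes P: "module k P" and \<beta>: "bilin k H H P \<beta>"
  shows move_Ht: "z \<in> Ht \<Longrightarrow> lift k H H P (\<lambda>a b. \<beta> a (b \<otimes>\<^bsub>H\<^esub> z)) (\<Delta> \<one>\<^bsub>H\<^esub>) =
      lift k H H P (\<lambda>a b. \<beta> (a \<otimes>\<^bsub>H\<^esub> es z) b) (\<Delta> \<one>\<^bsub>H\<^esub>)"
    and move_Hs: "y \<in> Hs \<Longrightarrow> lift k H H P (\<lambda>a b. \<beta> (a \<otimes>\<^bsub>H\<^esub> y) b) (\<Delta> \<one>\<^bsub>H\<^esub>) =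
      lift k H H P (\<lambda>a b. \<beta> a (b \<otimes>\<^bsub>H\<^esub> et y)) (\<Delta> \<one>\<^bsub>H\<^esub>)"
proof -
  show "lift k H H P (\<lambda>a b. \<beta> a (b \<otimes>\<^bsub>H\<^esub> z)) (\<Delta> \<one>\<^bsub>H\<^esub>) =
      lift k H H P (\<lambda>a b. \<beta> (a \<otimes>\<^bsub>H\<^esub> es z) b) (\<Delta> \<one>\<^bsub>H\<^esub>)" if z: "z \<in> Ht"
    by (rule move_across_comult_one[OF P \<beta> z eps_s_bar_in_Hs[OF Ht_closed[OF z]]])
      (rule counit_mult_eps_s_bar[OF _ Ht_closed[OF z], symmetric])
  show "lift k H H P (\<lambda>a b. \<beta> (a \<otimes>\<^bsub>H\<^esub> y) b) (\<Delta> \<one>\<^bsub>H\<^esub>) =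
      lift k H H P (\<lambda>a b. \<beta> a (b \<otimes>\<^bsub>H\<^esub> et y)) (\<Delta> \<one>\<^bsub>H\<^esub>)" if y: "y \<in> Hs"
    by (rule move_across_comult_one[OF P \<beta> eps_t_in_Ht[OF Hs_closed[OF y]] y, symmetric])
      (rule counit_mult_eps_t[OF _ Hs_closed[OF y]])
qed

text \<open>
  These identities say that \<open>\<Delta>(1)\<close> lies in \<open>H\<^sub>s \<otimes> H\<^sub>t\<close>. For the first one,
  \<open>1\<^sub>1 \<otimes> \<epsilon>\<^sub>t(1\<^sub>2) = 1\<^sub>1 \<otimes> \<epsilon>(1\<^sub>1\<^sub>' 1\<^sub>2) 1\<^sub>2\<^sub>'\<close>, which by (rc) is the coproduct of \<open>1\<close> in three legs with \<open>\<epsilon>\<close>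
  applied to the middle leg; the second one uses (lc) in the same way.
\<close>

lemma
  assumes P: "module k P" and \<beta>: "bilin k H H P \<beta>"
  shows comult_one_eps_t: "lift k H H P (\<lambda>a b. \<beta> a (et b)) (\<Delta> \<one>\<^bsub>H\<^esub>) = lift k H H P \<beta> (\<Delta> \<one>\<^bsub>H\<^esub>)"
    and comult_one_eps_s_bar: "lift k H H P (\<lambda>a b. \<beta> (es a) b) (\<Delta> \<one>\<^bsub>H\<^esub>) = lift k H H P \<beta> (\<Delta> \<one>\<^bsub>H\<^esub>)"
proof -
  note [lin_intros] = P \<beta> lin_comp[OF bilinD(1)[OF \<beta>]] lin_comp[OF bilinD(2)[OF \<beta>]] bilinD(3)[OF \<beta>]
  let ?\<tau> = "\<lambda>p q s. \<epsilon> q \<odot>\<^bsub>P\<^esub> \<beta> p s"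
  have \<tau>: "trilin k H H H P ?\<tau>" by (intro trilinI bilinI lin_intros)
  have middle: "lift k H H P (\<lambda>a b. lift k H H P (\<lambda>c d. ?\<tau> c d b) (\<Delta> a)) (\<Delta> \<one>\<^bsub>H\<^esub>) = lift k H H P \<beta> (\<Delta> \<one>\<^bsub>H\<^esub>)"
    by (rule lift_cong; (intro bilinI lin_intros counit_r_of_lin)?)
  have "lift k H H P (\<lambda>a b. \<beta> a (et b)) (\<Delta> \<one>\<^bsub>H\<^esub>) =
      lift k H H P (\<lambda>a b. lift k H H P (\<lambda>c d. ?\<tau> a (c \<otimes>\<^bsub>H\<^esub> b) d) (\<Delta> \<one>\<^bsub>H\<^esub>)) (\<Delta> \<one>\<^bsub>H\<^esub>)"
    by (rule lift_cong; (intro bilinI lin_intros lin_of_eps_t)?)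
  also have "\<dots> = lift k H H P \<beta> (\<Delta> \<one>\<^bsub>H\<^esub>)"
    by (simp only: lift_right_comonoidal[OF P \<tau>, symmetric] middle)
  finally show "lift k H H P (\<lambda>a b. \<beta> a (et b)) (\<Delta> \<one>\<^bsub>H\<^esub>) = lift k H H P \<beta> (\<Delta> \<one>\<^bsub>H\<^esub>)" .
  have "lift k H H P (\<lambda>a b. \<beta> (es a) b) (\<Delta> \<one>\<^bsub>H\<^esub>) =
      lift k H H P (\<lambda>a b. lift k H H P (\<lambda>c d. ?\<tau> c (d \<otimes>\<^bsub>H\<^esub> a) b) (\<Delta> \<one>\<^bsub>H\<^esub>)) (\<Delta> \<one>\<^bsub>H\<^esub>)"
    by (rule lift_cong; (intro bilinI lin_intros lin_of_eps_s_bar[where g = "\<lambda>x. \<beta> x b" for b])?)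
  also have "\<dots> = lift k H H P (\<lambda>c d. lift k H H P (\<lambda>a b. ?\<tau> c (d \<otimes>\<^bsub>H\<^esub> a) b) (\<Delta> \<one>\<^bsub>H\<^esub>)) (\<Delta> \<one>\<^bsub>H\<^esub>)"
    by (rule lift_swap; (intro bilinI lin_intros)?)
  also have "\<dots> = lift k H H P \<beta> (\<Delta> \<one>\<^bsub>H\<^esub>)"
    by (simp only: lift_left_comonoidal[OF P \<tau>, symmetric] middle)
  finally show "lift k H H P (\<lambda>a b. \<beta> (es a) b) (\<Delta> \<one>\<^bsub>H\<^esub>) = lift k H H P \<beta> (\<Delta> \<one>\<^bsub>H\<^esub>)" .
qed

text \<open>
  In \<open>\<epsilon>\<^sub>t(y h) = \<epsilon>(1\<^sub>1 y h) 1\<^sub>2\<close> the factor \<open>y\<close> moves to the second leg as \<open>\<epsilon>\<^sub>t(y)\<close>. The next lemma is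
  its mirror image.
\<close>

lemma eps_t_antimult:
  assumes y: "y \<in> Hs" and h: "h \<in> carrier H" shows "et (y \<otimes>\<^bsub>H\<^esub> h) = et h \<otimes>\<^bsub>H\<^esub> et y"
proof -
  note yH = Hs_closed[OF y]
  note [lin_intros] = y h yH
  have "et (y \<otimes>\<^bsub>H\<^esub> h) = lift k H H H (\<lambda>a b. \<epsilon> ((a \<otimes>\<^bsub>H\<^esub> y) \<otimes>\<^bsub>H\<^esub> h) \<odot>\<^bsub>H\<^esub> b) (\<Delta> \<one>\<^bsub>H\<^esub>)"
    unfolding eps_t_def by (rule lift_cong; (intro bilinI lin_intros)?; simp add: A.m_assoc yH h)
  also have "\<dots> = lift k H H H (\<lambda>a b. \<epsilon> (a \<otimes>\<^bsub>H\<^esub> h) \<odot>\<^bsub>H\<^esub> (b \<otimes>\<^bsub>H\<^esub> et y)) (\<Delta> \<one>\<^bsub>H\<^esub>)"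
    by (rule move_Hs[where \<beta> = "\<lambda>a b. \<epsilon> (a \<otimes>\<^bsub>H\<^esub> h) \<odot>\<^bsub>H\<^esub> b"]; (intro bilinI lin_intros)?)
  also have "\<dots> = et h \<otimes>\<^bsub>H\<^esub> et y"
    by (rule lin_of_eps_t[where g = "\<lambda>x. x \<otimes>\<^bsub>H\<^esub> et y", symmetric]; (intro bilinI lin_intros)?)
  finally show ?thesis .
qed

lemma eps_s_bar_antimult:
  assumes z: "z \<in> Ht" and h: "h \<in> carrier H" shows "es (z \<otimes>\<^bsub>H\<^esub> h) = es h \<otimes>\<^bsub>H\<^esub> es z"
proof -
  note zH = Ht_closed[OF z]
  note [lin_intros] = z h zH
  have "es (z \<otimes>\<^bsub>H\<^esub> h) = lift k H H H (\<lambda>a b. \<epsilon> ((b \<otimes>\<^bsub>H\<^esub> z) \<otimes>\<^bsub>H\<^esub> h) \<odot>\<^bsub>H\<^esub> a) (\<Delta> \<one>\<^bsub>H\<^esub>)"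
    unfolding eps_s_bar_def by (rule lift_cong; (intro bilinI lin_intros)?; simp add: A.m_assoc zH h)
  also have "\<dots> = lift k H H H (\<lambda>a b. \<epsilon> (b \<otimes>\<^bsub>H\<^esub> h) \<odot>\<^bsub>H\<^esub> (a \<otimes>\<^bsub>H\<^esub> es z)) (\<Delta> \<one>\<^bsub>H\<^esub>)"
    by (rule move_Ht[where \<beta> = "\<lambda>a b. \<epsilon> (b \<otimes>\<^bsub>H\<^esub> h) \<odot>\<^bsub>H\<^esub> a"]; (intro bilinI lin_intros)?)
  also have "\<dots> = es h \<otimes>\<^bsub>H\<^esub> es z"
    by (rule lin_of_eps_s_bar[where g = "\<lambda>x. x \<otimes>\<^bsub>H\<^esub> es z", symmetric]; (intro bilinI lin_intros)?)
  finally show ?thesis .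
qed

text \<open>Apply the counit to one leg of the identities \<open>move_Ht\<close> and \<open>move_Hs\<close>.\<close>

lemma eps_t_eps_s_bar: assumes z: "z \<in> Ht" shows "et (es z) = z"
proof -
  note zH = Ht_closed[OF z]
  note [lin_intros] = z zH
  have "et (es z) = lift k H H H (\<lambda>a b. \<epsilon> a \<odot>\<^bsub>H\<^esub> (b \<otimes>\<^bsub>H\<^esub> z)) (\<Delta> \<one>\<^bsub>H\<^esub>)"
    unfolding eps_t_def by (rule move_Ht[where \<beta> = "\<lambda>a b. \<epsilon> a \<odot>\<^bsub>H\<^esub> b", symmetric]; (intro bilinI lin_intros)?)
  also have "\<dots> = \<one>\<^bsub>H\<^esub> \<otimes>\<^bsub>H\<^esub> z"
    by (rule counit_l_of_lin; (intro bilinI lin_intros)?)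
  finally show ?thesis by (simp add: zH)
qed

lemma eps_s_bar_eps_t: assumes y: "y \<in> Hs" shows "es (et y) = y"
proof -
  note yH = Hs_closed[OF y]
  note [lin_intros] = y yH
  have "es (et y) = lift k H H H (\<lambda>a b. \<epsilon> b \<odot>\<^bsub>H\<^esub> (a \<otimes>\<^bsub>H\<^esub> y)) (\<Delta> \<one>\<^bsub>H\<^esub>)"
    unfolding eps_s_bar_def by (rule move_Hs[where \<beta> = "\<lambda>a b. \<epsilon> b \<odot>\<^bsub>H\<^esub> a", symmetric]; (intro bilinI lin_intros)?)
  also have "\<dots> = \<one>\<^bsub>H\<^esub> \<otimes>\<^bsub>H\<^esub> y"
    by (rule counit_r_of_lin; (intro bilinI lin_intros)?)
  finally show ?thesis by (simp add: yH)
qed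

end

section \<open>The target algebra of a weak bialgebra\<close>

locale weak_bialgebra_target = weak_bialgebra k H \<Delta> \<epsilon>
  for k :: "('k, 'e) ring_scheme" and H :: "('k, 'h) module"
    and \<Delta> :: "'h \<Rightarrow> ('k, 'h, 'h) tens" and \<epsilon> :: "'h \<Rightarrow> 'k"
begin

abbreviation "A \<equiv> target k H \<Delta> \<epsilon>"

text \<open>
  The first leg of \<open>\<Delta> 1\<close> lies in \<open>Hs\<close>, which \<open>et\<close> maps to \<open>Ht\<close>, and its second leg is fixed by
  \<open>et\<close>; applying \<open>et\<close> to it too makes \<open>e\<close> a tensor over the target algebra instead of \<open>H\<close>.
\<close>

definition "e = lift k H H (tensor k A A) (\<lambda>a b. pure k A A (et a) (et b)) (\<Delta> \<one>\<^bsub>H\<^esub>)"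

lemma target_simps [simp]:
  "carrier A = Ht" "mult A = mult H" "one A = one H" "zero A = zero H" "add A = add H" "smult A = smult H"
  by (simp_all add: target_def)

lemma submodule_Ht: "submodule Ht k H"
  by (rule submodule_image[OF module_algebra module_algebra eps_t_lin])

lemma module_target: "module k A"
  unfolding target_def by (rule submodule.submodule_is_module[OF submodule_Ht module_algebra])

lemma target_algebra: "assoc_algebra k A"
proof -
  interpret T: module k A by (rule module_target)
  have one: "\<one>\<^bsub>H\<^esub> \<in> Ht" by (metis eps_t_one eps_t_in_Ht one_closed)
  have "ring A"
    by (intro ringI T.abelian_group_axioms monoidI)
      (auto simp: Ht_closed Ht_mult one A.m_assoc A.l_distr A.r_distr)
  then show ?thesis
    by (intro assoc_algebra.intro module_target assoc_algebra_axioms.intro)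
      (auto simp: Ht_closed smult_mult_l smult_mult_r)
qed

sublocale T: assoc_algebra k A
  by (rule target_algebra)

lemma lin_incl [lin_intros]: "(\<lambda>x. x) \<in> lin k A H"
  by (rule linI) (auto simp: Ht_closed)

lemma lin_into_target [lin_intros]:
  assumes "f \<in> lin k X H" shows "(\<lambda>x. et (f x)) \<in> lin k X A"
proof -
  have "et \<in> lin k H A"
    by (rule linI) (simp_all add: eps_t_in_Ht lin_add[OF eps_t_lin] lin_smult[OF eps_t_lin])
  from lin_comp[OF this assms] show ?thesis .
qed

lemma eps_t_target [lin_intros]: "h \<in> carrier H \<Longrightarrow> et h \<in> carrier A"
  by (simp add: eps_t_in_Ht)

lemma e_closed [lin_intros]: "e \<in> carrier (tensor k A A)"
  unfolding e_def by (intro bilinI lin_intros)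

lemma lift_e:
  assumes P: "module k P" and \<beta>: "bilin k A A P \<beta>"
  shows "lift k A A P \<beta> e = lift k H H P (\<lambda>a b. \<beta> (et a) (et b)) (\<Delta> \<one>\<^bsub>H\<^esub>)"
  unfolding e_def by (rule lift_lift_pure; (intro bilinI lin_intros P \<beta>)?)

text \<open>
  With \<open>e = x \<otimes> z\<close>, this is \<open>\<Delta>(1) = es x \<otimes> z\<close>. It rewrites every structure that is defined by
  \<open>\<Delta> 1\<close> in terms of \<open>e\<close> and the right action of the target algebra, which is through \<open>es\<close>.
\<close>

lemma comult_one_via_e:
  assumes P: "module k P" and \<beta>: "bilin k H H P \<beta>"
  shows "lift k H H P \<beta> (\<Delta> \<one>\<^bsub>H\<^esub>) = lift k A A P (\<lambda>x z. \<beta> (es x) z) e"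
proof -
  note [lin_intros] = P \<beta> lin_comp[OF bilinD(1)[OF \<beta>]] lin_comp[OF bilinD(2)[OF \<beta>]]
  have "lift k A A P (\<lambda>x z. \<beta> (es x) z) e = lift k H H P (\<lambda>a b. \<beta> (es (et a)) (et b)) (\<Delta> \<one>\<^bsub>H\<^esub>)"
    by (rule lift_e; (intro bilinI lin_intros)?; simp add: Ht_closed)
  also have "\<dots> = lift k H H P (\<lambda>a b. \<beta> (es (et (es a))) (et b)) (\<Delta> \<one>\<^bsub>H\<^esub>)"
    by (rule comult_one_eps_s_bar[symmetric]; (intro bilinI lin_intros)?)
  also have "\<dots> = lift k H H P (\<lambda>a b. \<beta> (es a) (et b)) (\<Delta> \<one>\<^bsub>H\<^esub>)"
    by (rule lift_cong; (intro bilinI lin_intros)?; simp add: eps_s_bar_eps_t)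
  also have "\<dots> = lift k H H P (\<lambda>a b. \<beta> a (et b)) (\<Delta> \<one>\<^bsub>H\<^esub>)"
    by (rule comult_one_eps_s_bar; (intro bilinI lin_intros)?)
  also have "\<dots> = lift k H H P \<beta> (\<Delta> \<one>\<^bsub>H\<^esub>)"
    by (rule comult_one_eps_t; (intro bilinI lin_intros)?)
  finally show ?thesis by (rule sym)
qed

text \<open>
  In \<open>et 1\<^sub>1 \<otimes> (et 1\<^sub>2) w\<close>, the factor \<open>w\<close> moves across \<open>\<Delta> 1\<close> to the first leg as \<open>es w\<close>, and the
  antimultiplicativity of \<open>et\<close> brings it out in front as \<open>et (es w) = w\<close>. The insertions of \<open>et\<close>
  and \<open>es\<close> in between keep each leg in the image to which the next identity applies.
\<close>

lemma casimir_e: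
  assumes w: "w \<in> carrier A"
  shows "lift k A A (tensor k A A) (\<lambda>x z. pure k A A (w \<otimes>\<^bsub>A\<^esub> x) z) e =
      lift k A A (tensor k A A) (\<lambda>x z. pure k A A x (z \<otimes>\<^bsub>A\<^esub> w)) e"
proof -
  have wH: "w \<in> Ht" "w \<in> carrier H" using w by (auto simp: Ht_closed)
  note [lin_intros] = w wH
  have closed: "et (et b \<otimes>\<^bsub>H\<^esub> w) = et b \<otimes>\<^bsub>H\<^esub> w" if "b \<in> carrier H" for b
    by (rule eps_t_fix[OF Ht_mult[OF eps_t_in_Ht[OF that] wH(1)]])
  have "lift k A A (tensor k A A) (\<lambda>x z. pure k A A x (z \<otimes>\<^bsub>A\<^esub> w)) e = lift k H H (tensor k A A) (\<lambda>a b. pure k A A (et a) (et b \<otimes>\<^bsub>A\<^esub> w)) (\<Delta> \<one>\<^bsub>H\<^esub>)"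
    by (rule lift_e; (intro bilinI lin_intros)?)
  also have "\<dots> = lift k H H (tensor k A A) (\<lambda>a b. pure k A A (et a) (et (et b \<otimes>\<^bsub>H\<^esub> w))) (\<Delta> \<one>\<^bsub>H\<^esub>)"
    by (rule lift_cong; (intro bilinI lin_intros)?; simp add: closed)
  also have "\<dots> = lift k H H (tensor k A A) (\<lambda>a b. pure k A A (et a) (et (b \<otimes>\<^bsub>H\<^esub> w))) (\<Delta> \<one>\<^bsub>H\<^esub>)"
    by (rule comult_one_eps_t[where \<beta> = "\<lambda>a b. pure k A A (et a) (et (b \<otimes>\<^bsub>H\<^esub> w))"]; (intro bilinI lin_intros)?)
  also have "\<dots> = lift k H H (tensor k A A) (\<lambda>a b. pure k A A (et (a \<otimes>\<^bsub>H\<^esub> es w)) (et b)) (\<Delta> \<one>\<^bsub>H\<^esub>)"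
    by (rule move_Ht[where \<beta> = "\<lambda>a b. pure k A A (et a) (et b)"]; (intro bilinI lin_intros)?)
  also have "\<dots> = lift k H H (tensor k A A) (\<lambda>a b. pure k A A (et (es a \<otimes>\<^bsub>H\<^esub> es w)) (et b)) (\<Delta> \<one>\<^bsub>H\<^esub>)"
    by (rule comult_one_eps_s_bar[where \<beta> = "\<lambda>a b. pure k A A (et (a \<otimes>\<^bsub>H\<^esub> es w)) (et b)", symmetric];
        (intro bilinI lin_intros)?)
  also have "\<dots> = lift k H H (tensor k A A) (\<lambda>a b. pure k A A (w \<otimes>\<^bsub>A\<^esub> et (es a)) (et b)) (\<Delta> \<one>\<^bsub>H\<^esub>)"
    by (rule lift_cong; (intro bilinI lin_intros)?;
        simp add: eps_t_antimult eps_s_bar_in_Hs eps_s_bar_closed eps_t_eps_s_bar wH)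
  also have "\<dots> = lift k H H (tensor k A A) (\<lambda>a b. pure k A A (w \<otimes>\<^bsub>A\<^esub> et a) (et b)) (\<Delta> \<one>\<^bsub>H\<^esub>)"
    by (rule comult_one_eps_s_bar[where \<beta> = "\<lambda>a b. pure k A A (w \<otimes>\<^bsub>A\<^esub> et a) (et b)"]; (intro bilinI lin_intros)?)
  also have "\<dots> = lift k A A (tensor k A A) (\<lambda>x z. pure k A A (w \<otimes>\<^bsub>A\<^esub> x) z) e"
    by (rule lift_e[symmetric]; (intro bilinI lin_intros)?)
  finally show ?thesis by (rule sym)
qed

text \<open>A sum formed in the target algebra is the same as the sum formed in \<open>H\<close>, as the inclusion is linear.\<close>

lemma lift_e_into_target:
  assumes \<beta>: "bilin k A A A \<beta>"
  shows "lift k A A A \<beta> e = lift k H H H (\<lambda>a b. \<beta> (et a) (et b)) (\<Delta> \<one>\<^bsub>H\<^esub>)"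
proof -
  note [lin_intros] = \<beta> lin_comp[OF bilinD(1)[OF \<beta>]] lin_comp[OF bilinD(2)[OF \<beta>]]
  have "lift k A A A \<beta> e = lift k H H A (\<lambda>a b. \<beta> (et a) (et b)) (\<Delta> \<one>\<^bsub>H\<^esub>)"
    by (rule lift_e; (intro bilinI lin_intros)?)
  also have "\<dots> = lift k H H H (\<lambda>a b. \<beta> (et a) (et b)) (\<Delta> \<one>\<^bsub>H\<^esub>)"
    by (rule lin_lift[where g = "\<lambda>x. x" and P = A]; (intro bilinI lin_intros)?)
  finally show ?thesis .
qed

text \<open>This is \<open>\<epsilon>(1\<^sub>1\<^sub>' 1\<^sub>1) 1\<^sub>2\<^sub>' 1\<^sub>2 = \<epsilon>(1\<^sub>1) 1\<^sub>2 = 1\<close>, by \<open>\<Delta>(1) \<Delta>(1) = \<Delta>(1)\<close>.\<close>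

lemma separable_e: "lift k A A A (\<lambda>x z. x \<otimes>\<^bsub>A\<^esub> z) e = \<one>\<^bsub>A\<^esub>"
proof -
  let ?L = "\<lambda>f. lift k H H H (\<lambda>a b. f a b) (\<Delta> \<one>\<^bsub>H\<^esub>)"
  have "lift k A A A (\<lambda>x z. x \<otimes>\<^bsub>A\<^esub> z) e = ?L (\<lambda>a b. et a \<otimes>\<^bsub>A\<^esub> et b)"
    by (rule lift_e_into_target; (intro bilinI lin_intros)?)
  also have "\<dots> = ?L (\<lambda>a b. et a \<otimes>\<^bsub>H\<^esub> et b)" by simp
  also have "\<dots> = ?L (\<lambda>a b. et a \<otimes>\<^bsub>H\<^esub> b)"
    by (rule comult_one_eps_t[where \<beta> = "\<lambda>a b. et a \<otimes>\<^bsub>H\<^esub> b"]; (intro bilinI lin_intros)?)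
  also have "\<dots> = ?L (\<lambda>a b. ?L (\<lambda>c d. \<epsilon> (c \<otimes>\<^bsub>H\<^esub> a) \<odot>\<^bsub>H\<^esub> (d \<otimes>\<^bsub>H\<^esub> b)))"
    by (rule lift_cong; (intro bilinI lin_intros lin_of_eps_t[where g = "\<lambda>x. x \<otimes>\<^bsub>H\<^esub> b" for b])?)
  also have "\<dots> = ?L (\<lambda>c d. ?L (\<lambda>a b. \<epsilon> (c \<otimes>\<^bsub>H\<^esub> a) \<odot>\<^bsub>H\<^esub> (d \<otimes>\<^bsub>H\<^esub> b)))"
    by (rule lift_swap; (intro bilinI lin_intros)?)
  also have "\<dots> = ?L (\<lambda>a b. \<epsilon> a \<odot>\<^bsub>H\<^esub> b)"
    by (rule lift_comult_one(1)[where \<beta> = "\<lambda>p q. \<epsilon> p \<odot>\<^bsub>H\<^esub> q"]; (intro bilinI lin_intros)?)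
  finally show ?thesis by (simp add: counit_l)
qed

lemma counit_eps_t: assumes "h \<in> carrier H" shows "\<epsilon> (et h) = \<epsilon> h"
  using counit_mult_eps_t[OF one_closed assms] assms by (simp add: eps_t_closed)

lemma counit_e:
  shows "lift k A A A (\<lambda>x z. \<epsilon> x \<odot>\<^bsub>A\<^esub> z) e = \<one>\<^bsub>A\<^esub>"
    and "lift k A A A (\<lambda>x z. \<epsilon> z \<odot>\<^bsub>A\<^esub> x) e = \<one>\<^bsub>A\<^esub>"
proof -
  let ?L = "\<lambda>f. lift k H H H (\<lambda>a b. f a b) (\<Delta> \<one>\<^bsub>H\<^esub>)"
  have "lift k A A A (\<lambda>x z. \<epsilon> x \<odot>\<^bsub>A\<^esub> z) e = ?L (\<lambda>a b. \<epsilon> (et a) \<odot>\<^bsub>A\<^esub> et b)"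
    by (rule lift_e_into_target; (intro bilinI lin_intros)?; simp add: Ht_closed counit_closed)
  also have "\<dots> = ?L (\<lambda>a b. \<epsilon> (et a) \<odot>\<^bsub>H\<^esub> et b)" by simp
  also have "\<dots> = ?L (\<lambda>a b. \<epsilon> a \<odot>\<^bsub>H\<^esub> et b)"
    by (rule lift_cong; (intro bilinI lin_intros)?; simp add: counit_eps_t)
  also have "\<dots> = et \<one>\<^bsub>H\<^esub>"
    by (rule counit_l_of_lin; (intro bilinI lin_intros)?)
  finally show "lift k A A A (\<lambda>x z. \<epsilon> x \<odot>\<^bsub>A\<^esub> z) e = \<one>\<^bsub>A\<^esub>" by (simp add: eps_t_one)
  have "lift k A A A (\<lambda>x z. \<epsilon> z \<odot>\<^bsub>A\<^esub> x) e = ?L (\<lambda>a b. \<epsilon> (et b) \<odot>\<^bsub>A\<^esub> et a)"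
    by (rule lift_e_into_target; (intro bilinI lin_intros)?; simp add: Ht_closed counit_closed)
  also have "\<dots> = ?L (\<lambda>a b. \<epsilon> (et b) \<odot>\<^bsub>H\<^esub> et a)" by simp
  also have "\<dots> = ?L (\<lambda>a b. \<epsilon> b \<odot>\<^bsub>H\<^esub> et a)"
    by (rule lift_cong; (intro bilinI lin_intros)?; simp add: counit_eps_t)
  also have "\<dots> = et \<one>\<^bsub>H\<^esub>"
    by (rule counit_r_of_lin; (intro bilinI lin_intros)?)
  finally show "lift k A A A (\<lambda>x z. \<epsilon> z \<odot>\<^bsub>A\<^esub> x) e = \<one>\<^bsub>A\<^esub>" by (simp add: eps_t_one)
qed

text \<open>
  Write the first leg of \<open>\<Delta> 1\<close> as \<open>es a\<close>; then \<open>et (es a \<otimes> w) = w \<otimes> et (es a)\<close>, where \<open>\<otimes>\<close> is the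
  product of \<open>H\<close>.
\<close>

lemma comult_t_eq:
  assumes w: "w \<in> carrier A"
  shows "comult_t k H \<Delta> \<epsilon> w = lift k A A (tensor k A A) (\<lambda>x z. pure k A A (w \<otimes>\<^bsub>A\<^esub> x) z) e"
proof -
  have wH: "w \<in> Ht" "w \<in> carrier H" using w by (auto simp: Ht_closed)
  note [lin_intros] = w wH
  have "comult_t k H \<Delta> \<epsilon> w = lift k H H (tensor k A A) (\<lambda>a b. pure k A A (et (a \<otimes>\<^bsub>H\<^esub> w)) (et b)) (\<Delta> \<one>\<^bsub>H\<^esub>)"
    by (simp add: comult_t_def Let_def)
  also have "\<dots> = lift k H H (tensor k A A) (\<lambda>a b. pure k A A (et (es a \<otimes>\<^bsub>H\<^esub> w)) (et b)) (\<Delta> \<one>\<^bsub>H\<^esub>)"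
    by (rule comult_one_eps_s_bar[where \<beta> = "\<lambda>a b. pure k A A (et (a \<otimes>\<^bsub>H\<^esub> w)) (et b)", symmetric];
        (intro bilinI lin_intros)?)
  also have "\<dots> = lift k H H (tensor k A A) (\<lambda>a b. pure k A A (w \<otimes>\<^bsub>A\<^esub> et (es a)) (et b)) (\<Delta> \<one>\<^bsub>H\<^esub>)"
    by (rule lift_cong; (intro bilinI lin_intros)?; simp add: eps_t_antimult eps_s_bar_in_Hs eps_t_fix[OF wH(1)] wH)
  also have "\<dots> = lift k H H (tensor k A A) (\<lambda>a b. pure k A A (w \<otimes>\<^bsub>A\<^esub> et a) (et b)) (\<Delta> \<one>\<^bsub>H\<^esub>)"
    by (rule comult_one_eps_s_bar[where \<beta> = "\<lambda>a b. pure k A A (w \<otimes>\<^bsub>A\<^esub> et a) (et b)"]; (intro bilinI lin_intros)?)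
  also have "\<dots> = lift k A A (tensor k A A) (\<lambda>x z. pure k A A (w \<otimes>\<^bsub>A\<^esub> x) z) e"
    by (rule lift_e[symmetric]; (intro bilinI lin_intros)?)
  finally show ?thesis .
qed

lemma separable_frobenius_target: "separable_frobenius k A e (comult_t k H \<Delta> \<epsilon>) \<epsilon>"
proof
  show "\<epsilon> \<in> lin k A (regular_module k)" by (rule lin_counit[OF lin_incl])
qed (rule e_closed casimir_e separable_e counit_e comult_t_eq; assumption)+

lemma frobenius_bimodule_target:
  assumes "left_module k H M act"
  shows "frobenius_bimodule k A e (comult_t k H \<Delta> \<epsilon>) \<epsilon> M act (ract_t k H \<Delta> \<epsilon> act)
      (lcoact_t k H \<Delta> \<epsilon> M act) (rcoact_t k H \<Delta> \<epsilon> M act)"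
proof -
  interpret M: left_module k H M act by fact
  interpret F: separable_frobenius k A e "comult_t k H \<Delta> \<epsilon>" \<epsilon> by (rule separable_frobenius_target)
  show ?thesis
  proof
    fix m assume m [lin_intros]: "m \<in> carrier M"
    show "(\<lambda>a. act a m) \<in> lin k A M" by (intro lin_intros)
    show "ract_t k H \<Delta> \<epsilon> act m \<in> lin k A M" unfolding ract_t_def by (intro lin_intros)
    show "act \<one>\<^bsub>A\<^esub> m = m" using m by (simp add: M.l_one)
    show "ract_t k H \<Delta> \<epsilon> act m \<one>\<^bsub>A\<^esub> = m" using m by (simp add: ract_t_def eps_s_bar_one M.l_one)
    show "lcoact_t k H \<Delta> \<epsilon> M act m = lift k A A (tensor k A M) (\<lambda>x z. pure k A M x (act z m)) e"
    proof -
      have "lcoact_t k H \<Delta> \<epsilon> M act m = lift k H H (tensor k A M) (\<lambda>a b. pure k A M (et a) (act b m)) (\<Delta> \<one>\<^bsub>H\<^esub>)"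
        by (simp add: lcoact_t_def Let_def)
      also have "\<dots> = lift k A A (tensor k A M) (\<lambda>x z. pure k A M (et (es x)) (act z m)) e"
        by (rule comult_one_via_e; (intro bilinI lin_intros)?)
      also have "\<dots> = lift k A A (tensor k A M) (\<lambda>x z. pure k A M x (act z m)) e"
        by (rule lift_cong; (intro bilinI lin_intros)?; simp add: Ht_closed eps_t_eps_s_bar)
      finally show ?thesis .
    qed
    show "rcoact_t k H \<Delta> \<epsilon> M act m =
        lift k A A (tensor k M A) (\<lambda>x z. pure k M A (ract_t k H \<Delta> \<epsilon> act m x) z) e"
    proof -
      have "rcoact_t k H \<Delta> \<epsilon> M act m = lift k H H (tensor k M A) (\<lambda>a b. pure k M A (act a m) (et b)) (\<Delta> \<one>\<^bsub>H\<^esub>)"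
        by (simp add: rcoact_t_def Let_def)
      also have "\<dots> = lift k A A (tensor k M A) (\<lambda>x z. pure k M A (act (es x) m) (et z)) e"
        by (rule comult_one_via_e; (intro bilinI lin_intros)?)
      also have "\<dots> = lift k A A (tensor k M A) (\<lambda>x z. pure k M A (ract_t k H \<Delta> \<epsilon> act m x) z) e"
        by (rule lift_cong; (intro bilinI lin_intros)?; (simp only: eps_t_fix ract_t_def target_simps)?; simp add: Ht_closed)
      finally show ?thesis .
    qed
    fix a b assume ab: "a \<in> carrier A" "b \<in> carrier A"
    then have abH: "a \<in> carrier H" "b \<in> carrier H" "a \<in> Ht" "b \<in> Ht" by (auto simp: Ht_closed)
    show "act (a \<otimes>\<^bsub>A\<^esub> b) m = act a (act b m)"
      using m abH by (simp add: M.l_assoc)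
    show "ract_t k H \<Delta> \<epsilon> act m (a \<otimes>\<^bsub>A\<^esub> b) = ract_t k H \<Delta> \<epsilon> act (ract_t k H \<Delta> \<epsilon> act m a) b"
      using m abH by (simp add: ract_t_def eps_s_bar_antimult M.l_assoc eps_s_bar_closed)
    have "a \<otimes>\<^bsub>H\<^esub> es b = es b \<otimes>\<^bsub>H\<^esub> a"
      by (rule Ht_Hs_commute[OF abH(3) eps_s_bar_in_Hs[OF abH(2)]])
    then show "ract_t k H \<Delta> \<epsilon> act (act a m) b = act a (ract_t k H \<Delta> \<epsilon> act m b)"
      using m abH by (simp add: ract_t_def M.l_assoc[symmetric] eps_s_bar_closed)
  next
    fix a assume "a \<in> carrier A"
    then have [lin_intros]: "a \<in> carrier H" by (auto simp: Ht_closed)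
    show "act a \<in> lin k M M" by (intro lin_intros)
    show "(\<lambda>m. ract_t k H \<Delta> \<epsilon> act m a) \<in> lin k M M" unfolding ract_t_def by (intro lin_intros)
  qed
qed

lemma frobenius_tensor_target:
  assumes "left_module k H M actM" and "left_module k H N actN"
  shows "frobenius_tensor k A e (comult_t k H \<Delta> \<epsilon>) \<epsilon> M (ract_t k H \<Delta> \<epsilon> actM) (rcoact_t k H \<Delta> \<epsilon> M actM)
      N actN (lcoact_t k H \<Delta> \<epsilon> N actN) (proj k H \<Delta> M actM N actN)"
proof -
  interpret M: left_module k H M actM by fact
  interpret N: left_module k H N actN by fact
  interpret FM: frobenius_bimodule k A e "comult_t k H \<Delta> \<epsilon>" \<epsilon> M actM "ract_t k H \<Delta> \<epsilon> actM"
      "lcoact_t k H \<Delta> \<epsilon> M actM" "rcoact_t k H \<Delta> \<epsilon> M actM"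
    by (rule frobenius_bimodule_target) fact
  interpret FN: frobenius_bimodule k A e "comult_t k H \<Delta> \<epsilon>" \<epsilon> N actN "ract_t k H \<Delta> \<epsilon> actN"
      "lcoact_t k H \<Delta> \<epsilon> N actN" "rcoact_t k H \<Delta> \<epsilon> N actN"
    by (rule frobenius_bimodule_target) fact
  show ?thesis
  proof
    fix u assume [lin_intros]: "u \<in> carrier (tensor k M N)"
    have *: "lift k H H (tensor k M N) (\<lambda>a b. pure k M N (actM a m) (actN b n)) (\<Delta> \<one>\<^bsub>H\<^esub>) =
        lift k A A (tensor k M N) (\<lambda>x z. pure k M N (ract_t k H \<Delta> \<epsilon> actM m x) (actN z n)) e"
      if [lin_intros]: "m \<in> carrier M" "n \<in> carrier N" for m n
      unfolding ract_t_def by (rule comult_one_via_e; (intro bilinI lin_intros)?)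
    show "proj k H \<Delta> M actM N actN u = lift k M N (tensor k M N) (\<lambda>m n. lift k A A (tensor k M N)
        (\<lambda>x z. pure k M N (ract_t k H \<Delta> \<epsilon> actM m x) (actN z n)) e) u"
      unfolding proj_def by (rule lift_cong; (intro bilinI M.lin_left_action N.lin_left_action lin_intros *)?)
  qed
qed

end

theorem corollary4p5:
  fixes k :: "'k ring"
    and H :: "('k, 'h) module" and \<Delta> :: "'h \<Rightarrow> ('k, 'h, 'h) tens" and \<epsilon> :: "'h \<Rightarrow> 'k"
    and M :: "('k, 'm) module" and actM :: "'h \<Rightarrow> 'm \<Rightarrow> 'm"
    and N :: "('k, 'n) module" and actN :: "'h \<Rightarrow> 'n \<Rightarrow> 'n"
  assumes "cring k"
    and "weak_bialgebra k H \<Delta> \<epsilon>"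
    and "left_module k H M actM"
    and "left_module k H N actN"
  shows "bimodule k (target k H \<Delta> \<epsilon>) M actM (ract_t k H \<Delta> \<epsilon> actM) \<and>
     bimodule k (target k H \<Delta> \<epsilon>) N actN (ract_t k H \<Delta> \<epsilon> actN) \<and>
     bicomodule k (target k H \<Delta> \<epsilon>) (comult_t k H \<Delta> \<epsilon>) \<epsilon>
           M (lcoact_t k H \<Delta> \<epsilon> M actM) (rcoact_t k H \<Delta> \<epsilon> M actM) \<and>
     bicomodule k (target k H \<Delta> \<epsilon>) (comult_t k H \<Delta> \<epsilon>) \<epsilon>
           N (lcoact_t k H \<Delta> \<epsilon> N actN) (rcoact_t k H \<Delta> \<epsilon> N actN) \<and>
     submodule (tensor_im k H \<Delta> M actM N actN) k (tensor k M N) \<and>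
     cotensor k (target k H \<Delta> \<epsilon>) M N
           (rcoact_t k H \<Delta> \<epsilon> M actM) (lcoact_t k H \<Delta> \<epsilon> N actN)
         = tensor_im k H \<Delta> M actM N actN \<and>
     (\<exists>\<phi> \<in> lin_iso k (tensor_coim k H \<Delta> M actM N actN)
                ((tensor k M N)\<lparr>carrier := tensor_im k H \<Delta> M actM N actN\<rparr>).
           \<forall>x \<in> carrier (tensor k M N).
             \<phi> (proj_ker k H \<Delta> M actM N actN +>\<^bsub>tensor k M N\<^esub> x) = proj k H \<Delta> M actM N actN x) \<and>
     tensor_coim k H \<Delta> M actM N actN
         = balanced_tensor k (target k H \<Delta> \<epsilon>) M N (ract_t k H \<Delta> \<epsilon> actM) actN"
proof -
  interpret W: weak_bialgebra_target k H \<Delta> \<epsilon>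
    using assms(2) by (simp add: weak_bialgebra_target_def)
  interpret M: frobenius_bimodule k W.A W.e "comult_t k H \<Delta> \<epsilon>" \<epsilon> M actM "ract_t k H \<Delta> \<epsilon> actM"
      "lcoact_t k H \<Delta> \<epsilon> M actM" "rcoact_t k H \<Delta> \<epsilon> M actM"
    by (rule W.frobenius_bimodule_target[OF assms(3)])
  interpret N: frobenius_bimodule k W.A W.e "comult_t k H \<Delta> \<epsilon>" \<epsilon> N actN "ract_t k H \<Delta> \<epsilon> actN"
      "lcoact_t k H \<Delta> \<epsilon> N actN" "rcoact_t k H \<Delta> \<epsilon> N actN"
    by (rule W.frobenius_bimodule_target[OF assms(4)])
  interpret MN: frobenius_tensor k W.A W.e "comult_t k H \<Delta> \<epsilon>" \<epsilon> M "ract_t k H \<Delta> \<epsilon> actM" "rcoact_t k H \<Delta> \<epsilon> M actM"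
      N actN "lcoact_t k H \<Delta> \<epsilon> N actN" "proj k H \<Delta> M actM N actN"
    by (rule W.frobenius_tensor_target[OF assms(3,4)])
  have mod: "module k (tensor k M N)"
    by (rule module_tensorI[OF M.module_left_module N.module_left_module])
  show ?thesis
    using M.bimodule_axioms N.bimodule_axioms M.bicomodule N.bicomodule
      submodule_image[OF mod mod MN.pi_lin] MN.cotensor_eq_image
      first_isomorphism[OF mod mod MN.pi_lin] MN.kernel_eq_balanced
    unfolding tensor_im_def tensor_coim_def balanced_tensor_def proj_ker_def by (intro conjI) simp_all
qed

end
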